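(* Let $\lambda>0$ be a fixed real number, let $z=\lambda a$, and let $N$ be a positive integer. Then \[ \Gamma(-a,z)=z^{-a}e^{-z}\left(\sum_{n=0}^{N-1}\frac{a^n b_n(-\lambda)}{(z+a)^{2n+1}}+R_N(a,\lambda)\right) \] for $|\arg a|<-\omega+\pi$, where the coefficients are given by \[ b_n(-\lambda)=(\lambda+1)^n\left[\frac{d^n}{dt^n}\left(\frac{(\lambda+1)t}{\lambda e^t+t-\lambda}\right)^{n+1}\right]_{t=0}\qquad (n\ge 0), \] and, for $n\geq 1$, also \[ b_n(-\lambda)=(-1)^n\frac{(\lambda+1)^{2n+1}}{\sqrt{2\pi}\,i}\int_0^{+\infty}t^{n-\frac12}e^{-t|\lambda+\log\lambda+1+\pi i|}\left(e^{(n+\frac12)\omega i}\,\Gamma^\ast(te^{i\omega})-e^{-(n+\frac12)\omega i}\,\Gamma^\ast(te^{-i\omega})\right)dt , \] and the remainder term is given by \[ \begin{aligned} R_N(a,\lambda)=\;&\frac{(-1)^N a^N}{(z+a)^{2N+1}}(\lambda+1)^{2N+1}\frac{e^{(N+\frac12)\omega i}}{\sqrt{2\pi}\,i}\int_0^{+\infty}\frac{t^{N-\frac12}e^{-t|\lambda+\log\lambda+1+\pi i|}}{1+te^{i\omega}/a}\,\Gamma^\ast(te^{i\omega})\,dt\\ &+\frac{(-1)^{N+1}a^N}{(z+a)^{2N+1}}(\lambda+1)^{2N+1}\frac{e^{-(N+\frac12)\omega i}}{\sqrt{2\pi}\,i}\int_0^{+\infty}\frac{t^{N-\frac12}e^{-t|\lambda+\log\lambda+1+\pi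 i|}}{1+te^{-i\omega}/a}\,\Gamma^\ast(te^{-i\omega})\,dt . \end{aligned} \]
   Context: $\Gamma(\cdot,\cdot)$ is the (upper) incomplete gamma function, $a$ is a nonzero complex number, and all multivalued functions take their principal values. $\log\lambda$ is the real logarithm. For $\lambda>0$, $\omega=\omega(\lambda)=\arg(\lambda+\log\lambda+1+\pi i)\in(0,\pi)$. The scaled gamma function is \[ \Gamma^\ast(z)=\frac{\Gamma(z)}{\sqrt{2\pi}\,z^{z-\frac12}e^{-z}},\qquad |\arg z|<\pi . \] The function $t\mapsto \frac{(\lambda+1)t}{\lambda e^t+t-\lambda}$ is understood to take the value $1$ at its removable singularity $t=0$. *)

theory Defs
  imports "HOL-Analysis.Analysis"
begin

text \<open>
  The upper incomplete gamma function, i.e. the integral of \<open>w powr (s - 1) * exp (- w)\<close> from \<open>z\<close>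
  to infinity along a path that avoids the cut \<open>{x. x \<le> 0}\<close> of the principal branch of the integrand.
  The path used here is the horizontal ray \<open>w = z + u\<close>, \<open>u > 0\<close>. For \<open>z\<close> off the cut it does not
  meet the cut, and the integral converges absolutely for every \<open>s\<close>. Values at \<open>z\<close> on the cut are
  not meaningful in general.
\<close>
definition upper_incomplete_Gamma :: "complex \<Rightarrow> complex \<Rightarrow> complex" where
  "upper_incomplete_Gamma s z =
     (LBINT u:{0<..}. (z + complex_of_real u) powr (s - 1) * exp (- (z + complex_of_real u)))"

definition scaled_Gamma :: "complex \<Rightarrow> complex" where
  "scaled_Gamma z =
     Gamma z / (complex_of_real (sqrt (2 * pi)) * z powr (z - 1 / 2) * exp (- z))"

definition log_const :: "real \<Rightarrow> complex" where
  "log_const lam = complex_of_real (lam + ln lam + 1) + complex_of_real pi * \<i>"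

definition omega :: "real \<Rightarrow> real" where
  "omega lam = Arg (log_const lam)"

definition generating_fun :: "real \<Rightarrow> complex \<Rightarrow> complex" where
  "generating_fun lam t =
     (if t = 0 then 1
      else complex_of_real (lam + 1) * t
             / (complex_of_real lam * exp t + t - complex_of_real lam))"

text \<open>\<open>b_coeff n lam\<close> is the coefficient \<open>b\<^sub>n(- lam)\<close>: mind the sign of the argument.\<close>
definition b_coeff :: "nat \<Rightarrow> real \<Rightarrow> complex" where
  "b_coeff n lam =
     complex_of_real (lam + 1) ^ n * (deriv ^^ n) (\<lambda>t. generating_fun lam t ^ (n + 1)) 0"

definition b_integrand :: "nat \<Rightarrow> real \<Rightarrow> real \<Rightarrow> complex" where
  "b_integrand n lam t =
     complex_of_real (t powr (real n - 1 / 2) * exp (- t * norm (log_const lam)))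
     * (exp (complex_of_real ((real n + 1 / 2) * omega lam) * \<i>)
          * scaled_Gamma (complex_of_real t * exp (complex_of_real (omega lam) * \<i>))
        - exp (- complex_of_real ((real n + 1 / 2) * omega lam) * \<i>)
          * scaled_Gamma (complex_of_real t * exp (- complex_of_real (omega lam) * \<i>)))"

text \<open>The two integrands of the remainder are the cases \<open>\<theta> = omega lam\<close> and \<open>\<theta> = - omega lam\<close>.\<close>
definition remainder_integrand :: "nat \<Rightarrow> complex \<Rightarrow> real \<Rightarrow> real \<Rightarrow> real \<Rightarrow> complex" where
  "remainder_integrand N a lam \<theta> t =
     complex_of_real (t powr (real N - 1 / 2) * exp (- t * norm (log_const lam)))
     / (1 + complex_of_real t * exp (complex_of_real \<theta> * \<i>) / a)
     * scaled_Gamma (complex_of_real t * exp (complex_of_real \<theta> * \<i>))"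

definition remainder :: "nat \<Rightarrow> complex \<Rightarrow> real \<Rightarrow> complex" where
  "remainder N a lam =
     (let z = complex_of_real lam * a in
       (-1) ^ N * a ^ N / (z + a) ^ (2 * N + 1) * complex_of_real (lam + 1) ^ (2 * N + 1)
       * (exp (complex_of_real ((real N + 1 / 2) * omega lam) * \<i>)
            / (complex_of_real (sqrt (2 * pi)) * \<i>))
       * (LBINT t:{0<..}. remainder_integrand N a lam (omega lam) t)
     + (-1) ^ (N + 1) * a ^ N / (z + a) ^ (2 * N + 1) * complex_of_real (lam + 1) ^ (2 * N + 1)
       * (exp (- complex_of_real ((real N + 1 / 2) * omega lam) * \<i>)
            / (complex_of_real (sqrt (2 * pi)) * \<i>))
       * (LBINT t:{0<..}. remainder_integrand N a lam (- omega lam) t))"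

end

theory Submission
  imports Defs "HOL-Complex_Analysis.Complex_Analysis" "HOL-Probability.Sinc_Integral" "HOL-Real_Asymp.Real_Asymp"
begin

text \<open>
  Put \<open>f t = lam * exp t + t - lam\<close> and \<open>\<mu> = lam + ln lam\<close>. For \<open>Re x > 0\<close> the gamma integral gives
  \<open>Gamma x * x powr - x = \<integral> exp (x * (r - exp r)) dr\<close> over the real line. Inserting this into the
  integrals along a ray \<open>arg x = \<theta>\<close> in the right half plane and integrating in \<open>x\<close> first leaves
  \<open>\<integral> 1 / f (r + \<i> * pi) ^ (n + 1) dr\<close> for the upper ray, and the conjugate line for the lower one. Since
  \<open>0\<close> is the only zero of \<open>f\<close> in the closed strip between the two lines, their difference is a residue at
  \<open>0\<close>, and this residue is \<open>b\<^sub>n\<close> up to elementary factors.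

  For \<open>a > 0\<close>, the substitution \<open>w = a * l\<close> turns \<open>\<Gamma>(- a, lam * a)\<close> into an integral over \<open>l > lam\<close> of
  \<open>exp (- a * (l + ln l - \<mu>)) / l\<close>. One integration by parts splits off the term \<open>n = 0\<close> and leaves the
  density \<open>1 / (1 + l)\<^sup>2 = (1 + 1 / l) * (l / (1 + l) ^ 3)\<close>. The factor \<open>l / (1 + l) ^ 3\<close> is the ray integral
  for \<open>n = 1\<close> with \<open>l\<close> in place of \<open>lam\<close>, so that Fubini yields the case \<open>N = 1\<close>. A sectorial bound on
  \<open>Gamma\<close> allows the rays to be turned to \<open>arg x = \<plusminus> \<omega>\<close>, analytic continuation extends the identity to
  complex \<open>a\<close>, and expanding \<open>1 / (1 + x / a)\<close> produces the general \<open>N\<close>.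
\<close>

section \<open>Integrals over half-lines, lines and rays\<close>

text \<open>The induction starts at N = 1 because the ray integrals diverge for n = 0: the pole of
  \<open>Gamma\<close> at 0 makes their integrand behave like 1 / t, and on the strip side 1 / f
  decays only like 1 / |r| towards the left. So the term n = 0 has to be split off by parts before
  any ray appears. The factor 1 + 1 / l of the density is the derivative of s = l + ln l - \<mu>;
  integrated against exp (- (a + x) * s), it gives exactly the Cauchy kernel 1 / (a + x) of the
  remainder. Two constraints fix the angles. The gamma integral needs Re x > 0, whereas \<omega>
  exceeds pi / 2 when lam + ln lam + 1 < 0; and Fubini over l needs one angle for all l > lam,
  whereas \<omega> varies with l. Hence everything is computed on a ray of fixed angle below pi / 2
  and turned afterwards. The contour arguments (shift, residue, rotation) share one device: a global
  primitive is evaluated at two points moving along the two contours; the difference of its values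
  has the difference of the integrands as derivative and tends to 0 at both ends.\<close>

lemma integral_FTC_real_line:
  fixes D d :: "real \<Rightarrow> 'a::euclidean_space"
  assumes D: "\<And>x. (D has_vector_derivative d x) (at x)"
    and "continuous_on UNIV d" and int: "integrable lborel d"
    and "(D \<longlongrightarrow> A) at_bot" and "(D \<longlongrightarrow> B) at_top"
  shows "(LBINT x. d x) = B - A"
proof -
  have c: "isCont d x" for x
    using assms(2) by (simp add: continuous_on_eq_continuous_at)
  have "(LBINT x=-\<infinity>..\<infinity>. d x) = B - A"
    by (rule interval_integral_FTC_integrable[where F = D])
      (use assms c in \<open>auto simp: ereal_tendsto_simps set_integrable_def\<close>)
  then show ?thesis
    by (simp add: interval_lebesgue_integral_def set_lebesgue_integral_def)
qed

lemma integral_FTC_greaterThan: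
  fixes D d :: "real \<Rightarrow> 'a::euclidean_space"
  assumes D: "\<And>x. x > a \<Longrightarrow> (D has_vector_derivative d x) (at x)"
    and c: "continuous_on {a<..} d" and int: "set_integrable lborel {a<..} d"
    and "(D \<longlongrightarrow> A) (at_right a)" and "(D \<longlongrightarrow> B) at_top"
  shows "(LBINT x:{a<..}. d x) = B - A"
proof -
  have c: "isCont d x" if "x > a" for x
    using c that by (simp add: continuous_on_eq_continuous_at)
  have "(LBINT x=ereal a..\<infinity>. d x) = B - A"
    by (rule interval_integral_FTC_integrable[where F = D])
      (use assms c in \<open>auto simp: ereal_tendsto_simps\<close>)
  then show ?thesis
    by (simp add: interval_integral_to_infinity_eq)
qed

lemma set_integrable_FTC_greaterThan:
  fixes D d :: "real \<Rightarrow> real"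
  assumes D: "\<And>x. x > a \<Longrightarrow> (D has_vector_derivative d x) (at x)"
    and c: "continuous_on {a<..} d" and nn: "\<And>x. x > a \<Longrightarrow> 0 \<le> d x"
    and "(D \<longlongrightarrow> A) (at_right a)" and "(D \<longlongrightarrow> B) at_top"
  shows "set_integrable lborel {a<..} d"
proof -
  have c: "isCont d x" if "x > a" for x
    using c that by (simp add: continuous_on_eq_continuous_at)
  have "set_integrable lborel (einterval (ereal a) \<infinity>) d"
    by (rule interval_integral_FTC_nonneg(1)[where F = D])
      (use assms c in \<open>auto simp: ereal_tendsto_simps has_real_derivative_iff_has_vector_derivative\<close>)
  then show ?thesis by simp
qed

lemma set_integrable_bound_greaterThan:
  fixes f :: "real \<Rightarrow> 'a::euclidean_space" and g :: "real \<Rightarrow> real"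
  assumes "set_integrable lborel {a<..} g" "continuous_on {a<..} f"
    and "\<And>x. x > a \<Longrightarrow> norm (f x) \<le> g x"
  shows "set_integrable lborel {a<..} f"
proof (rule set_integrable_bound[OF assms(1)])
  show "set_borel_measurable lborel {a<..} f"
    using borel_measurable_continuous_on_indicator[OF _ assms(2)]
    by (simp add: set_borel_measurable_def)
  show "AE x in lborel. x \<in> {a<..} \<longrightarrow> norm (f x) \<le> norm (g x)"
    using assms(3) by (auto intro!: AE_I2 order.trans[OF _ abs_ge_self])
qed

lemma integrable_bound_continuous:
  fixes f :: "real \<Rightarrow> 'a::euclidean_space" and g :: "real \<Rightarrow> real"
  assumes "integrable lborel g" "continuous_on UNIV f" "\<And>x. norm (f x) \<le> g x"
  shows "integrable lborel f"
proof (rule Bochner_Integration.integrable_bound[OF assms(1)])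
  show "f \<in> borel_measurable lborel"
    using borel_measurable_continuous_onI[OF assms(2)] by simp
  show "AE x in lborel. norm (f x) \<le> norm (g x)"
    using assms(3) by (auto intro!: AE_I2 order.trans[OF _ abs_ge_self])
qed

section \<open>Moments of decaying exponentials\<close>

lemma tendsto_power_exp_real:
  assumes "c > (0::real)"
  shows "((\<lambda>t. t ^ n * exp (- (c * t))) \<longlongrightarrow> 0) at_top"
proof -
  have "((\<lambda>t. (1 / c ^ n) * ((c * t) ^ n / exp (c * t))) \<longlongrightarrow> (1 / c ^ n) * 0) at_top"
    using assms
    by (intro tendsto_intros filterlim_compose[OF tendsto_power_div_exp_0]
        filterlim_tendsto_pos_mult_at_top[OF tendsto_const _ filterlim_ident]) auto
  then show ?thesis
    using assms by (simp add: power_mult_distrib exp_minus field_simps)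
qed

lemma set_integrable_power_exp_real:
  assumes "c > (0::real)"
  shows "set_integrable lborel {0<..} (\<lambda>t. t ^ n * exp (- (c * t)))"
proof -
  have "(\<lambda>t. complex_of_real t powr (of_nat (Suc n) - 1) / of_real (exp (c * t)))
      absolutely_integrable_on {0<..}"
    by (rule absolutely_integrable_Gamma_integral) (use assms in auto)
  then have "(\<lambda>t. norm (complex_of_real t powr (of_nat (Suc n) - 1) / of_real (exp (c * t))))
      absolutely_integrable_on {0<..}"
    by (rule set_integrable_norm)
  also have "?this \<longleftrightarrow> (\<lambda>t. t ^ n * exp (- (c * t))) absolutely_integrable_on {0<..}"
    by (intro set_integrable_cong)
      (auto simp: norm_divide norm_powr_real_powr powr_realpow norm_power exp_minus field_simps)
  \<comment> \<open>Absolute integrability refers to Lebesgue measure, the completion of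
    \<open>lborel\<close>; Borel measurability of the integrand brings the statement back to
    \<open>lborel\<close>.\<close>
  finally have "integrable (completion lborel) (\<lambda>t. indicator {0<..} t *\<^sub>R (t ^ n * exp (- (c * t))))"
    by (simp add: set_integrable_def)
  moreover have "(\<lambda>t. indicator {0<..} t *\<^sub>R (t ^ n * exp (- (c * t)))) \<in> borel_measurable borel"
    by (intro borel_measurable_continuous_on_indicator continuous_intros) auto
  ultimately show ?thesis
    by (simp add: set_integrable_def integrable_completion)
qed

text \<open>Complex \<open>c\<close> needs no turning of contours: the derivative of t^(n+1) exp (-
  c t) integrates to 0, which is the recursion from n to n + 1.\<close>

lemma integral_power_exp_complex:
  assumes "Re c > 0"
  shows "set_integrable lborel {0<..} (\<lambda>t. of_real t ^ n * exp (- (c * of_real t)))"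
    "(LBINT t:{0<..}. of_real t ^ n * exp (- (c * of_real t))) = fact n / c ^ Suc n"
proof -
  have c: "c \<noteq> 0" using assms by auto
  show i: "set_integrable lborel {0<..} (\<lambda>t. of_real t ^ n * exp (- (c * of_real t)))" for n
    by (rule set_integrable_bound_greaterThan[OF set_integrable_power_exp_real[OF assms, of n]])
       (auto intro!: continuous_intros simp: norm_mult norm_power norm_exp_eq_Re)
  have top: "((\<lambda>t. of_real t ^ n * exp (- (c * of_real t))) \<longlongrightarrow> 0) at_top" for n
    by (rule Lim_null_comparison[OF _ tendsto_power_exp_real[OF assms, of n]])
       (auto intro!: eventually_mono[OF eventually_gt_at_top[of 0]] simp: norm_mult norm_power norm_exp_eq_Re)
  show "(LBINT t:{0<..}. of_real t ^ n * exp (- (c * of_real t))) = fact n / c ^ Suc n"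
  proof (induction n)
    case 0
    have D: "((\<lambda>t. - exp (- (c * of_real t)) / c) has_vector_derivative exp (- (c * of_real t))) (at t)" for t
      using c by (auto intro!: derivative_eq_intros has_vector_derivative_real_field)
    have "(LBINT t:{0<..}. exp (- (c * of_real t))) = 0 - (- 1 / c)"
      apply (rule integral_FTC_greaterThan[OF D])
      using i[of 0] c tendsto_mult_left[OF top[of 0], of "- 1 / c"]
      by (auto intro!: continuous_intros tendsto_eq_intros)
    then show ?case by simp
  next
    case (Suc n)
    have D: "((\<lambda>t. of_real t ^ Suc n * exp (- (c * of_real t))) has_vector_derivative
       of_nat (Suc n) * (of_real t ^ n * exp (- (c * of_real t))) - c * (of_real t ^ Suc n * exp (- (c * of_real t)))) (at t)" for t
      by (rule has_vector_derivative_real_field derivative_eq_intros refl | simp add: algebra_simps)+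
    have "(LBINT t:{0<..}. of_nat (Suc n) * (of_real t ^ n * exp (- (c * of_real t))) - c * (of_real t ^ Suc n * exp (- (c * of_real t)))) = 0 - 0"
      apply (rule integral_FTC_greaterThan[OF D _ _ _ top])
      using i[of n] i[of "Suc n"] by (auto intro!: continuous_intros set_integral_diff tendsto_eq_intros set_integrable_mult_right)
    also have "(LBINT t:{0<..}. of_nat (Suc n) * (of_real t ^ n * exp (- (c * of_real t))) - c * (of_real t ^ Suc n * exp (- (c * of_real t)))) =
       of_nat (Suc n) * (LBINT t:{0<..}. of_real t ^ n * exp (- (c * of_real t))) - c * (LBINT t:{0<..}. of_real t ^ Suc n * exp (- (c * of_real t)))"
      using i[of n] i[of "Suc n"] by (subst set_integral_diff) (auto intro!: set_integrable_mult_right)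
    finally show ?case
      using Suc c by (simp add: field_simps)
  qed
qed

text \<open>A local integrable majorant of the integrand alone is enough. Cauchy's inequality on
  discs of radius r / 3 turns it into a majorant of the derivative, hence of the difference
  quotients, and dominated convergence then differentiates under the integral.\<close>

lemma holomorphic_on_parametric_integral:
  fixes f :: "complex \<Rightarrow> 'b \<Rightarrow> complex"
  assumes "open S"
    and meas: "\<And>w. w \<in> S \<Longrightarrow> f w \<in> borel_measurable M"
    and hol: "\<And>t. t \<in> space M \<Longrightarrow> (\<lambda>w. f w t) holomorphic_on S"
    and bound: "\<And>w0. w0 \<in> S \<Longrightarrow> \<exists>r>0. \<exists>g. integrable M g \<and> (\<forall>w\<in>ball w0 r. w \<in> S \<and> (\<forall>t\<in>space M. norm (f w t) \<le> g t))"
  shows "(\<lambda>w. integral\<^sup>L M (f w)) holomorphic_on S"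
proof -
  have "(\<lambda>w. integral\<^sup>L M (f w)) field_differentiable at w0" if w0: "w0 \<in> S" for w0
  proof -
    obtain r g where r: "r > 0" and g: "integrable M g"
      and b: "\<And>w. w \<in> ball w0 r \<Longrightarrow> w \<in> S" "\<And>w t. w \<in> ball w0 r \<Longrightarrow> t \<in> space M \<Longrightarrow> norm (f w t) \<le> g t"
      using bound[OF w0] by metis
    have int: "integrable M (f w)" if "w \<in> ball w0 r" for w
      by (rule Bochner_Integration.integrable_bound[OF g meas])
        (use b that in \<open>auto intro!: AE_I2 order.trans[OF _ abs_ge_self]\<close>)
    have d: "norm (deriv (\<lambda>w. f w t) w) \<le> g t / (r / 3)" if w: "w \<in> ball w0 (r / 3)" and t: "t \<in> space M" for w t
    proof -
      have sub: "cball w (r / 3) \<subseteq> ball w0 r"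
        using w r by (auto simp: subset_iff dist_commute) (smt (verit) dist_triangle dist_commute)
      have h: "(\<lambda>w. f w t) holomorphic_on cball w (r / 3)"
        using hol[OF t] by (rule holomorphic_on_subset) (use b sub in auto)
      have "norm ((deriv ^^ 1) (\<lambda>w. f w t) w) \<le> fact 1 * g t / (r / 3) ^ 1"
        by (rule Cauchy_inequality)
          (use h r b sub t in \<open>auto intro: holomorphic_on_subset holomorphic_on_imp_continuous_on simp: subset_iff dist_norm\<close>)
      then show ?thesis by simp
    qed
    have lip: "norm ((f w t - f w0 t) / (w - w0)) \<le> g t / (r / 3)"
      if w: "w \<in> ball w0 (r / 3)" "w \<noteq> w0" and t: "t \<in> space M" for w t
    proof -
      have "norm (f w t - f w0 t) \<le> g t / (r / 3) * norm (w - w0)"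
      proof (rule field_differentiable_bound[of "ball w0 (r / 3)"])
        fix z assume z: "z \<in> ball w0 (r / 3)"
        then have "z \<in> S" using b r by auto
        then show "((\<lambda>w. f w t) has_field_derivative deriv (\<lambda>w. f w t) z) (at z within ball w0 (r / 3))"
          using hol[OF t] \<open>open S\<close> by (meson has_field_derivative_at_within holomorphic_derivI)
      qed (use d w r t in auto)
      then show ?thesis using w by (simp add: norm_divide divide_le_eq)
    qed
    have "((\<lambda>w. (integral\<^sup>L M (f w) - integral\<^sup>L M (f w0)) / (w - w0)) \<longlongrightarrow>
        (\<integral>t. deriv (\<lambda>w. f w t) w0 \<partial>M)) (at w0)"
    proof (rule tendsto_at_iff_sequentially[THEN iffD2], intro allI impI)
      fix X :: "nat \<Rightarrow> complex" assume X: "\<forall>i. X i \<in> UNIV - {w0}" "X \<longlonglongrightarrow> w0"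
      have "eventually (\<lambda>i. X i \<in> ball w0 (r / 3)) sequentially"
        using X(2) r by (intro topological_tendstoD) auto
      then obtain N where N: "\<And>i. i \<ge> N \<Longrightarrow> X i \<in> ball w0 (r / 3)"
        by (auto simp: eventually_sequentially)
      define Y where "Y i = X (i + N)" for i
      have Y: "Y i \<in> ball w0 (r / 3)" "Y i \<noteq> w0" "Y i \<in> ball w0 r" for i
        using N X r unfolding Y_def by (auto simp: less_le_trans) (smt (verit) N le_add2 mem_ball)
      have Ylim: "Y \<longlonglongrightarrow> w0" unfolding Y_def by (rule LIMSEQ_ignore_initial_segment[OF X(2)])
      have lim: "(\<lambda>i. (f (Y i) t - f w0 t) / (Y i - w0)) \<longlonglongrightarrow> deriv (\<lambda>w. f w t) w0"
        if t: "t \<in> space M" for t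
      proof -
        have "((\<lambda>w. f w t) has_field_derivative deriv (\<lambda>w. f w t) w0) (at w0)"
          using hol[OF t] \<open>open S\<close> w0 by (meson holomorphic_derivI)
        then have "((\<lambda>w. (f w t - f w0 t) / (w - w0)) \<longlongrightarrow> deriv (\<lambda>w. f w t) w0) (at w0)"
          by (simp add: has_field_derivative_iff)
        then show ?thesis
          using Y Ylim unfolding tendsto_at_iff_sequentially by (auto simp: o_def)
      qed
      have "(\<lambda>i. \<integral>t. (f (Y i) t - f w0 t) / (Y i - w0) \<partial>M) \<longlonglongrightarrow> (\<integral>t. deriv (\<lambda>w. f w t) w0 \<partial>M)"
      proof (rule integral_dominated_convergence[where w = "\<lambda>t. g t / (r / 3)"])
        show "AE t in M. (\<lambda>i. (f (Y i) t - f w0 t) / (Y i - w0)) \<longlonglongrightarrow> deriv (\<lambda>w. f w t) w0"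
          using lim by (rule AE_I2)
        show m: "(\<lambda>t. (f (Y i) t - f w0 t) / (Y i - w0)) \<in> borel_measurable M" for i
          using meas[OF b(1)[OF Y(3)[of i]]] meas[OF w0] by measurable
        show "(\<lambda>t. deriv (\<lambda>w. f w t) w0) \<in> borel_measurable M"
          by (rule borel_measurable_LIMSEQ_metric[OF m lim])
        show "integrable M (\<lambda>t. g t / (r / 3))" using g by auto
        show "AE t in M. norm ((f (Y i) t - f w0 t) / (Y i - w0)) \<le> g t / (r / 3)" for i
          using lip[OF Y(1,2)] by (auto intro!: AE_I2)
      qed
      also have "(\<lambda>i. \<integral>t. (f (Y i) t - f w0 t) / (Y i - w0) \<partial>M) =
          (\<lambda>i. (integral\<^sup>L M (f (Y i)) - integral\<^sup>L M (f w0)) / (Y i - w0))"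
        using int Y(3) r by (auto simp: Bochner_Integration.integral_diff)
      finally have "(\<lambda>i. ((\<lambda>w. (integral\<^sup>L M (f w) - integral\<^sup>L M (f w0)) / (w - w0)) \<circ> X) (i + N))
          \<longlonglongrightarrow> (\<integral>t. deriv (\<lambda>w. f w t) w0 \<partial>M)" by (simp add: Y_def o_def)
      then show "((\<lambda>w. (integral\<^sup>L M (f w) - integral\<^sup>L M (f w0)) / (w - w0)) \<circ> X)
          \<longlonglongrightarrow> (\<integral>t. deriv (\<lambda>w. f w t) w0 \<partial>M)" by (rule LIMSEQ_offset)
    qed
    then show ?thesis
      unfolding field_differentiable_def has_field_derivative_iff by auto
  qed
  then show ?thesis
    by (auto simp: holomorphic_on_def intro: field_differentiable_at_within)
qed

text \<open>A primitive \<open>Q\<close> on \<open>S\<close> stands in for Cauchy's theorem, so that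
  \<open>S\<close> may be a punctured strip once the residue of \<open>q\<close> has been removed.
  Integrability concerns only the difference of the two lines: a subtracted term c / z is not
  integrable along a single line, but its difference between two lines decays like 1 / r^2.\<close>

lemma strip_shift_primitive:
  fixes Q q :: "complex \<Rightarrow> complex"
  assumes Q: "\<And>z. z \<in> S \<Longrightarrow> (Q has_field_derivative q z) (at z)"
    and cont: "continuous_on S q"
    and lines: "\<And>r. of_real r + \<i> * of_real \<alpha> \<in> S" "\<And>r. of_real r + \<i> * of_real \<beta> \<in> S"
    and int: "integrable lborel (\<lambda>r. q (of_real r + \<i> * of_real \<beta>) - q (of_real r + \<i> * of_real \<alpha>))"
    and top: "eventually (\<lambda>r. \<forall>y\<in>closed_segment \<alpha> \<beta>. of_real r + \<i> * of_real y \<in> S \<and>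
                 norm (q (of_real r + \<i> * of_real y)) \<le> B r) at_top" "(B \<longlongrightarrow> 0) at_top"
    and bot: "eventually (\<lambda>r. \<forall>y\<in>closed_segment \<alpha> \<beta>. of_real r + \<i> * of_real y \<in> S \<and>
                 norm (q (of_real r + \<i> * of_real y)) \<le> B r) at_bot" "(B \<longlongrightarrow> 0) at_bot"
  shows "(LBINT r. q (of_real r + \<i> * of_real \<beta>) - q (of_real r + \<i> * of_real \<alpha>)) = 0"
proof -
  define D where "D r = Q (of_real r + \<i> * of_real \<beta>) - Q (of_real r + \<i> * of_real \<alpha>)" for r
  have D: "(D has_vector_derivative q (of_real r + \<i> * of_real \<beta>) - q (of_real r + \<i> * of_real \<alpha>)) (at r)" for r
  proof -
    have h: "((\<lambda>r. Q (of_real r + \<i> * of_real y)) has_vector_derivative q (of_real r + \<i> * of_real y)) (at r)"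
      if "of_real r + \<i> * of_real y \<in> S" for y
      using Q[OF that] by (intro has_vector_derivative_real_field) (simp add: DERIV_shift)
    show ?thesis unfolding D_def by (intro has_vector_derivative_diff h lines)
  qed
  have est: "norm (D r) \<le> B r * \<bar>\<beta> - \<alpha>\<bar>"
    if H: "\<forall>y\<in>closed_segment \<alpha> \<beta>. of_real r + \<i> * of_real y \<in> S \<and> norm (q (of_real r + \<i> * of_real y)) \<le> B r" for r
  proof -
    have "norm (Q (of_real r + \<i> * of_real \<beta>) - Q (of_real r + \<i> * of_real \<alpha>))
        \<le> B r * norm ((of_real r + \<i> * of_real \<beta>) - (of_real r + \<i> * of_real \<alpha>))"
    proof (rule field_differentiable_bound)
      show "convex ((\<lambda>y. of_real r + \<i> * of_real y) ` closed_segment \<alpha> \<beta>)"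
      proof -
        have "(\<lambda>y. of_real r + \<i> * of_real y) ` closed_segment \<alpha> \<beta> = (+) (of_real r) ` ((\<lambda>y. \<i> * of_real y) ` closed_segment \<alpha> \<beta>)"
          by (simp add: image_image)
        moreover have "convex ((\<lambda>y. \<i> * of_real y) ` closed_segment \<alpha> \<beta>)"
          by (rule convex_linear_image)
            (auto intro!: bounded_linear.linear bounded_linear_const_mult bounded_linear_of_real)
        ultimately show ?thesis using convex_translation by metis
      qed
      fix z assume "z \<in> (\<lambda>y. of_real r + \<i> * of_real y) ` closed_segment \<alpha> \<beta>"
      then have "z \<in> S" and n: "norm (q z) \<le> B r" using H by auto
      then show "(Q has_field_derivative q z) (at z within (\<lambda>y. of_real r + \<i> * of_real y) ` closed_segment \<alpha> \<beta>)"
        using Q has_field_derivative_at_within by blast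
      show "norm (q z) \<le> B r" by (rule n)
    qed auto
    also have "norm ((of_real r + \<i> * of_real \<beta>) - (of_real r + \<i> * of_real \<alpha>)) = \<bar>\<beta> - \<alpha>\<bar>"
    proof -
      have "(of_real r + \<i> * of_real \<beta>) - (of_real r + \<i> * of_real \<alpha>) = \<i> * of_real (\<beta> - \<alpha>)"
        by (simp add: algebra_simps)
      then show ?thesis by (simp only: norm_mult norm_of_real norm_ii mult_1)
    qed
    finally show ?thesis by (simp add: D_def)
  qed
  have "(D \<longlongrightarrow> 0) at_top"
    by (rule Lim_null_comparison[OF eventually_mono[OF top(1) est]])
      (use tendsto_mult_left_zero[OF top(2)] in auto)
  moreover have "(D \<longlongrightarrow> 0) at_bot"
    by (rule Lim_null_comparison[OF eventually_mono[OF bot(1) est]])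
      (use tendsto_mult_left_zero[OF bot(2)] in auto)
  moreover have "continuous_on UNIV (\<lambda>r. q (of_real r + \<i> * of_real \<beta>) - q (of_real r + \<i> * of_real \<alpha>))"
    by (intro continuous_intros continuous_on_compose2[OF cont]) (use lines in auto)
  ultimately show ?thesis
    using integral_FTC_real_line[OF D _ int] by simp
qed

lemma strip_shift:
  fixes q :: "complex \<Rightarrow> complex"
  assumes hol: "q holomorphic_on UNIV" and B: "integrable lborel B"
    and bound: "\<And>r y. y \<in> closed_segment \<alpha> \<beta> \<Longrightarrow> norm (q (of_real r + \<i> * of_real y)) \<le> B r"
    and lim: "(B \<longlongrightarrow> 0) at_top" "(B \<longlongrightarrow> 0) at_bot"
  shows "integrable lborel (\<lambda>r. q (of_real r + \<i> * of_real \<alpha>))"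
    "integrable lborel (\<lambda>r. q (of_real r + \<i> * of_real \<beta>))"
    "(LBINT r. q (of_real r + \<i> * of_real \<beta>)) = (LBINT r. q (of_real r + \<i> * of_real \<alpha>))"
proof -
  have c: "continuous_on UNIV q" using hol by (rule holomorphic_on_imp_continuous_on)
  have i: "integrable lborel (\<lambda>r. q (of_real r + \<i> * of_real y))" if "y \<in> closed_segment \<alpha> \<beta>" for y
    by (rule integrable_bound_continuous[OF B])
      (use bound that in \<open>auto intro!: continuous_intros continuous_on_compose2[OF c]\<close>)
  then show i: "integrable lborel (\<lambda>r. q (of_real r + \<i> * of_real \<alpha>))"
    "integrable lborel (\<lambda>r. q (of_real r + \<i> * of_real \<beta>))" by auto
  obtain Q where "\<And>z. z \<in> UNIV \<Longrightarrow> (Q has_field_derivative q z) (at z)"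
    using holomorphic_convex_primitive'[OF _ _ hol] by auto
  then have "(LBINT r. q (of_real r + \<i> * of_real \<beta>) - q (of_real r + \<i> * of_real \<alpha>)) = 0"
    by (rule strip_shift_primitive[where B = B]) (use c i bound lim in auto)
  then show "(LBINT r. q (of_real r + \<i> * of_real \<beta>)) = (LBINT r. q (of_real r + \<i> * of_real \<alpha>))"
    using i by simp
qed

section \<open>Rotation of rays in the slit plane\<close>

lemma Arg_of_real_cis:
  assumes "t > 0" "\<bar>y\<bar> < pi"
  shows "Arg (of_real t * cis y) = y"
  using assms by (intro Arg_unique[of t]) (auto simp: cis_conv_exp)

lemma ray_not_nonpos_Reals:
  assumes "t > 0" "\<bar>y\<bar> < pi"
  shows "of_real t * cis y \<notin> \<real>\<^sub>\<le>\<^sub>0"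
proof
  assume "of_real t * cis y \<in> \<real>\<^sub>\<le>\<^sub>0"
  then have "sin y = 0" "cos y \<le> 0"
    using assms by (auto simp: complex_nonpos_Reals_iff mult_le_0_iff)
  moreover from this have "y = 0" using assms sin_eq_0_pi[of y] by (simp add: abs_less_iff)
  ultimately show False by simp
qed

text \<open>The slit plane is starlike, so \<open>f\<close> has a primitive there. Its increment
  along the arc of radius t is at most arc length times \<open>B t\<close>; the two limits of t * B
  t therefore replace estimates on the large and the small arc.\<close>

lemma ray_rotation:
  fixes f :: "complex \<Rightarrow> complex"
  assumes hol: "f holomorphic_on - \<real>\<^sub>\<le>\<^sub>0" and ang: "- pi < \<alpha>" "\<alpha> \<le> \<beta>" "\<beta> < pi"
    and B: "set_integrable lborel {0<..} B"
    and bound: "\<And>t y. t > 0 \<Longrightarrow> \<alpha> \<le> y \<Longrightarrow> y \<le> \<beta> \<Longrightarrow> norm (f (of_real t * cis y)) \<le> B t"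
    and lim: "((\<lambda>t. t * B t) \<longlongrightarrow> 0) at_top" "((\<lambda>t. t * B t) \<longlongrightarrow> 0) (at_right 0)"
  shows "(LBINT t:{0<..}. f (of_real t * cis \<beta>) * cis \<beta>) = (LBINT t:{0<..}. f (of_real t * cis \<alpha>) * cis \<alpha>)"
proof -
  have c: "continuous_on (- \<real>\<^sub>\<le>\<^sub>0) f" using hol by (rule holomorphic_on_imp_continuous_on)
  have slit: "of_real t * cis y \<notin> \<real>\<^sub>\<le>\<^sub>0" if "t > 0" "\<alpha> \<le> y" "y \<le> \<beta>" for t y
    using that ang by (intro ray_not_nonpos_Reals) auto
  have i: "set_integrable lborel {0<..} (\<lambda>t. f (of_real t * cis y) * cis y)" if y: "\<alpha> \<le> y" "y \<le> \<beta>" for y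
    by (rule set_integrable_bound_greaterThan[OF B])
      (use y bound slit in \<open>auto intro!: continuous_intros continuous_on_compose2[OF c] simp: norm_mult\<close>)
  have op: "open (- \<real>\<^sub>\<le>\<^sub>0 :: complex set)" by (simp add: open_Compl)
  have st: "starlike (- \<real>\<^sub>\<le>\<^sub>0 :: complex set)"
  proof -
    have "(\<real>\<^sub>\<le>\<^sub>0 :: complex set) = of_real ` {..0}" by (auto simp: nonpos_Reals_def)
    then show ?thesis using starlike_slotted_complex_plane_left[of 0] by simp
  qed
  obtain P where P: "\<And>z. z \<notin> \<real>\<^sub>\<le>\<^sub>0 \<Longrightarrow> (P has_field_derivative f z) (at z)"
    using holomorphic_starlike_primitive[OF c st op, of "{}"]
      hol op by (auto simp: holomorphic_on_open field_differentiable_def)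
  define D where "D t = P (of_real t * cis \<beta>) - P (of_real t * cis \<alpha>)" for t
  have D: "(D has_vector_derivative f (of_real t * cis \<beta>) * cis \<beta> - f (of_real t * cis \<alpha>) * cis \<alpha>) (at t)" if "t > 0" for t
  proof -
    have "((\<lambda>t. P (of_real t * cis y)) has_vector_derivative f (of_real t * cis y) * cis y) (at t)"
      if y: "\<alpha> \<le> y" "y \<le> \<beta>" for y
    proof (rule has_vector_derivative_real_field)
      show "((\<lambda>w. P (w * cis y)) has_field_derivative f (of_real t * cis y) * cis y) (at (of_real t))"
        by (rule DERIV_chain2[where f = P and g = "\<lambda>w. w * cis y", OF P[OF slit[OF \<open>t > 0\<close> y]]])
          (rule derivative_eq_intros refl | simp)+
    qed
    then show ?thesis unfolding D_def using ang by (intro has_vector_derivative_diff) auto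
  qed
  have est: "norm (D t) \<le> (\<beta> - \<alpha>) * (t * B t)" if t: "t > 0" for t
  proof -
    \<comment> \<open>The arc is parametrised by a complex angle, so that the mean value inequality
      applies on the convex segment from \<alpha> to \<beta>.\<close>
    let ?g = "\<lambda>z. P (of_real t * exp (\<i> * z))"
    have "norm (?g (of_real \<beta>) - ?g (of_real \<alpha>)) \<le> (t * B t) * norm (of_real \<beta> - of_real \<alpha> :: complex)"
    proof (rule field_differentiable_bound)
      show "convex (complex_of_real ` {\<alpha>..\<beta>})"
        by (rule convex_linear_image) (auto intro!: bounded_linear.linear bounded_linear_of_real)
      fix z assume "z \<in> complex_of_real ` {\<alpha>..\<beta>}"
      then obtain y where y: "z = of_real y" "\<alpha> \<le> y" "y \<le> \<beta>" by auto
      let ?f' = "\<lambda>z. f (of_real t * exp (\<i> * z)) * (of_real t * (exp (\<i> * z) * \<i>))"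
      have e: "of_real t * exp (\<i> * z) = of_real t * cis y" using y by (simp add: cis_conv_exp)
      have s: "of_real t * exp (\<i> * z) \<notin> \<real>\<^sub>\<le>\<^sub>0" unfolding e by (rule slit) (use y t in auto)
      show "(?g has_field_derivative ?f' z) (at z within complex_of_real ` {\<alpha>..\<beta>})"
        by (rule DERIV_chain2[where f = P and g = "\<lambda>z. of_real t * exp (\<i> * z)", OF P[OF s]])
          (rule derivative_eq_intros refl | simp)+
      have "norm (?f' z) = norm (f (of_real t * cis y)) * t"
        using t y by (simp add: norm_mult e flip: cis_conv_exp)
      also have "\<dots> \<le> B t * t" using bound[of t y] y t by (intro mult_right_mono) auto
      finally show "norm (?f' z) \<le> t * B t" by (simp add: mult.commute)
    qed (use ang in auto)
    also have "norm (of_real \<beta> - of_real \<alpha> :: complex) = \<beta> - \<alpha>"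
      using ang by (metis norm_of_real of_real_diff abs_of_nonneg diff_ge_0_iff_ge)
    finally show ?thesis by (simp add: D_def cis_conv_exp mult.commute)
  qed
  have "(D \<longlongrightarrow> 0) at_top"
    by (rule Lim_null_comparison[OF eventually_mono[OF eventually_gt_at_top[of 0] est]])
      (use tendsto_mult_right_zero[OF lim(1)] in auto)
  moreover have "(D \<longlongrightarrow> 0) (at_right 0)"
    by (rule Lim_null_comparison[OF eventually_mono[OF eventually_at_right_less est]])
      (use tendsto_mult_right_zero[OF lim(2)] in auto)
  moreover have "continuous_on {0<..} (\<lambda>t. f (of_real t * cis \<beta>) * cis \<beta> - f (of_real t * cis \<alpha>) * cis \<alpha>)"
    by (intro continuous_intros continuous_on_compose2[OF c]) (use slit ang in auto)
  ultimately have "(LBINT t:{0<..}. f (of_real t * cis \<beta>) * cis \<beta> - f (of_real t * cis \<alpha>) * cis \<alpha>) = 0 - 0"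
    using i ang by (intro integral_FTC_greaterThan[OF D]) (auto intro!: set_integral_diff)
  then show ?thesis
    using i ang by (subst (asm) set_integral_diff) auto
qed

section \<open>The function \<open>Gamma x * x powr - x\<close>\<close>

lemma norm_integral_le:
  fixes f :: "'a \<Rightarrow> 'b::{banach, second_countable_topology}"
  assumes "integrable M f" "integrable M g" "\<And>x. norm (f x) \<le> g x"
  shows "norm (integral\<^sup>L M f) \<le> integral\<^sup>L M g"
  using assms by (intro order.trans[OF integral_norm_bound] integral_mono) auto

lemma integrable_real_decay:
  fixes f :: "real \<Rightarrow> real"
  assumes c: "continuous_on UNIV f"
    and top: "((\<lambda>r. (1 + r\<^sup>2) * f r) \<longlongrightarrow> 0) at_top" and bot: "((\<lambda>r. (1 + r\<^sup>2) * f r) \<longlongrightarrow> 0) at_bot"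
  shows "integrable lborel f"
proof -
  obtain R1 where R1: "\<And>r. r \<ge> R1 \<Longrightarrow> \<bar>(1 + r\<^sup>2) * f r\<bar> < 1"
    using tendstoD[OF top, of 1] by (auto simp: eventually_at_top_linorder)
  obtain R2 where R2: "\<And>r. r \<le> R2 \<Longrightarrow> \<bar>(1 + r\<^sup>2) * f r\<bar> < 1"
    using tendstoD[OF bot, of 1] by (auto simp: eventually_at_bot_linorder)
  have "compact ((\<lambda>r. (1 + r\<^sup>2) * f r) ` {R2..R1})"
    by (intro compact_continuous_image continuous_intros continuous_on_subset[OF c]) auto
  then obtain C where C: "\<And>r. r \<in> {R2..R1} \<Longrightarrow> \<bar>(1 + r\<^sup>2) * f r\<bar> \<le> C"
    by (force dest: compact_imp_bounded simp: bounded_iff)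
  have b: "\<bar>(1 + r\<^sup>2) * f r\<bar> \<le> max C 1" for r
    using R1[of r] R2[of r] C[of r] by (cases "r \<ge> R1"; cases "r \<le> R2") auto
  show ?thesis
  proof (rule integrable_bound_continuous[OF _ c])
    show "integrable lborel (\<lambda>r::real. max C 1 * inverse (1 + r\<^sup>2))"
      using integrable_inverse_1_plus_square by (simp add: set_integrable_def)
    show "norm (f r) \<le> max C 1 * inverse (1 + r\<^sup>2)" for r
    proof -
      have p: "1 + r\<^sup>2 > 0" by (simp add: add_pos_nonneg)
      show ?thesis using b[of r] p by (simp add: abs_mult field_simps)
    qed
  qed
qed

lemma
  assumes "c > (0::real)" "d > 0"
  shows integrable_exp_exp: "integrable lborel (\<lambda>r. exp (c * r - d * exp r))"
    and tendsto_exp_exp_top: "((\<lambda>r. exp (c * r - d * exp r)) \<longlongrightarrow> 0) at_top"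
    and tendsto_exp_exp_bot: "((\<lambda>r. exp (c * r - d * exp r)) \<longlongrightarrow> 0) at_bot"
proof -
  show "integrable lborel (\<lambda>r. exp (c * r - d * exp r))"
  proof (rule integrable_real_decay)
    show "((\<lambda>r. (1 + r\<^sup>2) * exp (c * r - d * exp r)) \<longlongrightarrow> 0) at_top" using assms by real_asymp
    show "((\<lambda>r. (1 + r\<^sup>2) * exp (c * r - d * exp r)) \<longlongrightarrow> 0) at_bot" using assms by real_asymp
  qed (intro continuous_intros)
qed (use assms in real_asymp)+

text \<open>The substitution t = exp r in Euler's integral. In the variable r, turning the path of
  integration becomes a vertical shift of a line.\<close>

lemma Gamma_conv_exp_integral:
  assumes "Re x > 0"
  shows "(LBINT r. exp (x * of_real r - exp (of_real r))) = Gamma x"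
proof -
  let ?f = "\<lambda>t. complex_of_real t powr (x - 1) / of_real (exp t)"
  have "(\<lambda>t. indicator {0<..} t *\<^sub>R ?f t) \<in> borel_measurable borel"
    by (intro borel_measurable_continuous_on_indicator continuous_intros) auto
  then have i: "set_integrable lborel {0<..} ?f"
    using absolutely_integrable_Gamma_integral'[OF assms]
    by (simp add: set_integrable_def integrable_completion)
  have e: "exp r *\<^sub>R ?f (exp r) = exp (x * of_real r - exp (of_real r))" for r
  proof -
    have "complex_of_real (exp r) powr (x - 1) = exp ((x - 1) * of_real r)"
      by (simp add: powr_def Ln_of_real flip: exp_of_real)
    then have "exp r *\<^sub>R ?f (exp r) = exp (of_real r) * exp ((x - 1) * of_real r) / exp (exp (of_real r))"
      by (simp add: scaleR_conv_of_real exp_of_real)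
    also have "exp (of_real r) * exp ((x - 1) * of_real r) = exp (x * of_real r)"
      by (simp add: ring_distribs flip: exp_add)
    also have "\<dots> / exp (exp (of_real r)) = exp (x * of_real r - exp (of_real r))"
      by (simp add: exp_diff)
    finally show ?thesis .
  qed
  have i2: "integrable lborel (\<lambda>r. exp r *\<^sub>R ?f (exp r))"
    unfolding e using assms
    by (intro integrable_bound_continuous[OF integrable_exp_exp[of "Re x" 1]])
      (auto intro!: continuous_intros simp: norm_exp_eq_Re Re_exp)
  have "(LBINT t=0..\<infinity>. ?f t) = (LBINT r=-\<infinity>..\<infinity>. exp r *\<^sub>R ?f (exp r))"
  proof (rule interval_integral_substitution_integrable)
    show "((ereal \<circ> exp \<circ> real_of_ereal) \<longlongrightarrow> 0) (at_right (- \<infinity>))"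
      unfolding zero_ereal_def ereal_tendsto_simps by (simp add: exp_at_bot)
    show "((ereal \<circ> exp \<circ> real_of_ereal) \<longlongrightarrow> \<infinity>) (at_left \<infinity>)"
      by (simp add: ereal_tendsto_simps exp_at_top)
    show "set_integrable lborel (einterval 0 \<infinity>) ?f" using i by (simp add: zero_ereal_def)
    show "set_integrable lborel (einterval (-\<infinity>) \<infinity>) (\<lambda>r. exp r *\<^sub>R ?f (exp r))"
      using i2 by (simp add: set_integrable_def)
  qed (auto intro!: derivative_eq_intros continuous_intros)
  also have "(LBINT t=0..\<infinity>. ?f t) = integral {0<..} ?f"
    using i by (simp add: zero_ereal_def interval_integral_to_infinity_eq set_borel_integral_eq_integral)
  also have "\<dots> = Gamma x"
    using Gamma_integral_complex'[OF assms] by (rule integral_unique)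
  finally show ?thesis
    unfolding e by (simp add: interval_lebesgue_integral_def set_lebesgue_integral_def)
qed

text \<open>On the slit plane, \<open>Gamma_div_power x * exp x\<close> is sqrt (2 * pi) * x powr (-
  1 / 2) * \<open>scaled_Gamma x\<close>. All estimates below are for this product.\<close>

definition Gamma_div_power :: "complex \<Rightarrow> complex" where
  "Gamma_div_power x = Gamma x * exp (- (x * Ln x))"

text \<open>Translating the variable by \<open>Ln x\<close> pulls out the power of x. The imaginary
  part \<open>Arg x\<close> of the translation is a contour shift, the real part an affine
  substitution; Re x > 0 keeps the shifted line at a height where exp (- exp w) still
  decays.\<close>

lemma Gamma_div_power_integral:
  assumes x: "Re x > 0"
  shows "integrable lborel (\<lambda>r. exp (x * of_real (r - exp r)))"
    "Gamma_div_power x = (LBINT r. exp (x * of_real (r - exp r)))"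
proof -
  have x0: "x \<noteq> 0" using x by auto
  define y where "y = Arg x"
  have y: "\<bar>y\<bar> < pi / 2"
    using x Re_Ln_pos_lt[OF x0] by (simp add: y_def Arg_eq_Im_Ln x0)
  then have cy: "cos y > 0" by (intro cos_gt_zero_pi) auto
  let ?q = "\<lambda>w. exp (x * w - exp w)"
  let ?f = "\<lambda>r::real. ?q (of_real r + \<i> * of_real y)"
  \<comment> \<open>For heights u between 0 and y one has cos u >= cos y > 0, and the constant
    factor majorises exp (- Im x * u).\<close>
  define B where "B r = exp (\<bar>Im x\<bar> * \<bar>y\<bar>) * exp (Re x * r - cos y * exp r)" for r
  have bound: "norm (?q (of_real r + \<i> * of_real u)) \<le> B r" if "u \<in> closed_segment 0 y" for r u
  proof -
    have u: "\<bar>u\<bar> \<le> \<bar>y\<bar>" using that by (auto simp: closed_segment_eq_real_ivl split: if_splits)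
    then have "cos \<bar>y\<bar> \<le> cos \<bar>u\<bar>" using y by (intro cos_monotone_0_pi_le) auto
    then have "cos y * exp r \<le> cos u * exp r" by (intro mult_right_mono) auto
    moreover have "- (Im x * u) \<le> \<bar>Im x\<bar> * \<bar>y\<bar>"
    proof -
      have "- (Im x * u) \<le> \<bar>Im x\<bar> * \<bar>u\<bar>" by (metis abs_ge_minus_self abs_mult)
      also have "\<dots> \<le> \<bar>Im x\<bar> * \<bar>y\<bar>" using u by (intro mult_left_mono) auto
      finally show ?thesis .
    qed
    moreover have "norm (?q (of_real r + \<i> * of_real u)) = exp (Re x * r - Im x * u - cos u * exp r)"
      by (simp add: norm_exp_eq_Re Re_exp mult.commute)
    moreover have "B r = exp (\<bar>Im x\<bar> * \<bar>y\<bar> + (Re x * r - cos y * exp r))"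
      by (simp only: B_def exp_add)
    ultimately show ?thesis
      by (simp only: exp_le_cancel_iff)
  qed
  have B: "integrable lborel B" "(B \<longlongrightarrow> 0) at_top" "(B \<longlongrightarrow> 0) at_bot"
    unfolding B_def using x cy
    by (auto intro!: integrable_exp_exp tendsto_mult_right_zero tendsto_exp_exp_top tendsto_exp_exp_bot)
  have h: "?q holomorphic_on UNIV" by (intro holomorphic_intros)
  note S = strip_shift[OF h B(1) bound B(2,3)]
  have G: "integrable lborel ?f" "(LBINT r. ?f r) = Gamma x"
    using S Gamma_conv_exp_integral[OF x] by auto
  have f: "?f (ln (norm x) + 1 * r) = exp (x * Ln x) * exp (x * of_real (r - exp r))" for r
  proof -
    have e: "complex_of_real (ln (norm x) + 1 * r) + \<i> * of_real y = Ln x + of_real r"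
      using x0 by (simp add: complex_eq_iff y_def Arg_eq_Im_Ln)
    have "?f (ln (norm x) + 1 * r) = exp (x * (Ln x + of_real r) - x * of_real (exp r))"
      unfolding e using x0 by (simp add: exp_add exp_of_real)
    then show ?thesis
      by (simp add: algebra_simps flip: exp_add)
  qed
  have "integrable lborel (\<lambda>r. ?f (ln (norm x) + 1 * r))"
    by (rule lborel_integrable_real_affine[OF G(1)]) simp
  then have "integrable lborel (\<lambda>r. exp (- (x * Ln x)) * (exp (x * Ln x) * exp (x * of_real (r - exp r))))"
    unfolding f by (rule integrable_mult_right)
  moreover have "exp (- (x * Ln x)) * (exp (x * Ln x) * w) = w" for w
    by (simp add: exp_minus)
  ultimately show "integrable lborel (\<lambda>r. exp (x * of_real (r - exp r)))"
    by (simp only:)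
  have "Gamma x = (LBINT r. ?f (ln (norm x) + 1 * r))"
    using G(2) lborel_integral_real_affine[of 1 ?f "ln (norm x)"] by simp
  then show "Gamma_div_power x = (LBINT r. exp (x * of_real (r - exp r)))"
    unfolding f by (simp add: Gamma_div_power_def exp_minus field_simps)
qed

text \<open>Since r - exp r + 1 <= 0, the modulus exp (Re x * (r - exp r + 1)) of the integrand
  decreases in Re x, so the integrand for Re x = 1 majorises all others.\<close>

lemma Gamma_div_power_bound_right:
  obtains C where "C > 0" "\<And>x. Re x \<ge> 1 \<Longrightarrow> norm (Gamma_div_power x * exp x) \<le> C"
proof -
  define C where "C = (LBINT r. exp 1 * exp (1 * r - 1 * exp r :: real))"
  have "norm (Gamma_div_power x * exp x) \<le> C" if x: "Re x \<ge> 1" for x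
  proof -
    have "norm (LBINT r. exp x * exp (x * of_real (r - exp r))) \<le> C"
      unfolding C_def
    proof (rule norm_integral_le)
      fix r :: real
      have "r - exp r + 1 \<le> 0" using exp_ge_add_one_self[of r] by linarith
      then have "Re x * (r - exp r + 1) \<le> 1 * (r - exp r + 1)"
        using x by (intro mult_right_mono_neg) auto
      then show "norm (exp x * exp (x * of_real (r - exp r))) \<le> exp 1 * exp (1 * r - 1 * exp r)"
        by (simp add: norm_exp_eq_Re algebra_simps flip: exp_add)
    qed (use x Gamma_div_power_integral(1)[of x] integrable_exp_exp[of 1 1] in auto)
    then show ?thesis
      using x by (simp add: Gamma_div_power_integral(2) mult.commute)
  qed
  then show ?thesis
    by (intro that[of "max C 1"]) (auto intro: order.trans[OF _ max.cobounded1])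
qed

text \<open>The constant is cos (\<omega> / 2). With s = |x| and c = cos (Arg x), one has |x + u|^2
  = (1 + c) / 2 * (s + u)^2 + (1 - c) / 2 * (s - u)^2; the second term is dropped. This is the
  common source of all distances from the cut and from the poles.\<close>

lemma norm_add_real_sector:
  assumes "u \<ge> 0" "\<bar>Arg x\<bar> \<le> \<omega>" "\<omega> \<le> pi"
  shows "sqrt ((1 + cos \<omega>) / 2) * (norm x + u) \<le> norm (x + of_real u)"
proof -
  let ?c = "cos (Arg x)" and ?s = "norm x"
  have "cos \<omega> \<le> cos \<bar>Arg x\<bar>" using assms by (intro cos_monotone_0_pi_le) auto
  then have c: "cos \<omega> \<le> ?c" "?c \<le> 1" by auto
  have "(sqrt ((1 + cos \<omega>) / 2) * (?s + u))\<^sup>2 = (1 + cos \<omega>) / 2 * (?s + u)\<^sup>2"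
  proof -
    have "0 \<le> 1 + cos \<omega>" using cos_ge_minus_one[of \<omega>] by linarith
    then show ?thesis by (simp add: power_mult_distrib)
  qed
  also have "\<dots> \<le> (1 + ?c) / 2 * (?s + u)\<^sup>2" using c by (intro mult_right_mono) auto
  also have "\<dots> = (?s\<^sup>2 + 2 * ?s * u * ?c + u\<^sup>2) - (1 - ?c) / 2 * (?s - u)\<^sup>2"
    by (simp add: power2_eq_square field_simps)
  also have "\<dots> \<le> ?s\<^sup>2 + 2 * ?s * u * ?c + u\<^sup>2" using c by simp
  also have "\<dots> = (norm (x + of_real u))\<^sup>2"
  proof -
    have x: "x = of_real ?s * cis (Arg x)" using rcis_cmod_Arg[of x] by (simp add: rcis_def)
    have "Re x = ?s * ?c" "Im x = ?s * sin (Arg x)" by (subst x, simp)+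
    then have "(norm (x + of_real u))\<^sup>2 = (?s * ?c + u)\<^sup>2 + (?s * sin (Arg x))\<^sup>2"
      by (simp add: cmod_power2)
    also have "\<dots> = ?s\<^sup>2 * (?c\<^sup>2 + (sin (Arg x))\<^sup>2) + 2 * ?s * u * ?c + u\<^sup>2"
      by algebra
    finally show ?thesis by simp
  qed
  finally show ?thesis by (rule power2_le_imp_le) auto
qed

lemma norm_Ln_le:
  assumes "x \<noteq> 0"
  shows "norm (Ln x) \<le> \<bar>ln (norm x)\<bar> + pi"
  using cmod_le[of "Ln x"] assms mpi_less_Im_Ln[OF assms] Im_Ln_le_pi[OF assms] by auto

text \<open>A second order Taylor remainder: along the unit segment, Ln (x + z) - z / x has
  derivative - z / (x * (x + z)), whose modulus is at most 1 / \<rho>^2.\<close>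

lemma norm_Ln_add_one_bound:
  assumes \<rho>: "\<rho> > 0" and x: "\<And>u. 0 \<le> u \<Longrightarrow> u \<le> 1 \<Longrightarrow> x + of_real u \<notin> \<real>\<^sub>\<le>\<^sub>0 \<and> \<rho> \<le> norm (x + of_real u)"
  shows "norm (Ln (x + 1) - Ln x - 1 / x) \<le> 1 / \<rho>\<^sup>2"
proof -
  have x0: "x \<notin> \<real>\<^sub>\<le>\<^sub>0" "\<rho> \<le> norm x" using x[of 0] by auto
  then have xn: "x \<noteq> 0" by auto
  let ?g = "\<lambda>z. Ln (x + z) - z / x"
  have "norm (?g 1 - ?g 0) \<le> 1 / \<rho>\<^sup>2 * norm (1 - 0 :: complex)"
  proof (rule field_differentiable_bound)
    show "convex (complex_of_real ` {0..1})"
      by (rule convex_linear_image) (auto intro!: bounded_linear.linear bounded_linear_of_real)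
    fix z assume "z \<in> complex_of_real ` {0..1}"
    then obtain u where u: "z = of_real u" "0 \<le> u" "u \<le> 1" by auto
    have z: "x + z \<notin> \<real>\<^sub>\<le>\<^sub>0" "\<rho> \<le> norm (x + z)" using x[of u] u by auto
    then have zn: "x + z \<noteq> 0" by auto
    show "(?g has_field_derivative 1 / (x + z) - 1 / x) (at z within complex_of_real ` {0..1})"
      using z by (auto intro!: derivative_eq_intros simp: divide_simps)
    have "norm (1 / (x + z) - 1 / x) = u / (norm (x + z) * norm x)"
      using xn zn u by (simp add: diff_frac_eq norm_divide norm_mult)
    also have "\<dots> \<le> 1 / (\<rho> * \<rho>)"
      using u z x0 \<rho> by (intro frac_le mult_mono) auto
    finally show "norm (1 / (x + z) - 1 / x) \<le> 1 / \<rho>\<^sup>2" by (simp add: power2_eq_square)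
  qed auto
  then show ?thesis by (simp add: algebra_simps)
qed

text \<open>The functional equation of \<open>Gamma\<close>, normalised by \<open>exp x\<close> so
  that the leading 1 of (x + 1) * (Ln (x + 1) - Ln x) cancels. The remaining exponent is O(1 /
  x).\<close>

lemma Gamma_div_power_shift:
  assumes "x \<notin> \<real>\<^sub>\<le>\<^sub>0"
  shows "Gamma_div_power x * exp x =
    Gamma_div_power (x + 1) * exp (x + 1) * exp ((x + 1) * (Ln (x + 1) - Ln x) - 1)"
proof -
  have x0: "x \<noteq> 0" using assms by auto
  have "Gamma (x + 1) = exp (Ln x) * Gamma x"
    using x0 assms nonpos_Ints_subset_nonpos_Reals by (subst Gamma_plus1) (auto)
  then show ?thesis
    by (simp add: Gamma_div_power_def ring_distribs flip: exp_add)
qed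

text \<open>
  The shift formula is iterated about \<open>norm x\<close> times to reach \<open>Re x \<ge> 1\<close>; every step costs a factor
  \<open>exp (O(1 / norm x))\<close>, hence the total loss stays bounded.
\<close>
lemma Gamma_div_power_sector_bound:
  assumes \<omega>: "0 \<le> \<omega>" "\<omega> < pi"
  obtains C where "C > 0"
    "\<And>x. x \<noteq> 0 \<Longrightarrow> \<bar>Arg x\<bar> \<le> \<omega> \<Longrightarrow> norm (Gamma_div_power x * exp x) \<le> C * (1 + 1 / norm x)"
proof -
  define \<kappa> where "\<kappa> = sqrt ((1 + cos \<omega>) / 2)"
  have "cos \<omega> > cos pi" using \<omega> by (intro cos_monotone_0_pi) auto
  then have \<kappa>: "\<kappa> > 0" by (simp add: \<kappa>_def)
  have lower: "\<kappa> * (norm x + u) \<le> norm (x + of_real u)" if "u \<ge> 0" "\<bar>Arg x\<bar> \<le> \<omega>" for u x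
    using norm_add_real_sector[OF that] \<omega> by (simp add: \<kappa>_def)
  have slit: "x + of_real u \<notin> \<real>\<^sub>\<le>\<^sub>0" if "x \<noteq> 0" "\<bar>Arg x\<bar> \<le> \<omega>" "u \<ge> 0" for x u
  proof
    assume A: "x + of_real u \<in> \<real>\<^sub>\<le>\<^sub>0"
    then have "Im x = 0" "Re x \<le> 0" using that(3) by (auto simp: complex_nonpos_Reals_iff)
    then have "Arg x = pi" using that(1) by (auto simp: Arg_eq_pi complex_eq_iff)
    then show False using that \<omega> by auto
  qed
  obtain C0 where C0: "C0 > 0" "\<And>x. Re x \<ge> 1 \<Longrightarrow> norm (Gamma_div_power x * exp x) \<le> C0"
    using Gamma_div_power_bound_right by blast
  \<comment> \<open>Cost of one shift from y = x + k: |y + 1| <= 4 |x| times the logarithmic error 1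
    / (\<kappa> |x|)^2, plus |1 / y| <= 1 / (\<kappa> |x|). The sum is c / |x|.\<close>
  define c where "c = 4 / \<kappa>\<^sup>2 + 1 / \<kappa>"
  have c: "c > 0" using \<kappa> by (simp add: c_def add_pos_pos)
  have large: "norm (Gamma_div_power x * exp x) \<le> C0 * exp (3 * c)"
    if x: "norm x \<ge> 1" "\<bar>Arg x\<bar> \<le> \<omega>" for x
  proof -
    have xn: "x \<noteq> 0" using x by auto
    define H where "H k = norm (Gamma_div_power (x + of_nat k) * exp (x + of_nat k))" for k
    have step: "H k \<le> H (Suc k) * exp (c / norm x)" if k: "real k \<le> norm x + 1" for k
    proof -
      let ?y = "x + of_nat k" and ?\<rho> = "\<kappa> * norm x"
      have \<rho>: "?\<rho> > 0" using \<kappa> xn by simp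
      have y: "?y + of_real u \<notin> \<real>\<^sub>\<le>\<^sub>0 \<and> ?\<rho> \<le> norm (?y + of_real u)" if "0 \<le> u" for u
      proof -
        have "\<kappa> * norm x \<le> \<kappa> * (norm x + (real k + u))" using \<kappa> that by simp
        also have "\<dots> \<le> norm (?y + of_real u)" using lower[of "real k + u" x] x that by (simp add: add.assoc)
        finally show ?thesis using slit[OF xn x(2), of "real k + u"] that by (simp add: add.assoc)
      qed
      have L: "norm (Ln (?y + 1) - Ln ?y - 1 / ?y) \<le> 1 / ?\<rho>\<^sup>2"
        using y \<rho> by (intro norm_Ln_add_one_bound) auto
      have y0: "?y \<noteq> 0" "?\<rho> \<le> norm ?y" "?y \<notin> \<real>\<^sub>\<le>\<^sub>0" using y[of 0] \<rho> by auto
      have n1: "norm (?y + 1) \<le> 4 * norm x"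
      proof -
        have "norm (?y + 1) \<le> norm x + real k + 1"
          by (metis norm_add_rule_thm norm_of_nat norm_one order.refl norm_triangle_mono)
        then show ?thesis using k x by linarith
      qed
      have "(?y + 1) * (Ln (?y + 1) - Ln ?y) - 1 = (?y + 1) * (Ln (?y + 1) - Ln ?y - 1 / ?y) + 1 / ?y"
        using y0 by (simp add: field_simps)
      then have "norm ((?y + 1) * (Ln (?y + 1) - Ln ?y) - 1) \<le> norm (?y + 1) * norm (Ln (?y + 1) - Ln ?y - 1 / ?y) + 1 / norm ?y"
        by (metis norm_triangle_ineq norm_mult norm_divide norm_one)
      also have "\<dots> \<le> 4 * norm x * (1 / ?\<rho>\<^sup>2) + 1 / ?\<rho>"
        using n1 L y0 \<rho> by (intro add_mono mult_mono divide_left_mono) auto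
      also have "\<dots> = c / norm x"
        using xn \<kappa> by (simp add: c_def field_simps power2_eq_square)
      finally have b: "norm ((?y + 1) * (Ln (?y + 1) - Ln ?y) - 1) \<le> c / norm x" .
      have "H k = H (Suc k) * norm (exp ((?y + 1) * (Ln (?y + 1) - Ln ?y) - 1))"
        using Gamma_div_power_shift[OF y0(3)] by (simp add: H_def norm_mult add_ac)
      also have "\<dots> \<le> H (Suc k) * exp (c / norm x)"
        using b by (intro mult_left_mono order.trans[OF norm_exp]) (auto simp: H_def)
      finally show ?thesis .
    qed
    have iter: "H 0 \<le> H k * exp (real k * (c / norm x))" if "real k \<le> norm x + 2" for k
      using that
    proof (induction k)
      case (Suc k)
      then have "H 0 \<le> H k * exp (real k * (c / norm x))" by simp
      also have "\<dots> \<le> (H (Suc k) * exp (c / norm x)) * exp (real k * (c / norm x))"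
        using step[of k] Suc.prems by (intro mult_right_mono) auto
      also have "\<dots> = H (Suc k) * exp (real (Suc k) * (c / norm x))"
        by (simp only: of_nat_Suc ring_distribs exp_add mult_1 mult_ac)
      finally show ?case .
    qed simp
    \<comment> \<open>This many shifts give Re (x + n) >= n - |x| >= 1, and n <= |x| + 2 <= 3 |x|
      explains the exponent 3 * c.\<close>
    define n where "n = nat \<lceil>norm x + 1\<rceil>"
    have n: "real n \<ge> norm x + 1" "real n \<le> norm x + 2" unfolding n_def using x by linarith+
    have "H 0 \<le> H n * exp (real n * (c / norm x))" by (rule iter[OF n(2)])
    also have "\<dots> \<le> C0 * exp (3 * c)"
    proof (intro mult_mono)
      have "Re (x + of_nat n) \<ge> 1" using n(1) abs_Re_le_cmod[of x] by simp
      then show "H n \<le> C0" unfolding H_def by (rule C0)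
      have "real n * (c / norm x) \<le> (3 * norm x) * (c / norm x)"
        using n x c by (intro mult_right_mono) auto
      also have "\<dots> = 3 * c" using xn by simp
      finally show "exp (real n * (c / norm x)) \<le> exp (3 * c)" by simp
    qed (use C0 in \<open>auto simp: H_def\<close>)
    finally show ?thesis by (simp add: H_def)
  qed
  \<comment> \<open>For |x| < 1, three shifts lead into a disc about 3, which contains no pole. In
    Gamma x = Gamma (x + 3) / (x (x + 1) (x + 2)) the sector bounds x + 1 and x + 2 away from 0, so
    only the factor 1 / |x| survives.\<close>
  have "continuous_on (cball 3 1) (Gamma :: complex \<Rightarrow> complex)"
  proof (rule continuous_on_Gamma)
    show "cball 3 1 \<inter> \<int>\<^sub>\<le>\<^sub>0 = ({} :: complex set)"
    proof -
      have "Re z \<ge> 2" if "z \<in> cball 3 1" for z :: complex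
        using that abs_Re_le_cmod[of "3 - z"] by (auto simp: dist_norm)
      then show ?thesis by (force elim!: nonpos_Ints_cases)
    qed
  qed
  then have "compact (Gamma ` cball (3 :: complex) 1)" by (rule compact_continuous_image) simp
  then obtain C1 where C1: "\<And>z :: complex. z \<in> cball 3 1 \<Longrightarrow> norm (Gamma z) \<le> C1"
    by (force dest: compact_imp_bounded simp: bounded_iff)
  have C1p: "C1 \<ge> 0" using C1[of 3] by (smt (verit) centre_in_cball norm_ge_zero)
  \<comment> \<open>\<kappa>^2 comes from x + 1 and x + 2; exp (1 + pi) bounds exp (- x Ln x), since
    |x| |ln |x|| <= 1 for |x| < 1; one more factor exp 1 bounds exp x.\<close>
  define C2 where "C2 = C1 / \<kappa>\<^sup>2 * exp (2 + pi)"
  have small: "norm (Gamma_div_power x * exp x) \<le> C2 * (1 / norm x)"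
    if x: "norm x < 1" "x \<noteq> 0" "\<bar>Arg x\<bar> \<le> \<omega>" for x
  proof -
    have k: "\<kappa> \<le> norm (x + of_real u)" if "u \<ge> 1" for u
    proof -
      have "\<kappa> * 1 \<le> \<kappa> * (norm x + u)"
        using \<kappa> that norm_ge_zero[of x] by (intro mult_left_mono) linarith+
      also have "\<dots> \<le> norm (x + of_real u)" using lower[of u x] x that by simp
      finally show ?thesis by simp
    qed
    have ni: "x + of_nat k \<notin> \<int>\<^sub>\<le>\<^sub>0" for k
      using slit[OF x(2,3), of "real k"] nonpos_Ints_subset_nonpos_Reals by auto
    have "Gamma (x + 3) = (x + 2) * ((x + 1) * (x * Gamma x))"
      using Gamma_plus1[OF ni[of 0]] Gamma_plus1[OF ni[of 1]] Gamma_plus1[OF ni[of 2]]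
      by (simp add: add.assoc)
    moreover have "x + 1 \<noteq> 0" "x + 2 \<noteq> 0" using ni[of 1] ni[of 2] by auto
    ultimately have G: "Gamma x = Gamma (x + 3) / (x * ((x + 1) * (x + 2)))"
      using x by (simp add: eq_divide_eq mult_ac)
    have "norm (Gamma x) \<le> C1 / (norm x * (\<kappa> * \<kappa>))"
      unfolding G norm_divide norm_mult
      using x \<kappa> k[of 1] k[of 2] C1[of "x + 3"] C1p
      by (intro frac_le mult_mono mult_pos_pos) (auto simp: dist_norm)
    moreover have "norm (exp (- (x * Ln x))) \<le> exp (1 + pi)"
    proof -
      have "norm x * norm (Ln x) \<le> norm x * (\<bar>ln (norm x)\<bar> + pi)"
        using norm_Ln_le[OF x(2)] by (intro mult_left_mono) auto
      also have "\<dots> \<le> norm x * (1 / norm x + pi)"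
      proof -
        have "\<bar>ln (norm x)\<bar> = ln (1 / norm x)" using x by (simp add: ln_div)
        also have "\<dots> \<le> 1 / norm x - 1" using x by (intro ln_le_minus_one) auto
        finally show ?thesis by (intro mult_left_mono) auto
      qed
      also have "\<dots> \<le> 1 + pi" using x by (simp add: ring_distribs)
      finally have "norm (- (x * Ln x)) \<le> 1 + pi" by (simp add: norm_mult)
      then show ?thesis by (meson exp_le_cancel_iff norm_exp order.trans)
    qed
    moreover have "norm (exp x) \<le> exp 1"
      using x by (meson exp_le_cancel_iff norm_exp order.trans less_imp_le)
    ultimately have "norm (Gamma_div_power x * exp x) \<le> C1 / (norm x * (\<kappa> * \<kappa>)) * exp (1 + pi) * exp 1"
      unfolding Gamma_div_power_def norm_mult using C1p \<kappa> by (intro mult_mono) auto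
    also have "\<dots> = C2 * (1 / norm x)"
      by (simp add: C2_def power2_eq_square mult_exp_exp[symmetric] exp_add mult_ac) (simp add: mult_exp_exp)
    finally show ?thesis .
  qed
  show ?thesis
  proof (rule that[of "C0 * exp (3 * c) + C2"])
    have "C2 \<ge> 0" using C1p by (simp add: C2_def)
    then show "C0 * exp (3 * c) + C2 > 0" using C0 by (simp add: add_pos_nonneg)
    fix x :: complex assume x: "x \<noteq> 0" "\<bar>Arg x\<bar> \<le> \<omega>"
    have "norm (Gamma_div_power x * exp x) \<le> C0 * exp (3 * c) + C2 * (1 / norm x)"
      using large[of x] small[of x] x \<open>C2 \<ge> 0\<close> C0
      by (cases "norm x < 1") (auto intro: order.trans)
    also have "\<dots> \<le> (C0 * exp (3 * c) + C2) * (1 + 1 / norm x)"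
    proof -
      have "C0 * exp (3 * c) + C2 * (1 / norm x)
          \<le> (C0 * exp (3 * c) + C2) + (C0 * exp (3 * c) + C2) * (1 / norm x)"
        using \<open>C2 \<ge> 0\<close> C0 by (intro add_mono mult_right_mono) auto
      then show ?thesis by (simp only: distrib_left mult_1_right)
    qed
    finally show "norm (Gamma_div_power x * exp x) \<le> (C0 * exp (3 * c) + C2) * (1 + 1 / norm x)" .
  qed
qed

section \<open>Residues of powers of the phase function\<close>

text \<open>Serves as a residue theorem: once the residue term is subtracted, a primitive exists on
  the whole punctured set. The induction integrates by parts, which lowers the order of the pole by
  one and replaces \<open>K\<close> by its derivative; the base case is a removable
  singularity.\<close>

lemma primitive_pole:
  fixes K :: "complex \<Rightarrow> complex"
  assumes "open S" "convex S" "0 \<in> S" "K holomorphic_on S"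
  shows "\<exists>Q. \<forall>z\<in>S - {0}. (Q has_field_derivative (K z / z ^ Suc n - (deriv ^^ n) K 0 / fact n / z)) (at z)"
  using assms(4)
proof (induction n arbitrary: K)
  case 0
  let ?h = "\<lambda>z. if z = 0 then deriv K 0 else (K z - K 0) / (z - 0)"
  have "?h holomorphic_on S" using pole_lemma_open[OF 0 assms(1)] .
  then obtain Q where Q: "\<And>z. z \<in> S \<Longrightarrow> (Q has_field_derivative ?h z) (at z)"
    using holomorphic_convex_primitive'[OF assms(2,1)] assms(1) by (auto simp: at_within_open[of _ S])
  show ?case
  proof (intro exI[of _ Q] ballI)
    fix z assume "z \<in> S - {0}"
    then show "(Q has_field_derivative (K z / z ^ Suc 0 - (deriv ^^ 0) K 0 / fact 0 / z)) (at z)"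
      using Q[of z] by (simp add: diff_divide_distrib)
  qed
next
  case (Suc n)
  have "(\<lambda>z. deriv K z) holomorphic_on S" using Suc.prems assms(1) by (intro holomorphic_intros)
  from Suc.IH[OF this] obtain Q where
    Q: "\<And>z. z \<in> S - {0} \<Longrightarrow> (Q has_field_derivative (deriv K z / z ^ Suc n - (deriv ^^ n) (deriv K) 0 / fact n / z)) (at z)"
    by auto
  show ?case
  proof (intro exI[of _ "\<lambda>z. (Q z - K z / z ^ Suc n) / of_nat (Suc n)"] ballI)
    fix z assume z: "z \<in> S - {0}"
    have K: "(K has_field_derivative deriv K z) (at z)"
      using Suc.prems assms(1) z by (meson DiffD1 holomorphic_derivI)
    have P: "((\<lambda>z. z ^ Suc n) has_field_derivative of_nat (Suc n) * z ^ n) (at z)"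
      using DERIV_power_Suc[OF DERIV_ident, where x = z and s = UNIV and n = n] by (simp add: algebra_simps)
    have zn: "z ^ Suc n \<noteq> 0" using z by simp
    have "((\<lambda>z. (Q z - K z / z ^ Suc n) / of_nat (Suc n)) has_field_derivative
       ((deriv K z / z ^ Suc n - (deriv ^^ n) (deriv K) 0 / fact n / z)
          - (deriv K z * z ^ Suc n - K z * (of_nat (Suc n) * z ^ n)) / (z ^ Suc n * z ^ Suc n)) / of_nat (Suc n)) (at z)"
      by (intro DERIV_cdivide DERIV_diff Q[OF z] DERIV_divide[OF K P zn])
    moreover have "((deriv K z / z ^ Suc n - (deriv ^^ n) (deriv K) 0 / fact n / z)
          - (deriv K z * z ^ Suc n - K z * (of_nat (Suc n) * z ^ n)) / (z ^ Suc n * z ^ Suc n)) / of_nat (Suc n)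
        = K z / z ^ Suc (Suc n) - (deriv ^^ Suc n) K 0 / fact (Suc n) / z"
    proof -
      have nz: "of_nat (Suc n) \<noteq> (0 :: complex)" by (rule of_nat_neq_0)
      have e1: "(deriv K z * z ^ Suc n - K z * (of_nat (Suc n) * z ^ n)) / (z ^ Suc n * z ^ Suc n)
          = deriv K z / z ^ Suc n - of_nat (Suc n) * (K z / z ^ Suc (Suc n))"
        using z by (simp add: field_simps)
      have e2: "(deriv ^^ n) (deriv K) 0 / fact n / z = of_nat (Suc n) * ((deriv ^^ Suc n) K 0 / fact (Suc n) / z)"
        using z nz by (simp add: funpow_swap1 fact_Suc del: of_nat_Suc)
      have "(a - N * c - (a - N * k)) / N = k - c" if "N \<noteq> 0" for a N c k :: complex
        using that by (simp add: field_simps)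
      then show ?thesis
        unfolding e1 e2 using nz by blast
    qed
    ultimately show "((\<lambda>z. (Q z - K z / z ^ Suc n) / of_nat (Suc n)) has_field_derivative
        (K z / z ^ Suc (Suc n) - (deriv ^^ Suc n) K 0 / fact (Suc n) / z)) (at z)" by simp
  qed
qed

section \<open>Zeros of the phase function\<close>

definition phase :: "real \<Rightarrow> complex \<Rightarrow> complex" where
  "phase lam z = of_real lam * exp z + z - of_real lam"

lemma phase_holomorphic [holomorphic_intros]: "phase lam holomorphic_on A"
  unfolding phase_def by (intro holomorphic_intros)

lemma Re_phase: "Re (phase lam z) = lam * exp (Re z) * cos (Im z) + Re z - lam"
  and Im_phase: "Im (phase lam z) = lam * exp (Re z) * sin (Im z) + Im z"
  by (simp_all add: phase_def Re_exp Im_exp)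

text \<open>
  The lines \<open>\<bar>Im z\<bar> = pi\<close> must be interior, so the strip is slightly larger: a zero with \<open>pi < \<bar>Im z\<bar> < pi + \<epsilon>\<close>
  needs \<open>lam * exp (Re z) > pi / \<epsilon>\<close>, and then the real part of the phase is negative.
\<close>
lemma phase_zero_free_strip:
  assumes lam: "lam > 0"
  obtains \<epsilon> where "\<epsilon> > 0" "\<And>z. \<bar>Im z\<bar> < pi + \<epsilon> \<Longrightarrow> phase lam z = 0 \<Longrightarrow> z = 0"
proof -
  \<comment> \<open>With s = exp r, this inequality says that the real part of the phase is negative
    as soon as the cosine of Im z is at most - 1 / 2.\<close>
  have "eventually (\<lambda>s::real. ln s < lam * s / 2 + lam) at_top" using lam by real_asymp
  then obtain s0 where s0: "\<And>s. s \<ge> s0 \<Longrightarrow> ln s < lam * s / 2 + lam"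
    by (auto simp: eventually_at_top_linorder)
  \<comment> \<open>The bound 1 < pi / 3 yields cos \<delta> >= 1 / 2; the other bound makes a
    vanishing imaginary part force exp r > max s0 1.\<close>
  define \<epsilon> where "\<epsilon> = min 1 (pi / (lam * max s0 1))"
  have e: "\<epsilon> > 0" "\<epsilon> \<le> 1" "\<epsilon> \<le> pi / (lam * max s0 1)" using lam by (auto simp: \<epsilon>_def)
  have "z = 0" if z: "\<bar>Im z\<bar> < pi + \<epsilon>" "phase lam z = 0" for z
  proof -
    define r \<psi> where "r = Re z" and "\<psi> = \<bar>Im z\<bar>"
    have re: "lam * exp r * cos \<psi> + r - lam = 0"
      using z(2) Re_phase[of lam z] by (simp add: r_def \<psi>_def)
    have im: "lam * exp r * sin \<psi> + \<psi> = 0"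
      using z(2) Im_phase[of lam z] by (auto simp: r_def \<psi>_def abs_if)
    have \<psi>: "0 \<le> \<psi>" "\<psi> < pi + \<epsilon>" using z by (auto simp: \<psi>_def)
    consider "\<psi> = 0" | "0 < \<psi>" "\<psi> \<le> pi" | "pi < \<psi>" using \<psi> by linarith
    then show ?thesis
    proof cases
      case 1
      have "r = 0"
      proof (rule ccontr)
        assume "r \<noteq> 0"
        then have "r > 0 \<and> lam * exp r > lam * 1 \<or> r < 0 \<and> lam * exp r < lam * 1"
          using lam by (auto simp: mult_less_cancel_left neq_iff)
        then show False using re 1 by auto
      qed
      then show ?thesis using 1 by (simp add: complex_eq_iff r_def \<psi>_def)
    next
      case 2
      then have "sin \<psi> \<ge> 0" by (intro sin_ge_zero) auto
      \<comment> \<open>Inside the strip and off the real axis, both summands of the imaginary part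
        have the same sign and \<psi> is positive, so they cannot cancel.\<close>
      then have "lam * exp r * sin \<psi> \<ge> 0" using lam by simp
      then show ?thesis using im 2 by linarith
    next
      case 3
      define \<delta> where "\<delta> = \<psi> - pi"
      have d: "0 < \<delta>" "\<delta> < \<epsilon>" using 3 \<psi> by (auto simp: \<delta>_def)
      have sc: "sin \<psi> = - sin \<delta>" "cos \<psi> = - cos \<delta>" by (simp_all add: \<delta>_def sin_diff cos_diff)
      have "pi < lam * exp r * sin \<delta>" using im sc 3 by simp
      also have "\<dots> \<le> lam * exp r * \<epsilon>"
        using d lam sin_x_le_x[of \<delta>] by (intro mult_left_mono) auto
      also have "\<dots> \<le> lam * exp r * (pi / (lam * max s0 1))" using e lam by (intro mult_left_mono) auto
      also have "\<dots> = exp r * pi / max s0 1" using lam by simp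
      finally have "pi * max s0 1 < pi * exp r" by (simp add: pos_less_divide_eq mult.commute)
      then have "max s0 1 < exp r" by simp
      then have "ln (exp r) < lam * exp r / 2 + lam" by (intro s0) auto
      then have r: "r < lam * exp r / 2 + lam" by simp
      have "cos (pi / 3) \<le> cos \<delta>"
        using d e pi_gt3 by (intro cos_monotone_0_pi_le) auto
      then have "1 / 2 \<le> cos \<delta>" by (simp add: cos_60)
      then have "lam * exp r * (1 / 2) \<le> lam * exp r * cos \<delta>" using lam by (intro mult_left_mono) auto
      then show ?thesis using re r sc by simp
    qed
  qed
  then show ?thesis using that e by blast
qed

text \<open>The function is lam + 1 divided by the difference quotient of the phase at 0. The
  removable value of that quotient is the derivative lam + 1, in accordance with the value 1
  prescribed at 0.\<close>

lemma generating_fun_holomorphic: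
  assumes lam: "lam > 0" and S: "open S" and nz: "\<And>z. z \<in> S \<Longrightarrow> phase lam z = 0 \<Longrightarrow> z = 0"
  shows "generating_fun lam holomorphic_on S"
proof -
  let ?j = "\<lambda>z. if z = 0 then deriv (phase lam) 0 else (phase lam z - phase lam 0) / (z - 0)"
  have j: "?j holomorphic_on S" by (intro pole_lemma_open holomorphic_intros S)
  have d: "deriv (phase lam) 0 = of_real lam + 1"
    unfolding phase_def by (rule DERIV_imp_deriv) (auto intro!: derivative_eq_intros)
  have l: "of_real lam + 1 \<noteq> (0::complex)"
    using lam by (simp add: complex_eq_iff)
  have p0: "phase lam 0 = 0" by (simp add: phase_def)
  have "(\<lambda>z. of_real (lam + 1) / ?j z) holomorphic_on S"
    by (intro holomorphic_intros j) (use nz l in \<open>auto simp: d p0\<close>)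
  moreover have "generating_fun lam = (\<lambda>z. of_real (lam + 1) / ?j z)"
    using l by (auto simp: fun_eq_iff generating_fun_def d p0 phase_def)
  ultimately show ?thesis by simp
qed

text \<open>Needed because c / (r - i pi) - c / (r + i pi) = 2 pi i c / (r^2 + pi^2): with total
  mass 1, the pole term contributes exactly 2 pi i c.\<close>

lemma integral_inverse_pi_squares:
  "integrable lborel (\<lambda>r. 1 / (r\<^sup>2 + pi\<^sup>2))" "(LBINT r. 1 / (r\<^sup>2 + pi\<^sup>2)) = 1"
proof -
  have p: "r\<^sup>2 + pi\<^sup>2 > 0" for r by (simp add: add_nonneg_pos)
  show i: "integrable lborel (\<lambda>r. 1 / (r\<^sup>2 + pi\<^sup>2))"
  proof (rule integrable_bound_continuous)
    show "integrable lborel (\<lambda>r::real. inverse (1 + r\<^sup>2))"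
      using integrable_inverse_1_plus_square by (simp add: set_integrable_def)
    show "continuous_on UNIV (\<lambda>r. 1 / (r\<^sup>2 + pi\<^sup>2))"
      using p by (intro continuous_intros) (auto simp: less_le)
    have "1 \<le> pi\<^sup>2" using pi_gt3 by (simp add: one_le_power)
    then show "norm (1 / (r\<^sup>2 + pi\<^sup>2)) \<le> inverse (1 + r\<^sup>2)" for r
      using p[of r] by (auto simp: inverse_eq_divide intro!: divide_left_mono mult_pos_pos add_pos_nonneg)
  qed
  have D: "((\<lambda>r. arctan (r / pi) / pi) has_vector_derivative 1 / (r\<^sup>2 + pi\<^sup>2)) (at r)" for r
    unfolding has_real_derivative_iff_has_vector_derivative[symmetric]
    using p[of r] by (auto intro!: derivative_eq_intros simp: divide_simps power2_eq_square)
  have top: "((\<lambda>r. arctan (r / pi) / pi) \<longlongrightarrow> (pi / 2) / pi) at_top"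
    by (intro tendsto_intros filterlim_compose[OF tendsto_arctan_at_top]) (real_asymp, simp)
  have bot: "((\<lambda>r. arctan (r / pi) / pi) \<longlongrightarrow> (- (pi / 2)) / pi) at_bot"
    by (intro tendsto_intros filterlim_compose[OF tendsto_arctan_at_bot]) (real_asymp, simp)
  have "(LBINT r. 1 / (r\<^sup>2 + pi\<^sup>2)) = (pi / 2) / pi - (- (pi / 2)) / pi"
    using p by (intro integral_FTC_real_line[OF D _ i bot top] continuous_intros) (auto simp: less_le)
  then show "(LBINT r. 1 / (r\<^sup>2 + pi\<^sup>2)) = 1" by (simp add: field_simps)
qed

text \<open>The residue at 0, computed without closing the contour: after the pole term c / z is
  removed, the two line integrals agree, so the pole term alone carries the whole difference. The
  minus sign is due to taking the upper line minus the lower one.\<close>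

lemma strip_integral_phase:
  assumes lam: "lam > 0"
    and i1: "integrable lborel (\<lambda>r. 1 / phase lam (of_real r + \<i> * of_real pi) ^ Suc n)"
    and i2: "integrable lborel (\<lambda>r. 1 / phase lam (of_real r + \<i> * of_real (- pi)) ^ Suc n)"
  shows "(LBINT r. 1 / phase lam (of_real r + \<i> * of_real pi) ^ Suc n
        - 1 / phase lam (of_real r + \<i> * of_real (- pi)) ^ Suc n)
    = - 2 * of_real pi * \<i> * ((deriv ^^ n) (\<lambda>t. generating_fun lam t ^ Suc n) 0 / fact n) / of_real (lam + 1) ^ Suc n"
proof -
  obtain \<epsilon> where e: "\<epsilon> > 0" "\<And>z. \<bar>Im z\<bar> < pi + \<epsilon> \<Longrightarrow> phase lam z = 0 \<Longrightarrow> z = 0"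
    using phase_zero_free_strip[OF lam] by blast
  define S where "S = {z. \<bar>Im z\<bar> < pi + \<epsilon>}"
  have S_eq: "S = {z. Im z < pi + \<epsilon>} \<inter> {z. - (pi + \<epsilon>) < Im z}" by (auto simp: S_def)
  have S: "open S" "convex S"
    unfolding S_eq
    by (intro open_Int convex_Int open_halfspace_Im_lt open_halfspace_Im_gt convex_halfspace_Im_lt convex_halfspace_Im_gt)+
  have S0: "0 \<in> S" using e(1) pi_gt_zero by (simp add: S_def add_pos_pos)
  define K where "K t = generating_fun lam t ^ Suc n" for t
  have K: "K holomorphic_on S"
    unfolding K_def by (intro holomorphic_intros generating_fun_holomorphic lam S) (auto simp: S_def e)
  \<comment> \<open>As L / phase^(n+1) equals K z / z^(n+1) off 0, this is its residue
    there.\<close>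
  define c where "c = (deriv ^^ n) K 0 / fact n"
  define L where "L = complex_of_real (lam + 1) ^ Suc n"
  have L: "L \<noteq> 0" using lam unfolding L_def by (metis less_add_one less_trans of_real_eq_0_iff power_not_zero zero_less_one add_pos_pos less_irrefl)
  obtain Q where Q: "\<And>z. z \<in> S - {0} \<Longrightarrow> (Q has_field_derivative (K z / z ^ Suc n - c / z)) (at z)"
    using primitive_pole[OF S S0 K, of n] unfolding c_def by auto
  define q where "q z = L / phase lam z ^ Suc n - c / z" for z
  have Kq: "K z / z ^ Suc n - c / z = q z" if "z \<noteq> 0" for z
    using that by (simp add: K_def q_def L_def generating_fun_def phase_def power_divide power_mult_distrib del: power_Suc)
  have Q: "(Q has_field_derivative q z) (at z)" if "z \<in> S - {0}" for z
    using Q[OF that] Kq[of z] that by auto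
  have nz: "of_real r + \<i> * of_real y \<noteq> 0" if "r \<noteq> 0 \<or> y \<noteq> 0" for r y
    using that by (auto simp: complex_eq_iff)
  have inS: "of_real r + \<i> * of_real y \<in> S" if "\<bar>y\<bar> \<le> pi" for r y
    using that e by (auto simp: S_def)
  have diff: "q (of_real r + \<i> * of_real pi) - q (of_real r + \<i> * of_real (- pi))
     = L * (1 / phase lam (of_real r + \<i> * of_real pi) ^ Suc n - 1 / phase lam (of_real r + \<i> * of_real (- pi)) ^ Suc n)
       + (2 * of_real pi * \<i> * c) * of_real (1 / (r\<^sup>2 + pi\<^sup>2))" for r
  proof -
    have "(of_real r + \<i> * of_real pi) * (of_real r + \<i> * of_real (- pi)) = complex_of_real (r\<^sup>2 + pi\<^sup>2)"
      by (simp add: complex_eq_iff power2_eq_square)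
    moreover have "c / (of_real r + \<i> * of_real (- pi)) - c / (of_real r + \<i> * of_real pi)
       = c * (2 * \<i> * of_real pi) / ((of_real r + \<i> * of_real pi) * (of_real r + \<i> * of_real (- pi)))"
      using nz[of r pi] nz[of r "- pi"] by (simp add: diff_frac_eq) (simp add: algebra_simps)
    ultimately have "c / (of_real r + \<i> * of_real (- pi)) - c / (of_real r + \<i> * of_real pi)
       = (2 * of_real pi * \<i> * c) * of_real (1 / (r\<^sup>2 + pi\<^sup>2))"
      by simp
    then show ?thesis unfolding q_def by (simp add: algebra_simps del: power_Suc)
  qed
  have i3: "integrable lborel (\<lambda>r. (2 * of_real pi * \<i> * c) * complex_of_real (1 / (r\<^sup>2 + pi\<^sup>2)))"
    by (intro integrable_mult_right integrable_of_real integral_inverse_pi_squares)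
  have i4: "integrable lborel (\<lambda>r. L * (1 / phase lam (of_real r + \<i> * of_real pi) ^ Suc n - 1 / phase lam (of_real r + \<i> * of_real (- pi)) ^ Suc n))"
    by (intro integrable_mult_right Bochner_Integration.integrable_diff i1 i2)
  \<comment> \<open>Valid where |phase| >= |r| / 2. Far to the right the exponential dominates the
    phase, far to the left its linear term does.\<close>
  define B where "B r = norm L * (2 / \<bar>r\<bar>) ^ Suc n + norm c / \<bar>r\<bar>" for r :: real
  have vert: "norm (q (of_real r + \<i> * of_real y)) \<le> B r"
    if r: "r \<noteq> 0" and y: "\<bar>y\<bar> \<le> pi" and p: "norm (phase lam (of_real r + \<i> * of_real y)) \<ge> \<bar>r\<bar> / 2" for r y
  proof -
    have a: "norm (of_real r + \<i> * of_real y) \<ge> \<bar>r\<bar>"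
      using abs_Re_le_cmod[of "of_real r + \<i> * of_real y"] by simp
    have "norm (q (of_real r + \<i> * of_real y)) \<le> norm L / norm (phase lam (of_real r + \<i> * of_real y)) ^ Suc n + norm c / norm (of_real r + \<i> * of_real y)"
      unfolding q_def by (rule order.trans[OF norm_triangle_ineq4]) (simp only: norm_divide norm_power order.refl)
    also have "\<dots> \<le> norm L / (\<bar>r\<bar> / 2) ^ Suc n + norm c / \<bar>r\<bar>"
      using r p a by (intro add_mono divide_left_mono power_mono mult_pos_pos zero_less_power) auto
    also have "\<dots> = B r" by (simp add: B_def power_divide del: power_Suc)
    finally show ?thesis .
  qed
  have pb: "norm (phase lam (of_real r + \<i> * of_real y)) \<ge> \<bar>r\<bar> - lam * exp r - lam"
    and pt: "norm (phase lam (of_real r + \<i> * of_real y)) \<ge> lam * exp r - \<bar>r\<bar> - pi - lam"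
    if "\<bar>y\<bar> \<le> pi" for r y
  proof -
    let ?z = "of_real r + \<i> * of_real y"
    have peq: "phase lam ?z = of_real lam * exp ?z + (?z - of_real lam)" by (simp add: phase_def)
    have l: "norm (of_real lam :: complex) = lam" "norm (of_real lam * exp ?z) = lam * exp r"
      using lam by (simp_all add: norm_mult)
    have z: "\<bar>r\<bar> \<le> norm ?z" "norm ?z \<le> \<bar>r\<bar> + pi"
      using abs_Re_le_cmod[of ?z] cmod_le[of ?z] that by auto
    have "norm (?z - of_real lam) \<ge> norm ?z - norm (of_real lam :: complex)" by (rule norm_triangle_ineq2)
    moreover have "norm (?z - of_real lam) \<le> norm ?z + norm (of_real lam :: complex)" by (rule norm_triangle_ineq4)
    moreover have "norm (of_real lam * exp ?z + (?z - of_real lam)) \<ge> norm (?z - of_real lam) - norm (of_real lam * exp ?z)"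
      by (metis add.commute norm_diff_ineq)
    moreover have "norm (of_real lam * exp ?z + (?z - of_real lam)) \<ge> norm (of_real lam * exp ?z) - norm (?z - of_real lam)"
      by (rule norm_diff_ineq)
    ultimately show "norm (phase lam ?z) \<ge> \<bar>r\<bar> - lam * exp r - lam"
      "norm (phase lam ?z) \<ge> lam * exp r - \<bar>r\<bar> - pi - lam" unfolding peq using l z by - linarith+
  qed
  have "(LBINT r. q (of_real r + \<i> * of_real pi) - q (of_real r + \<i> * of_real (- pi))) = 0"
  proof (rule strip_shift_primitive[OF Q, where B = B])
    show "continuous_on (S - {0}) q"
      unfolding q_def by (intro continuous_intros holomorphic_on_imp_continuous_on holomorphic_intros) (auto simp: S_def e)
    show "of_real r + \<i> * of_real (- pi) \<in> S - {0}" "of_real r + \<i> * of_real pi \<in> S - {0}" for r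
      using inS[of "-pi" r] inS[of pi r] nz[of r pi] nz[of r "- pi"] by auto
    show "integrable lborel (\<lambda>r. q (of_real r + \<i> * of_real pi) - q (of_real r + \<i> * of_real (- pi)))"
      unfolding diff by (intro Bochner_Integration.integrable_add i3 i4)
    have seg: "\<bar>y\<bar> \<le> pi" if "y \<in> closed_segment (- pi) pi" for y
      using that by (auto simp: closed_segment_eq_real_ivl)
    have "eventually (\<lambda>r. r > 0 \<and> lam * exp r - r - pi - lam \<ge> r / 2) at_top"
      using lam by (intro eventually_conj eventually_gt_at_top) real_asymp
    then show "eventually (\<lambda>r. \<forall>y\<in>closed_segment (- pi) pi. of_real r + \<i> * of_real y \<in> S - {0} \<and>
        norm (q (of_real r + \<i> * of_real y)) \<le> B r) at_top"
    proof eventually_elim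
      case (elim r)
      show ?case
      proof
        fix y assume "y \<in> closed_segment (- pi) pi"
        then have y: "\<bar>y\<bar> \<le> pi" by (rule seg)
        have "norm (phase lam (of_real r + \<i> * of_real y)) \<ge> \<bar>r\<bar> / 2"
          using elim pt[OF y, of r] by linarith
        then show "of_real r + \<i> * of_real y \<in> S - {0} \<and> norm (q (of_real r + \<i> * of_real y)) \<le> B r"
          using elim inS[OF y, of r] nz[of r y] y by (auto intro!: vert)
      qed
    qed
    have "eventually (\<lambda>r. r < 0 \<and> - r - lam * exp r - lam \<ge> - r / 2) at_bot"
      using lam by (intro eventually_conj) real_asymp+
    then show "eventually (\<lambda>r. \<forall>y\<in>closed_segment (- pi) pi. of_real r + \<i> * of_real y \<in> S - {0} \<and>
        norm (q (of_real r + \<i> * of_real y)) \<le> B r) at_bot"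
    proof eventually_elim
      case (elim r)
      show ?case
      proof
        fix y assume "y \<in> closed_segment (- pi) pi"
        then have y: "\<bar>y\<bar> \<le> pi" by (rule seg)
        have "norm (phase lam (of_real r + \<i> * of_real y)) \<ge> \<bar>r\<bar> / 2"
          using elim pb[OF y, of r] by linarith
        then show "of_real r + \<i> * of_real y \<in> S - {0} \<and> norm (q (of_real r + \<i> * of_real y)) \<le> B r"
          using elim inS[OF y, of r] nz[of r y] y by (auto intro!: vert)
      qed
    qed
    have i: "((\<lambda>r::real. inverse \<bar>r\<bar>) \<longlongrightarrow> 0) at_top" "((\<lambda>r::real. inverse \<bar>r\<bar>) \<longlongrightarrow> 0) at_bot"
      by real_asymp+
    have Be: "B = (\<lambda>r. norm L * (2 * inverse \<bar>r\<bar>) ^ Suc n + norm c * inverse \<bar>r\<bar>)"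
      by (simp add: B_def fun_eq_iff divide_inverse)
    show "(B \<longlongrightarrow> 0) at_top" "(B \<longlongrightarrow> 0) at_bot"
      unfolding Be by (rule tendsto_eq_intros i refl | simp)+
  qed
  then have "L * (LBINT r. 1 / phase lam (of_real r + \<i> * of_real pi) ^ Suc n - 1 / phase lam (of_real r + \<i> * of_real (- pi)) ^ Suc n)
      + 2 * of_real pi * \<i> * c = 0"
    unfolding diff
    by (subst (asm) Bochner_Integration.integral_add[OF i4 i3])
      (simp only: integral_mult_right_zero integral_complex_of_real integral_inverse_pi_squares of_real_1 mult_1_right)
  then have "(LBINT r. 1 / phase lam (of_real r + \<i> * of_real pi) ^ Suc n - 1 / phase lam (of_real r + \<i> * of_real (- pi)) ^ Suc n)
      = - (2 * of_real pi * \<i> * c) / L"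
  proof -
    have "I = - x / L" if "L * I + x = 0" for I x
    proof -
      have "x = - (L * I)" using that by (simp add: eq_neg_iff_add_eq_0 add.commute)
      then show ?thesis using L by simp
    qed
    then show ?thesis using \<open>L * _ + _ = 0\<close> by blast
  qed
  moreover have "K = (\<lambda>t. generating_fun lam t ^ Suc n)" by (simp add: K_def fun_eq_iff)
  ultimately show ?thesis by (simp add: c_def L_def del: power_Suc)
qed

section \<open>The coefficients as ray integrals\<close>

text \<open>
  On the upper half plane this is \<open>Gamma x * (- x) powr (- x)\<close> times \<open>(lam * exp lam) powr (- x)\<close>, where the
  power of \<open>- x\<close> is principal.
\<close>
definition ray_kernel :: "real \<Rightarrow> complex \<Rightarrow> complex" where
  "ray_kernel lam x = Gamma_div_power x * exp x * exp (- (x * cnj (log_const lam)))"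

lemma integral_power_exp_real:
  assumes "c > (0::real)"
  shows "(LBINT t:{0<..}. t ^ n * exp (- (c * t))) = fact n / c ^ Suc n"
proof -
  have "complex_of_real (LBINT t:{0<..}. t ^ n * exp (- (c * t))) = of_real (fact n / c ^ Suc n)"
    using integral_power_exp_complex(2)[of "of_real c" n] assms
    by (simp add: set_integral_complex_of_real[symmetric] exp_of_real[symmetric])
  then show ?thesis by (simp only: of_real_eq_iff)
qed

lemma exp_minus_self_lower: "exp r - r \<ge> max 1 \<bar>r\<bar>" for r :: real
proof -
  have "exp r - r \<ge> \<bar>r\<bar>"
  proof (cases "r \<ge> 0")
    case True
    then have "1 + r + r\<^sup>2 / 2 \<le> exp r" by (rule exp_lower_Taylor_quadratic)
    moreover have "0 \<le> (r - 1)\<^sup>2" by simp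
    ultimately show ?thesis using True by (simp add: power2_eq_square algebra_simps)
  qed (use exp_gt_zero[of r] in linarith)
  then show ?thesis using exp_ge_add_one_self[of r] by linarith
qed

text \<open>For fixed r the integral over t is fact n / p^(n+1). On the ray, the rate Re (cis
  \<theta> * p r) is positive and grows at least linearly in |r|, so that n >= 1 makes its power n +
  1 integrable in r; this justifies Fubini.\<close>

lemma ray_kernel_integral_strip:
  fixes n :: nat
  assumes \<theta>: "0 \<le> \<theta>" "\<theta> < pi / 2" and \<kappa>: "0 < Re (cis \<theta> * cnj (log_const lam))" and n: "n \<ge> 1"
  defines "p \<equiv> \<lambda>r. cnj (log_const lam) + of_real (exp r - r - 1)"
  shows "set_integrable lborel {0<..} (\<lambda>t. (of_real t * cis \<theta>) ^ n * ray_kernel lam (of_real t * cis \<theta>) * cis \<theta>)"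
    "(LBINT t:{0<..}. (of_real t * cis \<theta>) ^ n * ray_kernel lam (of_real t * cis \<theta>) * cis \<theta>) = fact n * (LBINT r. 1 / p r ^ Suc n)"
    "integrable lborel (\<lambda>r. 1 / p r ^ Suc n)"
proof -
  define \<kappa>' where "\<kappa>' = Re (cis \<theta> * cnj (log_const lam))"
  define \<rho> where "\<rho> r = Re (cis \<theta> * p r)" for r
  have ct: "cos \<theta> > 0" using \<theta> by (intro cos_gt_zero_pi) auto
  \<comment> \<open>The rate is \<kappa>' + cos \<theta> * (exp r - r - 1) with a nonnegative
    bracket, hence at least m * (exp r - r).\<close>
  define m where "m = min \<kappa>' (cos \<theta>)"
  have m: "m > 0" using \<kappa> ct by (simp add: m_def \<kappa>'_def)
  have \<rho>_lower: "\<rho> r \<ge> m * max 1 \<bar>r\<bar>" for r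
  proof -
    have "m * max 1 \<bar>r\<bar> \<le> m * (exp r - r)" using exp_minus_self_lower[of r] m by (intro mult_left_mono) auto
    also have "\<dots> = m * 1 + m * (exp r - r - 1)" by (simp add: algebra_simps)
    also have "\<dots> \<le> \<kappa>' * 1 + cos \<theta> * (exp r - r - 1)"
      using exp_ge_add_one_self[of r] by (intro add_mono mult_right_mono) (auto simp: m_def le_diff_eq add.commute)
    also have "\<dots> = \<rho> r" by (simp add: \<rho>_def p_def \<kappa>'_def algebra_simps)
    finally show ?thesis .
  qed
  have \<rho>: "\<rho> r > 0" for r
    using \<rho>_lower[of r] m by (smt (verit) max.cobounded1 mult_pos_pos)
  have p0: "p r \<noteq> 0" for r using \<rho>[of r] by (auto simp: \<rho>_def)
  have c\<rho>: "continuous_on UNIV \<rho>" unfolding \<rho>_def p_def by (intro continuous_intros)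
  have cp: "continuous_on UNIV p" unfolding p_def by (intro continuous_intros)
  have \<rho>_bound: "1 / \<rho> r ^ Suc n \<le> 2 / m ^ Suc n * inverse (1 + r\<^sup>2)" for r
  proof -
    have "(1 + r\<^sup>2) / 2 \<le> (max 1 \<bar>r\<bar>)\<^sup>2"
    proof -
      have "1 \<le> (max 1 \<bar>r\<bar>)\<^sup>2" by (intro one_le_power) auto
      moreover have "\<bar>r\<bar>\<^sup>2 \<le> (max 1 \<bar>r\<bar>)\<^sup>2" by (intro power_mono) auto
      moreover have "(1 + x) / 2 \<le> y" if "1 \<le> y" "x \<le> y" for x y :: real using that by (simp add: divide_le_eq)
      ultimately show ?thesis unfolding power2_abs by blast
    qed
    also have "\<dots> \<le> (max 1 \<bar>r\<bar>) ^ Suc n" using n by (intro power_increasing) auto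
    finally have "m ^ Suc n * ((1 + r\<^sup>2) / 2) \<le> m ^ Suc n * (max 1 \<bar>r\<bar>) ^ Suc n"
      using m by (intro mult_left_mono) auto
    also have "\<dots> \<le> \<rho> r ^ Suc n"
      unfolding power_mult_distrib[symmetric] using \<rho>_lower[of r] m by (intro power_mono mult_nonneg_nonneg) auto
    finally have "1 / \<rho> r ^ Suc n \<le> 1 / (m ^ Suc n * ((1 + r\<^sup>2) / 2))"
      using m \<rho>[of r] by (intro divide_left_mono mult_pos_pos zero_less_power) (auto simp: add_pos_nonneg)
    then show ?thesis by (simp add: field_simps)
  qed
  have sq: "integrable lborel (\<lambda>r::real. C * inverse (1 + r\<^sup>2))" for C
    using integrable_inverse_1_plus_square by (simp add: set_integrable_def)
  have i\<rho>: "integrable lborel (\<lambda>r. 1 / \<rho> r ^ Suc n)"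
    by (rule integrable_bound_continuous[OF sq[of "2 / m ^ Suc n"]])
      (use \<rho> \<rho>_bound in \<open>auto intro!: continuous_intros c\<rho> simp: less_le simp del: power_Suc\<close>)
  show ip: "integrable lborel (\<lambda>r. 1 / p r ^ Suc n)"
  proof (rule integrable_bound_continuous[OF i\<rho>])
    fix r
    have "\<rho> r \<le> norm (p r)"
      using complex_Re_le_cmod[of "cis \<theta> * p r"] by (simp add: \<rho>_def norm_mult)
    then show "norm (1 / p r ^ Suc n) \<le> 1 / \<rho> r ^ Suc n"
      unfolding norm_divide norm_power norm_one
      using \<rho>[of r] by (intro divide_left_mono power_mono mult_pos_pos zero_less_power) auto
  qed (use p0 in \<open>auto intro!: continuous_intros cp simp del: power_Suc\<close>)
  define F where "F r t = indicator {0<..} t *\<^sub>R ((of_real t * cis \<theta>) ^ n * cis \<theta> * exp (- (of_real t * cis \<theta> * p r)))" for r t :: real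
  have meas: "case_prod F \<in> borel_measurable (lborel \<Otimes>\<^sub>M lborel)"
    unfolding F_def p_def by measurable
  have F2: "F r t = cis \<theta> ^ Suc n * (indicator {0<..} t *\<^sub>R (of_real t ^ n * exp (- ((cis \<theta> * p r) * of_real t))))" for r t
    by (simp add: F_def power_mult_distrib indicator_def mult_ac)
  have nF: "norm (F r t) = indicator {0<..} t *\<^sub>R (t ^ n * exp (- (\<rho> r * t)))" for r t
    by (simp add: F2 norm_mult norm_power norm_exp_eq_Re \<rho>_def indicator_def del: power_Suc)
  have Fr: "integrable lborel (F r)" "(LBINT t. F r t) = fact n / p r ^ Suc n" for r
  proof -
    have r: "Re (cis \<theta> * p r) > 0" using \<rho>[of r] by (simp add: \<rho>_def)
    show "integrable lborel (F r)"
      unfolding F2 using integral_power_exp_complex(1)[OF r, of n]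
      by (intro integrable_mult_right) (simp add: set_integrable_def)
    have "(LBINT t. F r t) = cis \<theta> ^ Suc n * (fact n / (cis \<theta> * p r) ^ Suc n)"
      unfolding F2 integral_power_exp_complex(2)[OF r, of n, symmetric] set_lebesgue_integral_def
      by (rule integral_mult_right_zero)
    then show "(LBINT t. F r t) = fact n / p r ^ Suc n"
      by (simp add: power_mult_distrib del: power_Suc)
  qed
  have int: "integrable (lborel \<Otimes>\<^sub>M lborel) (case_prod F)"
  proof (rule lborel_pair.Fubini_integrable[OF meas])
    have e: "(LBINT t. norm (F r t)) = fact n * (1 / \<rho> r ^ Suc n)" for r
      unfolding nF using integral_power_exp_real[OF \<rho>[of r], of n] by (simp add: set_lebesgue_integral_def del: power_Suc)
    show "integrable lborel (\<lambda>r. LBINT t. norm (case_prod F (r, t)))"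
      unfolding case_prod_conv e by (rule integrable_mult_right[OF i\<rho>])
  qed (use Fr in auto)
  have inner: "(LBINT r. F r t) = indicator {0<..} t *\<^sub>R ((of_real t * cis \<theta>) ^ n * ray_kernel lam (of_real t * cis \<theta>) * cis \<theta>)" for t
  proof (cases "t > 0")
    case True
    define x where "x = of_real t * cis \<theta>"
    have "Re x > 0" using True ct by (simp add: x_def)
    note H = Gamma_div_power_integral[OF this]
    have "F r t = (x ^ n * cis \<theta> * (exp x * exp (- (x * cnj (log_const lam))))) * exp (x * of_real (r - exp r))" for r
      using True by (simp add: F_def p_def flip: x_def exp_add) (simp add: algebra_simps)
    then have "(LBINT r. F r t) = (x ^ n * cis \<theta> * (exp x * exp (- (x * cnj (log_const lam))))) * Gamma_div_power x"
      using H by simp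
    then show ?thesis using True by (simp add: ray_kernel_def x_def mult_ac)
  qed (simp add: F_def)
  have "integrable lborel (\<lambda>t. LBINT r. F r t)"
    using lborel_pair.integrable_snd[OF int] by simp
  then show "set_integrable lborel {0<..} (\<lambda>t. (of_real t * cis \<theta>) ^ n * ray_kernel lam (of_real t * cis \<theta>) * cis \<theta>)"
    unfolding set_integrable_def inner .
  have "(LBINT t. LBINT r. F r t) = (LBINT r. LBINT t. F r t)"
    using lborel_pair.Fubini_integral[OF int] by simp
  also have "\<dots> = (LBINT r. fact n * (1 / p r ^ Suc n))"
    unfolding Fr by (simp del: power_Suc)
  also have "\<dots> = fact n * (LBINT r. 1 / p r ^ Suc n)" by (rule integral_mult_right_zero)
  finally show "(LBINT t:{0<..}. (of_real t * cis \<theta>) ^ n * ray_kernel lam (of_real t * cis \<theta>) * cis \<theta>) = fact n * (LBINT r. 1 / p r ^ Suc n)"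
    unfolding inner set_lebesgue_integral_def .
qed

text \<open>Translating r by ln lam turns \<open>p\<close> into minus the phase on the line Im z =
  pi. Conjugation supplies the line Im z = - pi, so I - cnj I becomes the difference of the two line
  integrals; the minus in front of the phase produces the alternating sign.\<close>

lemma b_coeff_ray:
  fixes n :: nat
  assumes lam: "lam > 0" and \<theta>: "0 \<le> \<theta>" "\<theta> < pi / 2"
    and \<kappa>: "0 < Re (cis \<theta> * cnj (log_const lam))" and n: "n \<ge> 1"
  defines "I \<equiv> (LBINT t:{0<..}. (of_real t * cis \<theta>) ^ n * ray_kernel lam (of_real t * cis \<theta>) * cis \<theta>)"
  shows "b_coeff n lam = (-1) ^ n * of_real (lam + 1) ^ (2 * n + 1) / (2 * of_real pi * \<i>) * (I - cnj I)"
proof -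
  define p where "p r = cnj (log_const lam) + of_real (exp r - r - 1)" for r
  define P where "P y r = 1 / phase lam (of_real r + \<i> * of_real y) ^ Suc n" for y r
  note S = ray_kernel_integral_strip[OF \<theta> \<kappa> n, folded p_def I_def]
  have p: "p (ln lam + 1 * r) = - phase lam (of_real r + \<i> * of_real pi)" for r
    using lam by (simp add: p_def log_const_def phase_def exp_add complex_eq_iff Re_exp Im_exp)
  have pP: "1 / p (ln lam + 1 * r) ^ Suc n = (-1) ^ Suc n * P pi r" for r
    unfolding p P_def by (subst power_minus) (simp add: divide_simps del: power_Suc)
  have "integrable lborel (\<lambda>r. 1 / p (ln lam + 1 * r) ^ Suc n)"
    by (rule lborel_integrable_real_affine[OF S(3)]) simp
  then have "integrable lborel (\<lambda>r. (-1) ^ Suc n * ((-1) ^ Suc n * P pi r))"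
    unfolding pP by (rule integrable_mult_right)
  moreover have sgn: "(-1) ^ Suc n * ((-1) ^ Suc n * x) = x" for x :: complex
    by (simp flip: mult.assoc power_mult_distrib)
  ultimately have i1: "integrable lborel (P pi)" by (simp only: sgn)
  have cP: "cnj (P pi r) = P (- pi) r" for r
    by (simp add: P_def phase_def exp_cnj del: power_Suc)
  have i2: "integrable lborel (P (- pi))"
    using integrable_cnj[OF i1] by (simp only: cP)
  define J where "J = (LBINT r. P pi r)"
  have cJ: "cnj J = (LBINT r. P (- pi) r)"
    unfolding J_def cP[symmetric] by (rule Bochner_Integration.integral_cnj[symmetric])
  have "(LBINT r. 1 / p r ^ Suc n) = (LBINT r. 1 / p (ln lam + 1 * r) ^ Suc n)"
    using lborel_integral_real_affine[of 1 "\<lambda>r. 1 / p r ^ Suc n" "ln lam"] by simp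
  also have "\<dots> = (-1) ^ Suc n * J"
    unfolding pP J_def by (rule integral_mult_right_zero)
  finally have I: "I = fact n * ((-1) ^ Suc n * J)" using S(2) by simp
  define d where "d = (deriv ^^ n) (\<lambda>t. generating_fun lam t ^ Suc n) 0"
  define L where "L = complex_of_real (lam + 1)"
  have L: "L \<noteq> 0" using lam by (auto simp: L_def complex_eq_iff)
  have JD: "J - cnj J = - 2 * of_real pi * \<i> * (d / fact n) / L ^ Suc n"
    using strip_integral_phase[OF lam, of n, folded P_def d_def L_def, OF i1 i2] i1 i2
    by (simp add: J_def cJ[unfolded J_def] del: power_Suc)
  have "I - cnj I = fact n * (-1) ^ Suc n * (J - cnj J)"
    unfolding I by (simp add: algebra_simps)
  also note JD
  also have "fact n * (-1) ^ Suc n * (- 2 * of_real pi * \<i> * (d / fact n) / L ^ Suc n)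
      = (-1) ^ n * (2 * of_real pi * \<i> * d / L ^ Suc n)" by simp
  finally have ID: "I - cnj I = (-1) ^ n * (2 * of_real pi * \<i> * d / L ^ Suc n)" .
  have gen: "s * A / c * (s * (c * d / B)) = (s * s) * (A / B) * d" if "c \<noteq> 0" for s A B c :: complex
    using that by simp
  have "(-1) ^ n * L ^ (2 * n + 1) / (2 * of_real pi * \<i>) * (I - cnj I)
      = ((-1) ^ n * (-1) ^ n) * (L ^ (2 * n + 1) / L ^ Suc n) * d"
    unfolding ID by (rule gen) simp
  also have "\<dots> = L ^ n * d"
  proof -
    have "L ^ (2 * n + 1) = L ^ n * L ^ Suc n" by (simp add: mult_2 flip: power_add)
    moreover have "((-1) ^ n * (-1) ^ n :: complex) = 1" by (simp flip: power_mult_distrib)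
    ultimately show ?thesis using L by simp
  qed
  also have "\<dots> = b_coeff n lam" by (simp add: b_coeff_def L_def d_def)
  finally show ?thesis by (simp add: L_def)
qed

section \<open>The first two coefficients in closed form\<close>

lemma b_coeff_0: "b_coeff 0 lam = 1"
  by (simp add: b_coeff_def generating_fun_def)

text \<open>Differentiating the product g * phase = (lam + 1) * t twice at 0 avoids the quotient
  with its vanishing denominator. It gives 2 (lam + 1) g'(0) = - lam, and b_1 = (lam + 1) * 2
  g'(0).\<close>

lemma b_coeff_1:
  assumes lam: "lam > 0"
  shows "b_coeff 1 lam = - of_real lam"
proof -
  obtain \<epsilon> where e: "\<epsilon> > 0" "\<And>z. \<bar>Im z\<bar> < pi + \<epsilon> \<Longrightarrow> phase lam z = 0 \<Longrightarrow> z = 0"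
    using phase_zero_free_strip[OF lam] by blast
  define S where "S = ball (0 :: complex) pi"
  have S: "open S" "0 \<in> S" by (auto simp: S_def)
  have nz: "z = 0" if "z \<in> S" "phase lam z = 0" for z
  proof (rule e(2))
    show "\<bar>Im z\<bar> < pi + \<epsilon>" using that e(1) abs_Im_le_cmod[of z] by (simp add: S_def)
  qed (rule that)
  let ?g = "generating_fun lam" and ?L = "complex_of_real (lam + 1)"
  have g: "?g holomorphic_on S" by (rule generating_fun_holomorphic[OF lam S(1) nz])
  then have g': "deriv ?g holomorphic_on S" using S(1) by (rule holomorphic_deriv)
  have ph: "(phase lam has_field_derivative of_real lam * exp z + 1) (at z)" for z
    unfolding phase_def by (auto intro!: derivative_eq_intros)
  have first: "deriv ?g z * phase lam z + ?g z * (of_real lam * exp z + 1) = ?L" if z: "z \<in> S" for z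
  proof (rule DERIV_unique)
    show "((\<lambda>z. ?g z * phase lam z) has_field_derivative deriv ?g z * phase lam z + ?g z * (of_real lam * exp z + 1)) (at z)"
      using DERIV_mult[OF holomorphic_derivI[OF g S(1) z] ph[of z]] by (simp add: algebra_simps)
    show "((\<lambda>z. ?g z * phase lam z) has_field_derivative ?L) (at z)"
    proof (rule has_field_derivative_transform_within_open[OF _ S(1) z])
      show "((\<lambda>z. ?L * z) has_field_derivative ?L) (at z)" by (auto intro!: derivative_eq_intros)
      show "?L * w = ?g w * phase lam w" if "w \<in> S" for w
        using nz[OF that] by (auto simp: generating_fun_def phase_def)
    qed
  qed
  have p0: "phase lam 0 = 0" and g0: "?g 0 = 1" by (simp_all add: phase_def generating_fun_def)
  have "deriv (deriv ?g) 0 * phase lam 0 + deriv ?g 0 * (of_real lam * exp 0 + 1)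
      + (deriv ?g 0 * (of_real lam * exp 0 + 1) + ?g 0 * (of_real lam * exp 0)) = 0"
  proof (rule DERIV_unique)
    let ?h = "\<lambda>z. deriv ?g z * phase lam z + ?g z * (of_real lam * exp z + 1)"
    have e': "((\<lambda>z. of_real lam * exp z + 1) has_field_derivative of_real lam * exp 0) (at 0)"
      by (auto intro!: derivative_eq_intros)
    show "(?h has_field_derivative (deriv (deriv ?g) 0 * phase lam 0 + deriv ?g 0 * (of_real lam * exp 0 + 1)
      + (deriv ?g 0 * (of_real lam * exp 0 + 1) + ?g 0 * (of_real lam * exp 0)))) (at 0)"
      using DERIV_add[OF DERIV_mult[OF holomorphic_derivI[OF g' S] ph[of 0]] DERIV_mult[OF holomorphic_derivI[OF g S] e']]
      by (simp add: algebra_simps)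
    show "(?h has_field_derivative 0) (at 0)"
      by (rule has_field_derivative_transform_within_open[OF DERIV_const S]) (use first in auto)
  qed
  then have d: "2 * (?L * deriv ?g 0) = - of_real lam"
    by (simp add: p0 g0 algebra_simps eq_neg_iff_add_eq_0)
  have "deriv (\<lambda>t. ?g t ^ (1 + 1)) 0 = 2 * deriv ?g 0"
    by (rule DERIV_imp_deriv)
      (use DERIV_mult[OF holomorphic_derivI[OF g S] holomorphic_derivI[OF g S]] in \<open>simp add: g0 power2_eq_square numeral_2_eq_2\<close>)
  then show ?thesis using d by (simp add: b_coeff_def mult_ac)
qed

text \<open>The case n = 1 with b_1 = - lam inserted. Since it holds for every positive parameter,
  it can be read from right to left as an integral representation of l / (l + 1)^3.\<close>

lemma ray_kernel_first_moment:
  assumes lam: "lam > 0" and \<theta>: "0 \<le> \<theta>" "\<theta> < pi / 2"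
    and \<kappa>: "0 < Re (cis \<theta> * cnj (log_const lam))"
  shows "Im (LBINT t:{0<..}. of_real t * cis \<theta> * ray_kernel lam (of_real t * cis \<theta>) * cis \<theta>) / pi = lam / (lam + 1) ^ 3"
proof -
  define I where "I = (LBINT t:{0<..}. of_real t * cis \<theta> * ray_kernel lam (of_real t * cis \<theta>) * cis \<theta>)"
  have "- of_real lam = - (of_real (lam + 1) ^ 3 / (2 * of_real pi * \<i>) * (I - cnj I))"
    using b_coeff_ray[OF lam \<theta> \<kappa>, of 1] b_coeff_1[OF lam] by (simp add: I_def numeral_3_eq_3)
  also have "I - cnj I = 2 * \<i> * of_real (Im I)" by (simp add: complex_eq_iff)
  finally have "complex_of_real lam = of_real ((lam + 1) ^ 3 * (Im I / pi))"
    by (simp add: field_simps)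
  then have "lam = (lam + 1) ^ 3 * (Im I / pi)" by (simp only: of_real_eq_iff)
  moreover have "(lam + 1) ^ 3 \<noteq> 0" using lam by simp
  ultimately have "Im I / pi = lam / (lam + 1) ^ 3"
    by (metis nonzero_mult_div_cancel_left)
  then show ?thesis by (simp only: I_def)
qed

section \<open>Rotation of the rays\<close>

lemma log_const_polar: "log_const lam = of_real (norm (log_const lam)) * cis (omega lam)"
  using rcis_cmod_Arg[of "log_const lam"] by (simp add: rcis_def omega_def)

lemma log_const_nonzero: "norm (log_const lam) > 0"
  by (auto simp: log_const_def complex_eq_iff)

lemma omega_bounds: "0 < omega lam" "omega lam < pi"
  using Arg_lt_pi[of "log_const lam"] by (auto simp: omega_def log_const_def)

text \<open>The rate of exponential decay of the kernel on the ray of angle y. It is largest at y =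
  \<omega> and positive for |y - \<omega>| < pi / 2, which delimits the rotations allowed.\<close>

lemma Re_cis_cnj_log_const: "Re (cis y * cnj (log_const lam)) = norm (log_const lam) * cos (y - omega lam)"
proof -
  have "Re (cis y * cnj (of_real n * cis o')) = n * cos (y - o')" for n o' by (simp add: cos_diff algebra_simps)
  then show ?thesis using log_const_polar[of lam] by metis
qed

lemma Gamma_div_power_holomorphic: "Gamma_div_power holomorphic_on - \<real>\<^sub>\<le>\<^sub>0"
  unfolding Gamma_div_power_def by (intro holomorphic_intros) (use nonpos_Ints_subset_nonpos_Reals in blast)+

lemma ray_kernel_holomorphic: "ray_kernel lam holomorphic_on - \<real>\<^sub>\<le>\<^sub>0"
  unfolding ray_kernel_def by (intro holomorphic_intros Gamma_div_power_holomorphic)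

lemma ray_kernel_bound:
  obtains C where "C > 0"
    "\<And>t y. t > 0 \<Longrightarrow> 0 \<le> y \<Longrightarrow> y \<le> omega lam \<Longrightarrow>
      norm (ray_kernel lam (of_real t * cis y)) \<le> C * (1 + 1 / t) * exp (- (norm (log_const lam) * cos (y - omega lam) * t))"
proof -
  obtain C where C: "C > 0" "\<And>x. x \<noteq> 0 \<Longrightarrow> \<bar>Arg x\<bar> \<le> omega lam \<Longrightarrow> norm (Gamma_div_power x * exp x) \<le> C * (1 + 1 / norm x)"
    using Gamma_div_power_sector_bound[of "omega lam"] omega_bounds by (metis less_imp_le)
  show ?thesis
  proof (rule that[OF C(1)])
    fix t y :: real assume t: "t > 0" and y: "0 \<le> y" "y \<le> omega lam"
    let ?x = "of_real t * cis y"
    have "norm (Gamma_div_power ?x * exp ?x) \<le> C * (1 + 1 / t)"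
      using C(2)[of ?x] t y omega_bounds[of lam] Arg_of_real_cis[OF t, of y] by (auto simp: norm_mult)
    moreover have "norm (exp (- (?x * cnj (log_const lam)))) = exp (- (norm (log_const lam) * cos (y - omega lam) * t))"
    proof -
      have "Re (?x * cnj (log_const lam)) = t * Re (cis y * cnj (log_const lam))"
        by (simp add: algebra_simps)
      moreover have "norm (exp (- (?x * cnj (log_const lam)))) = exp (- Re (?x * cnj (log_const lam)))"
        by (simp only: norm_exp_eq_Re uminus_complex.sel)
      ultimately show ?thesis
        unfolding Re_cis_cnj_log_const by (simp only: mult_ac)
    qed
    ultimately show "norm (ray_kernel lam ?x) \<le> C * (1 + 1 / t) * exp (- (norm (log_const lam) * cos (y - omega lam) * t))"
      unfolding ray_kernel_def norm_mult[of "_ * _"] by (simp add: mult_right_mono)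
  qed
qed

text \<open>The factor \<open>E\<close> is 1 for the coefficients and 1 / (a + x) for the case N =
  1. One power of t absorbs the singularity 1 / t of the kernel at 0, and all rays in between decay
  at least at the rate of the ray \<theta>.\<close>

lemma ray_kernel_integrable_rotation:
  fixes n :: nat and E :: "complex \<Rightarrow> complex"
  assumes n: "n \<ge> 1" and \<theta>: "0 \<le> \<theta>" "\<theta> \<le> omega lam" "omega lam - \<theta> < pi / 2"
    and E: "E holomorphic_on - \<real>\<^sub>\<le>\<^sub>0" "\<And>t y. t > 0 \<Longrightarrow> \<theta> \<le> y \<Longrightarrow> y \<le> omega lam \<Longrightarrow> norm (E (of_real t * cis y)) \<le> D"
  defines "M \<equiv> \<lambda>y t. (of_real t * cis y) ^ n * ray_kernel lam (of_real t * cis y) * cis y * E (of_real t * cis y)"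
  shows "\<And>y. \<theta> \<le> y \<Longrightarrow> y \<le> omega lam \<Longrightarrow> set_integrable lborel {0<..} (M y)"
    and "(LBINT t:{0<..}. M (omega lam) t) = (LBINT t:{0<..}. M \<theta> t)"
proof -
  obtain C where C: "C > 0" "\<And>t y. t > 0 \<Longrightarrow> 0 \<le> y \<Longrightarrow> y \<le> omega lam \<Longrightarrow>
      norm (ray_kernel lam (of_real t * cis y)) \<le> C * (1 + 1 / t) * exp (- (norm (log_const lam) * cos (y - omega lam) * t))"
    using ray_kernel_bound[of lam] by blast
  define c where "c = norm (log_const lam) * cos (omega lam - \<theta>)"
  have cpos: "c > 0" unfolding c_def using log_const_nonzero[of lam] \<theta> omega_bounds[of lam]
    by (intro mult_pos_pos cos_gt_zero_pi) auto
  define f where "f x = x ^ n * ray_kernel lam x * E x" for x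
  have f: "f holomorphic_on - \<real>\<^sub>\<le>\<^sub>0"
    unfolding f_def by (intro holomorphic_intros ray_kernel_holomorphic E)
  have D: "D \<ge> 0" using E(2)[of 1 \<theta>] \<theta> norm_ge_zero order.trans zero_less_one by blast
  define B where "B t = C * D * (t ^ n * exp (- (c * t)) + t ^ (n - 1) * exp (- (c * t)))" for t
  have bound: "norm (f (of_real t * cis y)) \<le> B t" if t: "t > 0" and y: "\<theta> \<le> y" "y \<le> omega lam" for t y
  proof -
    have "cos (omega lam - \<theta>) \<le> cos (omega lam - y)"
      using y \<theta> omega_bounds[of lam] by (intro cos_monotone_0_pi_le) auto
    then have "cos (omega lam - \<theta>) \<le> cos (y - omega lam)" by (metis cos_minus minus_diff_eq)
    then have "c * t \<le> norm (log_const lam) * cos (y - omega lam) * t"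
      unfolding c_def using t by (intro mult_right_mono mult_left_mono) auto
    then have "norm (ray_kernel lam (of_real t * cis y)) \<le> C * (1 + 1 / t) * exp (- (c * t))"
      using C t y \<theta> by (intro order.trans[OF C(2)] mult_left_mono) auto
    then have "norm (f (of_real t * cis y)) \<le> t ^ n * (C * (1 + 1 / t) * exp (- (c * t))) * D"
      unfolding f_def norm_mult norm_power using E(2)[OF t y] D t C by (intro mult_mono) auto
    also have "\<dots> = B t"
    proof -
      have "t ^ n * (1 + 1 / t) = t ^ n + t ^ (n - 1)"
        using t n by (cases n) (auto simp: distrib_left)
      moreover have "t ^ n * (C * (1 + 1 / t) * exp (- (c * t))) * D = C * D * (t ^ n * (1 + 1 / t) * exp (- (c * t)))"
        by (simp only: mult_ac)
      ultimately show ?thesis by (simp only: B_def distrib_right)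
    qed
    finally show ?thesis .
  qed
  have iB: "set_integrable lborel {0<..} B"
    unfolding B_def using cpos by (intro set_integrable_mult_right set_integral_add set_integrable_power_exp_real)
  have M: "M y t = f (of_real t * cis y) * cis y" for y t by (simp add: M_def f_def)
  have cf: "continuous_on {0<..} (\<lambda>t. f (of_real t * cis y) * cis y)" if "\<theta> \<le> y" "y \<le> omega lam" for y
    using that \<theta> omega_bounds[of lam]
    by (intro continuous_intros continuous_on_compose2[OF holomorphic_on_imp_continuous_on[OF f]])
      (use ray_not_nonpos_Reals[of _ y] in auto)
  show "set_integrable lborel {0<..} (M y)" if "\<theta> \<le> y" "y \<le> omega lam" for y
    unfolding M by (rule set_integrable_bound_greaterThan[OF iB cf[OF that]])
      (use bound that in \<open>auto simp: norm_mult\<close>)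
  have tB: "t * B t = C * D * (t ^ Suc n * exp (- (c * t)) + t ^ n * exp (- (c * t)))" for t
    using n by (cases n) (simp_all add: B_def algebra_simps)
  show "(LBINT t:{0<..}. M (omega lam) t) = (LBINT t:{0<..}. M \<theta> t)"
    unfolding M
  proof (rule ray_rotation[OF f _ _ _ iB])
    show "- pi < \<theta>" "\<theta> \<le> omega lam" "omega lam < pi" using \<theta> omega_bounds[of lam] by auto
    show "norm (f (of_real t * cis y)) \<le> B t" if "t > 0" "\<theta> \<le> y" "y \<le> omega lam" for t y
      using that by (rule bound)
    have "((\<lambda>t. C * D * (t ^ Suc n * exp (- (c * t)) + t ^ n * exp (- (c * t)))) \<longlongrightarrow> C * D * (0 + 0)) at_top"
      by (intro tendsto_intros tendsto_power_exp_real cpos)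
    then show "((\<lambda>t. t * B t) \<longlongrightarrow> 0) at_top" unfolding tB by simp
    show "((\<lambda>t. t * B t) \<longlongrightarrow> 0) (at_right 0)"
      unfolding tB using n by (auto intro!: tendsto_eq_intros simp: power_0_left)
  qed
qed

section \<open>The case \<open>N = 1\<close> for positive \<open>a\<close>\<close>

text \<open>\<open>s\<close> increases from 0 to infinity and has derivative 1 + 1 / l, so in the
  variable s this is the Laplace transform of the constant 1. It is used with c = a + x.\<close>

lemma laplace_kernel_integral:
  fixes lam :: real and c :: complex
  assumes lam: "lam > 0" and c: "Re c > 0"
  defines "s \<equiv> \<lambda>l. l + ln l - (lam + ln lam)"
  shows "set_integrable lborel {lam<..} (\<lambda>l. of_real (1 + 1 / l) * exp (- (c * of_real (s l))))"
    "(LBINT l:{lam<..}. of_real (1 + 1 / l) * exp (- (c * of_real (s l)))) = 1 / c"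
proof -
  have c0: "c \<noteq> 0" using c by auto
  have s': "(s has_real_derivative 1 + 1 / l) (at l)" if "l > 0" for l
    unfolding s_def using that by (auto intro!: derivative_eq_intros)
  have cs: "continuous_on {lam<..} s"
    unfolding s_def using lam by (intro continuous_intros) auto
  have slim: "(s \<longlongrightarrow> 0) (at_right lam)"
    unfolding s_def using lam by (auto intro!: tendsto_eq_intros)
  have stop: "filterlim s at_top at_top" unfolding s_def by real_asymp
  have etop: "((\<lambda>l. exp (- (Re c * s l))) \<longlongrightarrow> 0) at_top"
    using c by (intro filterlim_compose[OF exp_at_bot] filterlim_uminus_at_top[THEN iffD1] filterlim_tendsto_pos_mult_at_top[OF tendsto_const _ stop])
  have i: "set_integrable lborel {lam<..} (\<lambda>l. (1 + 1 / l) * exp (- (Re c * s l)))"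
  proof (rule set_integrable_FTC_greaterThan[where D = "\<lambda>l. - exp (- (Re c * s l)) / Re c"])
    show "((\<lambda>l. - exp (- (Re c * s l)) / Re c) has_vector_derivative (1 + 1 / l) * exp (- (Re c * s l))) (at l)"
      if "l > lam" for l
      unfolding has_real_derivative_iff_has_vector_derivative[symmetric]
      using that lam c by (auto intro!: derivative_eq_intros s' simp: field_simps)
    show "((\<lambda>l. - exp (- (Re c * s l)) / Re c) \<longlongrightarrow> - 1 / Re c) (at_right lam)"
      using c by (auto intro!: tendsto_eq_intros slim)
    show "((\<lambda>l. - exp (- (Re c * s l)) / Re c) \<longlongrightarrow> - 0 / Re c) at_top"
      using c by (intro tendsto_intros etop) auto
  qed (use lam in \<open>auto intro!: continuous_intros cs\<close>)
  show i': "set_integrable lborel {lam<..} (\<lambda>l. of_real (1 + 1 / l) * exp (- (c * of_real (s l))))"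
  proof (rule set_integrable_bound_greaterThan[OF i])
    show "continuous_on {lam<..} (\<lambda>l. of_real (1 + 1 / l) * exp (- (c * of_real (s l))))"
      using lam by (intro continuous_intros cs) auto
    show "norm (of_real (1 + 1 / l) * exp (- (c * of_real (s l)))) \<le> (1 + 1 / l) * exp (- (Re c * s l))"
      if "l > lam" for l
      using that lam by (simp only: norm_mult norm_of_real norm_exp_eq_Re) simp
  qed
  have "(LBINT l:{lam<..}. of_real (1 + 1 / l) * exp (- (c * of_real (s l)))) = 0 - (- 1 / c)"
  proof (rule integral_FTC_greaterThan[OF _ _ i', where D = "\<lambda>l. - exp (- (c * of_real (s l))) / c"])
    show "((\<lambda>l. - exp (- (c * of_real (s l))) / c) has_vector_derivative of_real (1 + 1 / l) * exp (- (c * of_real (s l)))) (at l)"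
      if "l > lam" for l
    proof -
      have "((\<lambda>l. complex_of_real (s l)) has_vector_derivative of_real (1 + 1 / l)) (at l)"
        using s'[of l] that lam by (intro has_vector_derivative_of_real) auto
      moreover have "((\<lambda>w. - exp (- (c * w)) / c) has_field_derivative exp (- (c * w))) (at w)" for w
        using c0 by (auto intro!: derivative_eq_intros)
      ultimately show ?thesis
        using field_vector_diff_chain_at[of "\<lambda>l. complex_of_real (s l)" "of_real (1 + 1 / l)" l "\<lambda>w. - exp (- (c * w)) / c" "exp (- (c * of_real (s l)))"]
        by (simp add: o_def)
    qed
    show "continuous_on {lam<..} (\<lambda>l. of_real (1 + 1 / l) * exp (- (c * of_real (s l))))"
      using lam by (intro continuous_intros cs) auto
    have "((\<lambda>l. - exp (- (c * of_real (s l))) / c) \<longlongrightarrow> - exp (- (c * of_real 0)) / c) (at_right lam)"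
      using c0 by (intro tendsto_intros slim)
    then show "((\<lambda>l. - exp (- (c * of_real (s l))) / c) \<longlongrightarrow> - 1 / c) (at_right lam)" by simp
    show "((\<lambda>l. - exp (- (c * of_real (s l))) / c) \<longlongrightarrow> 0) at_top"
      by (rule Lim_null_comparison[OF always_eventually tendsto_divide_zero[OF etop, of "norm c"]])
        (auto simp: norm_divide norm_exp_eq_Re)
  qed
  then show "(LBINT l:{lam<..}. of_real (1 + 1 / l) * exp (- (c * of_real (s l)))) = 1 / c" by simp
qed

lemma laplace_kernel_integrable_real:
  fixes lam a :: real
  assumes lam: "lam > 0" and a: "a > 0"
  defines "s \<equiv> \<lambda>l. l + ln l - (lam + ln lam)"
  shows "set_integrable lborel {lam<..} (\<lambda>l. (1 + 1 / l) * exp (- (a * s l)))"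
proof -
  have "set_integrable lborel {lam<..} (\<lambda>l. complex_of_real (1 + 1 / l) * exp (- (of_real a * of_real (s l))))"
    using laplace_kernel_integral(1)[OF lam, of "of_real a"] a by (simp add: s_def)
  then have "set_integrable lborel {lam<..} (\<lambda>l. norm (complex_of_real (1 + 1 / l) * exp (- (of_real a * of_real (s l)))))"
    by (rule set_integrable_norm)
  also have "?this \<longleftrightarrow> ?thesis"
    using lam by (intro set_integrable_cong) (auto simp: norm_mult norm_exp_eq_Re simp del: of_real_add of_real_divide)
  finally show ?thesis .
qed

text \<open>\<open>log_const\<close> depends on its parameter only through a real summand; a new
  parameter therefore costs one exponential in x, which merges with exp (- a * s).\<close>

lemma ray_kernel_change_lam:
  assumes "lam > 0" "l > 0"
  shows "ray_kernel l x = ray_kernel lam x * exp (- (x * of_real (l + ln l - (lam + ln lam))))"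
proof -
  have "cnj (log_const l) = cnj (log_const lam) + of_real (l + ln l - (lam + ln lam))"
    by (simp add: log_const_def)
  then have "- (x * cnj (log_const l)) = - (x * cnj (log_const lam)) + - (x * of_real (l + ln l - (lam + ln lam)))"
    by (simp only: distrib_left minus_add_distrib)
  then show ?thesis by (simp only: ray_kernel_def exp_add mult.assoc)
qed

text \<open>The same angle serves every l > lam: passing from lam to l raises Re (cis \<theta> * cnj
  (log_const l)) by cos \<theta> * s l >= 0, so the first moment formula stays applicable. That
  formula determines an imaginary part only, whence the \<open>Im\<close>.\<close>

lemma cauchy_ray_integral:
  fixes lam a \<theta> :: real
  assumes lam: "lam > 0" and a: "a > 0" and \<theta>: "0 \<le> \<theta>" "\<theta> < pi / 2"
    and \<kappa>: "0 < Re (cis \<theta> * cnj (log_const lam))"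
  defines "M \<equiv> \<lambda>t. of_real t * cis \<theta> * ray_kernel lam (of_real t * cis \<theta>) * cis \<theta>"
    and "s \<equiv> \<lambda>l. l + ln l - (lam + ln lam)"
  shows "(LBINT l:{lam<..}. exp (- (a * s l)) / (1 + l)\<^sup>2) = Im (LBINT t:{0<..}. M t / (of_real a + of_real t * cis \<theta>)) / pi"
proof -
  have ct: "cos \<theta> > 0" using \<theta> by (intro cos_gt_zero_pi) auto
  have s_nonneg: "s l \<ge> 0" if "l > lam" for l
  proof -
    have "ln lam \<le> ln l" using that lam by simp
    then show ?thesis using that by (simp add: s_def)
  qed
  have iM: "set_integrable lborel {0<..} M"
    using ray_kernel_integral_strip(1)[OF \<theta> \<kappa>, of 1] by (simp add: M_def)
  define g where "g l = indicator {lam<..} l * ((1 + 1 / l) * exp (- (a * s l)))" for l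
  have g_nonneg: "g l \<ge> 0" for l using lam by (simp add: g_def indicator_def)
  have ig: "integrable lborel g"
    using laplace_kernel_integrable_real[OF lam a]
    by (simp add: set_integrable_def g_def[abs_def] s_def)
  define M' where "M' t = indicator {0<..} t *\<^sub>R M t" for t
  have iM': "integrable lborel M'" using iM by (simp add: set_integrable_def M'_def[abs_def])
  define G where "G l t = of_real (g l) * M' t * exp (- (of_real t * cis \<theta> * of_real (s l)))" for l t
  have [measurable]: "g \<in> borel_measurable borel" "M' \<in> borel_measurable borel"
    using ig iM' by auto
  have meas: "case_prod G \<in> borel_measurable (lborel \<Otimes>\<^sub>M lborel)"
    unfolding G_def s_def by measurable
  have iprod: "integrable (lborel \<Otimes>\<^sub>M lborel) (\<lambda>(l, t). of_real (g l) * M' t)"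
  proof (rule lborel_pair.Fubini_integrable)
    have "(LBINT t. norm (of_real (g l) * M' t)) = g l * (LBINT t. norm (M' t))" for l
      using g_nonneg[of l] by (simp add: norm_mult)
    then show "integrable lborel (\<lambda>l. LBINT t. norm (case_prod (\<lambda>l t. of_real (g l) * M' t) (l, t)))"
      using ig by simp
  qed (use iM' in auto)
  \<comment> \<open>For l > lam and t > 0 the exponential coupling l and t has modulus at most 1, so
    the product of the two one-variable functions dominates; the decay in l sits in \<open>g\<close>
    and comes from a > 0.\<close>
  have iG: "integrable (lborel \<Otimes>\<^sub>M lborel) (case_prod G)"
  proof (rule Bochner_Integration.integrable_bound[OF iprod meas])
    have "norm (G l t) \<le> norm (of_real (g l) * M' t)" for l t
    proof (cases "l > lam \<and> t > 0")
      case True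
      then have "norm (exp (- (of_real t * cis \<theta> * of_real (s l)))) \<le> 1"
        using s_nonneg[of l] ct by (simp add: norm_exp_eq_Re)
      then show ?thesis unfolding G_def norm_mult[of "_ * _"] by (simp add: mult_left_le)
    qed (auto simp: G_def g_def M'_def)
    then show "AE x in lborel \<Otimes>\<^sub>M lborel. norm (case_prod G x) \<le> norm (case_prod (\<lambda>l t. of_real (g l) * M' t) x)"
      by (auto intro!: AE_I2)
  qed
  have in1: "(LBINT l. G l t) = indicator {0<..} t *\<^sub>R (M t / (of_real a + of_real t * cis \<theta>))" for t
  proof (cases "t > 0")
    case True
    let ?c = "of_real a + of_real t * cis \<theta>"
    have c: "Re ?c > 0" using a True ct by (simp add: add_pos_pos)
    have "G l t = M t * (indicator {lam<..} l *\<^sub>R (of_real (1 + 1 / l) * exp (- (?c * of_real (s l)))))" for l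
    proof -
      have "exp (- (?c * of_real (s l))) = of_real (exp (- (a * s l))) * exp (- (of_real t * cis \<theta> * of_real (s l)))"
        by (simp add: ring_distribs exp_of_real[symmetric] exp_add[symmetric])
      then show ?thesis using True by (simp add: G_def g_def M'_def indicator_def)
    qed
    then have "(LBINT l. G l t) = M t * (LBINT l:{lam<..}. of_real (1 + 1 / l) * exp (- (?c * of_real (s l))))"
      unfolding set_lebesgue_integral_def by (simp only: integral_mult_right_zero)
    also have "\<dots> = M t * (1 / ?c)"
      using laplace_kernel_integral(2)[OF lam c] by (simp add: s_def)
    finally show ?thesis using True by simp
  qed (simp add: G_def M'_def)
  have in2: "Im (LBINT t. G l t) = pi * (indicator {lam<..} l *\<^sub>R (exp (- (a * s l)) / (1 + l)\<^sup>2))" for l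
  proof (cases "l > lam")
    case True
    then have l: "l > 0" using lam by simp
    have "Re (cis \<theta> * cnj (log_const l)) = Re (cis \<theta> * cnj (log_const lam)) + cos \<theta> * s l"
      by (simp add: log_const_def s_def algebra_simps)
    then have \<kappa>l: "0 < Re (cis \<theta> * cnj (log_const l))"
      using \<kappa> ct s_nonneg[OF True] by (simp only: add_pos_nonneg mult_nonneg_nonneg less_imp_le)
    define I where "I = (LBINT t:{0<..}. of_real t * cis \<theta> * ray_kernel l (of_real t * cis \<theta>) * cis \<theta>)"
    have "G l t = of_real (g l) * (indicator {0<..} t *\<^sub>R (of_real t * cis \<theta> * ray_kernel l (of_real t * cis \<theta>) * cis \<theta>))" for t
      unfolding ray_kernel_change_lam[OF lam l] by (simp add: G_def M'_def M_def s_def indicator_def mult_ac)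
    then have "(LBINT t. G l t) = of_real (g l) * I"
      unfolding I_def set_lebesgue_integral_def by (simp only: integral_mult_right_zero)
    then have "Im (LBINT t. G l t) = g l * Im I" by simp
    also have "Im I = pi * (l / (l + 1) ^ 3)"
      using ray_kernel_first_moment[OF l \<theta> \<kappa>l] by (simp add: I_def field_simps)
    also have "g l * (pi * (l / (l + 1) ^ 3)) = pi * (exp (- (a * s l)) * ((1 + 1 / l) * (l / (l + 1) ^ 3)))"
      using True by (simp add: g_def)
    also have "(1 + 1 / l) * (l / (l + 1) ^ 3) = 1 / (1 + l)\<^sup>2"
    proof -
      have "1 + 1 / l = (l + 1) / l" using l by (simp add: field_simps)
      then show ?thesis using l by (simp add: power2_eq_square power3_eq_cube add.commute)
    qed
    finally show ?thesis using True by simp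
  qed (simp add: G_def g_def)
  have "(LBINT t. LBINT l. G l t) = (LBINT l. LBINT t. G l t)"
    using lborel_pair.Fubini_integral[OF iG] by simp
  then have "Im (LBINT t:{0<..}. M t / (of_real a + of_real t * cis \<theta>)) = Im (LBINT l. LBINT t. G l t)"
    unfolding in1 set_lebesgue_integral_def by simp
  also have "\<dots> = (LBINT l. Im (LBINT t. G l t))"
    using lborel_pair.integrable_fst[OF iG] by (intro integral_Im[symmetric]) simp
  also have "\<dots> = pi * (LBINT l:{lam<..}. exp (- (a * s l)) / (1 + l)\<^sup>2)"
    unfolding in2 set_lebesgue_integral_def by (rule integral_mult_right_zero)
  finally show ?thesis by simp
qed

text \<open>In the variable l = w / a the exponent is a multiple of a up to a constant. Normalising
  \<open>s\<close> to vanish at the endpoint lam turns that constant into the prefactor (lam a)^(-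
  a) exp (- lam a).\<close>

lemma upper_incomplete_Gamma_positive:
  fixes lam a :: real
  assumes lam: "lam > 0" and a: "a > 0"
  defines "s \<equiv> \<lambda>l. l + ln l - (lam + ln lam)"
  shows "upper_incomplete_Gamma (- of_real a) (of_real lam * of_real a) =
    of_real ((lam * a) powr (- a) * exp (- (lam * a)) * ((1 / (1 + lam) - (LBINT l:{lam<..}. exp (- (a * s l)) / (1 + l)\<^sup>2)) / a))"
proof -
  define h where "h w = w powr (- a - 1) * exp (- w)" for w :: real
  define C where "C = (lam * a) powr (- a) * exp (- (lam * a))"
  have "upper_incomplete_Gamma (- of_real a) (of_real lam * of_real a) = (LBINT u:{0<..}. of_real (h (lam * a + u)))"
    unfolding upper_incomplete_Gamma_def
  proof (rule set_lebesgue_integral_cong)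
    show "\<forall>u. u \<in> {0<..} \<longrightarrow> (of_real lam * of_real a + complex_of_real u) powr (- of_real a - 1) * exp (- (of_real lam * of_real a + complex_of_real u)) = of_real (h (lam * a + u))"
    proof (intro allI impI)
      fix u :: real assume "u \<in> {0<..}"
      then have "lam * a + u > 0" using lam a by (simp add: add_pos_pos)
      then have "complex_of_real (lam * a + u) powr of_real (- a - 1) = of_real ((lam * a + u) powr (- a - 1))"
        by (intro powr_of_real) auto
      then show "(of_real lam * of_real a + complex_of_real u) powr (- of_real a - 1) * exp (- (of_real lam * of_real a + complex_of_real u)) = of_real (h (lam * a + u))"
        by (simp add: h_def exp_of_real[symmetric])
    qed
  qed simp
  also have "\<dots> = of_real (LBINT u:{0<..}. h (lam * a + u))" by (rule set_integral_complex_of_real)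
  also have "(LBINT u:{0<..}. h (lam * a + u)) = (LBINT u. indicator {0<..} u *\<^sub>R h (lam * a + u))"
    by (simp add: set_lebesgue_integral_def)
  also have "\<dots> = a * (LBINT l. indicator {0<..} (- (lam * a) + a * l) *\<^sub>R h (lam * a + (- (lam * a) + a * l)))"
    using a by (subst lborel_integral_real_affine[of a _ "- (lam * a)"]) auto
  also have "\<dots> = a * (LBINT l. C / a * (indicator {lam<..} l *\<^sub>R (exp (- (a * s l)) / l)))"
  proof (intro arg_cong[of _ _ "\<lambda>x. a * x"] Bochner_Integration.integral_cong refl)
    fix l :: real
    have ind: "(0 < - (lam * a) + a * l) \<longleftrightarrow> lam < l"
      using a by (simp add: mult.commute[of lam])
    show "indicator {0<..} (- (lam * a) + a * l) *\<^sub>R h (lam * a + (- (lam * a) + a * l)) = C / a * (indicator {lam<..} l *\<^sub>R (exp (- (a * s l)) / l))"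
    proof (cases "lam < l")
      case True
      then have l: "l > 0" using lam by simp
      have "h (a * l) = exp ((- a - 1) * ln (a * l)) * exp (- (a * l))"
        using a l by (simp add: h_def powr_def)
      also have "(- a - 1) * ln (a * l) = - (a * (ln a + ln l)) - ln (a * l)"
        using a l by (simp add: ln_mult algebra_simps)
      also have "exp (- (a * (ln a + ln l)) - ln (a * l)) * exp (- (a * l)) = exp (- (a * (ln a + ln l)) - a * l) / (a * l)"
      proof -
        have "exp (Y - ln (a * l)) * exp (- (a * l)) = exp (Y - a * l) / (a * l)" for Y
          using a l by (simp add: exp_diff exp_minus divide_inverse mult_ac)
        then show ?thesis .
      qed
      also have "- (a * (ln a + ln l)) - a * l = (- a * ln (lam * a) - lam * a) - a * s l"
        using a lam by (simp add: s_def ln_mult algebra_simps)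
      also have "exp (\<dots>) = C * exp (- (a * s l))"
      proof -
        have "exp (X - Y - Z) = exp X * exp (- Y) * exp (- Z)" for X Y Z :: real
          by (simp add: exp_diff exp_minus divide_inverse)
        then show ?thesis unfolding C_def using a lam by (simp add: powr_def)
      qed
      finally show ?thesis using True ind by (simp add: indicator_def)
    qed (use ind in \<open>simp add: indicator_def\<close>)
  qed
  also have "\<dots> = C * (LBINT l:{lam<..}. exp (- (a * s l)) / l)"
    using a unfolding set_lebesgue_integral_def by (subst integral_mult_right_zero) simp
  also have "(LBINT l:{lam<..}. exp (- (a * s l)) / l) = (1 / (1 + lam) - (LBINT l:{lam<..}. exp (- (a * s l)) / (1 + l)\<^sup>2)) / a"
  proof -
    have s': "(s has_real_derivative 1 + 1 / l) (at l)" if "l > 0" for l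
      unfolding s_def using that by (auto intro!: derivative_eq_intros)
    have cs: "continuous_on {lam<..} s"
      unfolding s_def using lam by (intro continuous_intros) auto
    have slim: "(s \<longlongrightarrow> 0) (at_right lam)"
      unfolding s_def using lam by (auto intro!: tendsto_eq_intros)
    have i0: "set_integrable lborel {lam<..} (\<lambda>l. (1 + 1 / l) * exp (- (a * s l)))"
      unfolding s_def by (rule laplace_kernel_integrable_real[OF lam a])
    have i1: "set_integrable lborel {lam<..} (\<lambda>l. exp (- (a * s l)) / l)"
      and i2: "set_integrable lborel {lam<..} (\<lambda>l. exp (- (a * s l)) / (1 + l)\<^sup>2)"
    proof -
      show "set_integrable lborel {lam<..} (\<lambda>l. exp (- (a * s l)) / l)"
        by (rule set_integrable_bound_greaterThan[OF i0])
          (use lam in \<open>auto intro!: continuous_intros cs simp: field_simps\<close>)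
      have "1 / (1 + l)\<^sup>2 \<le> 1 + 1 / l" if "l > lam" for l
      proof -
        have "1 / (1 + l)\<^sup>2 \<le> 1" using that lam by (simp add: one_le_power)
        also have "1 \<le> 1 + 1 / l" using that lam by simp
        finally show ?thesis .
      qed
      then have "exp (- (a * s l)) / (1 + l)\<^sup>2 \<le> (1 + 1 / l) * exp (- (a * s l))" if "l > lam" for l
        using that mult_right_mono[of "1 / (1 + l)\<^sup>2" "1 + 1 / l" "exp (- (a * s l))"] by simp
      then show "set_integrable lborel {lam<..} (\<lambda>l. exp (- (a * s l)) / (1 + l)\<^sup>2)"
        by (intro set_integrable_bound_greaterThan[OF i0])
          (use lam in \<open>auto intro!: continuous_intros cs\<close>)
    qed
    \<comment> \<open>Integration by parts with the factor 1 / (1 + l): as (1 + 1 / l) / (1 + l) = 1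
      / l, differentiating the exponential reproduces the integrand, and the boundary value 1 / (1 +
      lam) is the term n = 0.\<close>
    have "(LBINT l:{lam<..}. - a * (exp (- (a * s l)) / l) - exp (- (a * s l)) / (1 + l)\<^sup>2) = 0 - 1 / (1 + lam)"
    proof (rule integral_FTC_greaterThan[where D = "\<lambda>l. exp (- (a * s l)) / (1 + l)"])
      show "((\<lambda>l. exp (- (a * s l)) / (1 + l)) has_vector_derivative - a * (exp (- (a * s l)) / l) - exp (- (a * s l)) / (1 + l)\<^sup>2) (at l)"
        if l: "l > lam" for l
      proof -
        have l0: "l > 0" "1 + l \<noteq> 0" using l lam by auto
        have "((\<lambda>l. exp (- (a * s l)) / (1 + l)) has_real_derivative
            (exp (- (a * s l)) * - (a * (1 + 1 / l)) * (1 + l) - exp (- (a * s l)) * 1) / ((1 + l) * (1 + l))) (at l)"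
          using l0 by (auto intro!: derivative_eq_intros s')
        also have "(exp (- (a * s l)) * - (a * (1 + 1 / l)) * (1 + l) - exp (- (a * s l)) * 1) / ((1 + l) * (1 + l))
            = - a * (exp (- (a * s l)) / l) - exp (- (a * s l)) / (1 + l)\<^sup>2"
          using l0 by (simp add: divide_simps power2_eq_square)
        finally show ?thesis by (simp add: has_real_derivative_iff_has_vector_derivative)
      qed
      show "continuous_on {lam<..} (\<lambda>l. - a * (exp (- (a * s l)) / l) - exp (- (a * s l)) / (1 + l)\<^sup>2)"
        using lam by (intro continuous_intros cs) auto
      show "set_integrable lborel {lam<..} (\<lambda>l. - a * (exp (- (a * s l)) / l) - exp (- (a * s l)) / (1 + l)\<^sup>2)"
        by (intro set_integral_diff set_integrable_mult_right i1 i2)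
      have "((\<lambda>l. exp (- (a * s l)) / (1 + l)) \<longlongrightarrow> exp (- (a * 0)) / (1 + lam)) (at_right lam)"
        using lam by (intro tendsto_intros slim) auto
      then show "((\<lambda>l. exp (- (a * s l)) / (1 + l)) \<longlongrightarrow> 1 / (1 + lam)) (at_right lam)" by simp
      show "((\<lambda>l. exp (- (a * s l)) / (1 + l)) \<longlongrightarrow> 0) at_top"
        unfolding s_def using a by real_asymp
    qed
    then have "- a * (LBINT l:{lam<..}. exp (- (a * s l)) / l) - (LBINT l:{lam<..}. exp (- (a * s l)) / (1 + l)\<^sup>2) = - (1 / (1 + lam))"
      using set_integral_diff(2)[OF set_integrable_mult_right[of "- a", OF i1] i2]
      by (simp only: set_integral_mult_right)
    then show ?thesis using a by (simp add: field_simps)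
  qed
  finally show ?thesis by (simp add: C_def)
qed

section \<open>The integrands in terms of the scaled gamma function\<close>

lemma Gamma_div_power_cnj:
  assumes "x \<notin> \<real>\<^sub>\<le>\<^sub>0"
  shows "Gamma_div_power (cnj x) = cnj (Gamma_div_power x)"
  using assms by (simp add: Gamma_div_power_def cnj_Ln exp_cnj cnj_Gamma)

lemma Ln_ray:
  assumes "t > 0" "\<bar>y\<bar> < pi"
  shows "Ln (of_real t * cis y) = of_real (ln t) + \<i> * of_real y"
proof -
  have "of_real t * cis y \<noteq> 0" using assms by auto
  moreover have "norm (of_real t * cis y) = t" using assms by (simp add: norm_mult)
  ultimately show ?thesis
    using Arg_of_real_cis[OF assms] by (simp add: complex_eq_iff Arg_eq_Im_Ln)
qed

text \<open>The last factor is exp (Ln x / 2), the principal square root of x, left over from the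
  exponent x - 1 / 2 in \<open>scaled_Gamma\<close>.\<close>

lemma scaled_Gamma_ray:
  assumes "t > 0" "\<bar>y\<bar> < pi"
  shows "of_real (sqrt (2 * pi)) * scaled_Gamma (of_real t * cis y) =
    Gamma_div_power (of_real t * cis y) * exp (of_real t * cis y) * (of_real (sqrt t) * cis (y / 2))"
proof -
  define x where "x = of_real t * cis y"
  have x0: "x \<noteq> 0" using assms by (auto simp: x_def)
  have "sqrt t = exp (ln t / 2)" using assms by (simp add: ln_sqrt[symmetric])
  then have E: "of_real (sqrt t) * cis (y / 2) = exp (Ln x / 2)"
    unfolding x_def Ln_ray[OF assms] by (simp add: cis_conv_exp exp_of_real[symmetric] exp_add[symmetric] add_divide_distrib)
  have pw: "x powr (x - 1 / 2) = exp (x * Ln x) / exp (Ln x / 2)"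
    using x0 by (simp add: powr_def exp_diff[symmetric] algebra_simps)
  show ?thesis
    unfolding E x_def[symmetric] scaled_Gamma_def Gamma_div_power_def pw by (simp add: exp_minus field_simps)
qed

text \<open>The decay factor uses the modulus of \<open>log_const\<close>, so one formula covers
  both rays: at y = \<omega> it agrees with the ray kernel, at y = - \<omega> with its conjugate.
  The kernel itself lacks this symmetry.\<close>

definition ray_density :: "real \<Rightarrow> nat \<Rightarrow> real \<Rightarrow> real \<Rightarrow> complex" where
  "ray_density lam n y t = (of_real t * cis y) ^ n * cis y
     * (Gamma_div_power (of_real t * cis y) * exp (of_real t * cis y)) * of_real (exp (- t * norm (log_const lam)))"

lemma ray_density_omega:
  "ray_density lam n (omega lam) t =
    (of_real t * cis (omega lam)) ^ n * ray_kernel lam (of_real t * cis (omega lam)) * cis (omega lam)"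
proof -
  have "cis (omega lam) * cnj (log_const lam) = of_real (norm (log_const lam))"
    by (subst log_const_polar) (simp add: cis_cnj mult.left_commute cis_mult)
  then have "of_real t * cis (omega lam) * cnj (log_const lam) = of_real (t * norm (log_const lam))"
    by (simp add: mult.assoc)
  then have "exp (- (of_real t * cis (omega lam) * cnj (log_const lam))) = of_real (exp (- t * norm (log_const lam)))"
    by (simp add: exp_of_real[symmetric] del: of_real_mult)
  then show ?thesis by (simp only: ray_density_def ray_kernel_def mult_ac)
qed

lemma ray_density_uminus:
  assumes "t > 0" "\<bar>y\<bar> < pi"
  shows "ray_density lam n (- y) t = cnj (ray_density lam n y t)"
proof -
  have cx: "of_real t * cis (- y) = cnj (of_real t * cis y)" by (simp add: cis_cnj)
  show ?thesis
    unfolding ray_density_def cx Gamma_div_power_cnj[OF ray_not_nonpos_Reals[OF assms]]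
    by (simp add: exp_cnj cis_cnj)
qed

lemma ray_density_Suc: "ray_density lam (Suc n) y t = of_real t * cis y * ray_density lam n y t"
  by (simp add: ray_density_def mult_ac)

lemma continuous_on_ray_density:
  assumes "\<bar>y\<bar> < pi"
  shows "continuous_on {0<..} (ray_density lam n y)"
  unfolding ray_density_def
  by (intro continuous_intros continuous_on_compose2[OF holomorphic_on_imp_continuous_on[OF Gamma_div_power_holomorphic]])
    (use ray_not_nonpos_Reals[OF _ assms] in auto)

text \<open>The half-integers cancel: t^(n - 1/2) sqrt t = t^n, and the angles (n + 1/2) y and y / 2
  add up to (n + 1) y.\<close>

lemma scaled_Gamma_ray_density:
  assumes "t > 0" "\<bar>y\<bar> < pi"
  shows "exp (of_real ((real n + 1 / 2) * y) * \<i>) *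
      (of_real (t powr (real n - 1 / 2) * exp (- t * norm (log_const lam))) * scaled_Gamma (of_real t * exp (of_real y * \<i>)))
    = ray_density lam n y t / of_real (sqrt (2 * pi))"
proof -
  have e: "exp (of_real u * \<i>) = cis u" for u by (simp add: cis_conv_exp mult.commute)
  have "t powr (real n - 1 / 2) * sqrt t = t powr real n"
    using assms by (simp add: powr_half_sqrt[symmetric] powr_add[symmetric])
  also have "\<dots> = t ^ n" using assms by (simp add: powr_realpow)
  finally have p: "of_real (t powr (real n - 1 / 2)) * of_real (sqrt t) = complex_of_real t ^ n"
    by (simp flip: of_real_mult)
  have c: "cis ((real n + 1 / 2) * y) * cis (y / 2) = cis y ^ n * cis y"
  proof -
    have "cis y ^ n * cis y = cis (real n * y + y)" unfolding Complex.DeMoivre cis_mult by simp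
    moreover have "(real n + 1 / 2) * y + y / 2 = real n * y + y" by (simp add: algebra_simps)
    ultimately show ?thesis by (simp only: cis_mult)
  qed
  have "of_real (sqrt (2 * pi)) * (cis ((real n + 1 / 2) * y) *
      (of_real (t powr (real n - 1 / 2) * exp (- t * norm (log_const lam))) * scaled_Gamma (of_real t * cis y)))
    = cis ((real n + 1 / 2) * y) * of_real (t powr (real n - 1 / 2)) * of_real (exp (- t * norm (log_const lam)))
        * (of_real (sqrt (2 * pi)) * scaled_Gamma (of_real t * cis y))"
    by (simp only: of_real_mult mult_ac)
  also have "\<dots> = (of_real (t powr (real n - 1 / 2)) * of_real (sqrt t)) * (cis ((real n + 1 / 2) * y) * cis (y / 2))
       * (Gamma_div_power (of_real t * cis y) * exp (of_real t * cis y)) * of_real (exp (- t * norm (log_const lam)))"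
    unfolding scaled_Gamma_ray[OF assms] by (simp only: mult_ac)
  also have "\<dots> = ray_density lam n y t"
    unfolding p c by (simp only: ray_density_def power_mult_distrib mult_ac)
  finally show ?thesis unfolding e by (simp add: nonzero_eq_divide_eq mult.commute)
qed

text \<open>
  Half the angle keeps the ray in the right half plane, where the integral for \<open>Gamma_div_power\<close> converges,
  and within \<open>pi / 2\<close> of \<open>omega lam\<close>, where the ray kernel decays.
\<close>
lemma half_omega_rotation: "0 \<le> omega lam / 2" "omega lam / 2 \<le> omega lam" "omega lam - omega lam / 2 < pi / 2"
    "omega lam / 2 < pi / 2" "0 < Re (cis (omega lam / 2) * cnj (log_const lam))"
proof -
  note o = omega_bounds[of lam]
  show "0 \<le> omega lam / 2" "omega lam / 2 \<le> omega lam" "omega lam - omega lam / 2 < pi / 2" "omega lam / 2 < pi / 2"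
    using o by auto
  have "cos (omega lam / 2 - omega lam) > 0" using o by (intro cos_gt_zero_pi) auto
  then show "0 < Re (cis (omega lam / 2) * cnj (log_const lam))"
    unfolding Re_cis_cnj_log_const using log_const_nonzero[of lam] by (intro mult_pos_pos)
qed

lemma set_integrable_ray_density:
  assumes n: "n \<ge> 1" and y: "y = omega lam \<or> y = - omega lam"
  shows "set_integrable lborel {0<..} (ray_density lam n y)"
proof -
  have i: "set_integrable lborel {0<..} (ray_density lam n (omega lam))"
    unfolding ray_density_omega
    using ray_kernel_integrable_rotation(1)[OF n half_omega_rotation(1-3), where E = "\<lambda>_. 1" and D = 1 and lam = lam and y = "omega lam"]
      half_omega_rotation(2)[of lam] by simp
  have "set_integrable lborel {0<..} (\<lambda>t. cnj (ray_density lam n (omega lam) t))"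
    using integrable_cnj[OF i[unfolded set_integrable_def]] by (simp add: set_integrable_def)
  also have "?this \<longleftrightarrow> set_integrable lborel {0<..} (ray_density lam n (- omega lam))"
    using omega_bounds[of lam] by (intro set_integrable_cong) (auto simp: ray_density_uminus)
  finally show ?thesis using i y by auto
qed

lemma set_integral_cnj_greaterThan:
  assumes "\<And>t. t > 0 \<Longrightarrow> g t = cnj (f t)"
  shows "(LBINT t:{0<..}. g t) = cnj (LBINT t:{0<..}. f t)"
proof -
  have "(LBINT t:{0<..}. g t) = (LBINT t. cnj (indicator {0<..} t *\<^sub>R f t))"
    unfolding set_lebesgue_integral_def using assms
    by (intro Bochner_Integration.integral_cong) (auto simp: indicator_def)
  then show ?thesis
    unfolding set_lebesgue_integral_def by (simp only: Bochner_Integration.integral_cnj)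
qed

lemma b_coeff_ray_density:
  assumes lam: "lam > 0" and n: "n \<ge> 1"
  shows "b_coeff n lam = (-1) ^ n * of_real (lam + 1) ^ (2 * n + 1) / (2 * of_real pi * \<i>) *
    ((LBINT t:{0<..}. ray_density lam n (omega lam) t) - (LBINT t:{0<..}. ray_density lam n (- omega lam) t))"
proof -
  have I: "(LBINT t:{0<..}. ray_density lam n (omega lam) t) =
     (LBINT t:{0<..}. (of_real t * cis (omega lam / 2)) ^ n * ray_kernel lam (of_real t * cis (omega lam / 2)) * cis (omega lam / 2))"
    unfolding ray_density_omega
    using ray_kernel_integrable_rotation(2)[OF n half_omega_rotation(1-3), where E = "\<lambda>_. 1" and D = 1 and lam = lam] by simp
  have "(LBINT t:{0<..}. ray_density lam n (- omega lam) t) = cnj (LBINT t:{0<..}. ray_density lam n (omega lam) t)"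
    using omega_bounds[of lam] by (intro set_integral_cnj_greaterThan ray_density_uminus) auto
  then show ?thesis
    using b_coeff_ray[OF lam half_omega_rotation(1,4,5) n] by (simp only: I)
qed

text \<open>Here the sector |arg a| < pi - \<omega> enters: the quotient x / a has argument y - Im w
  without wrapping around, hence stays away from -1.\<close>

lemma one_plus_ray_lower:
  assumes "\<bar>y\<bar> \<le> \<alpha>" "\<bar>Im w\<bar> \<le> \<beta>" "\<alpha> + \<beta> < pi" "t > 0"
  shows "sqrt ((1 + cos (\<alpha> + \<beta>)) / 2) \<le> norm (1 + of_real t * cis y / exp w)"
proof -
  let ?x = "of_real t * cis y / exp w"
  have "?x = of_real (t / exp (Re w)) * cis (y - Im w)"
    by (simp add: exp_eq_polar[of w] cis_divide[symmetric])
  moreover have b: "\<bar>y - Im w\<bar> \<le> \<alpha> + \<beta>" using assms by linarith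
  ultimately have "\<bar>Arg ?x\<bar> \<le> \<alpha> + \<beta>"
    using assms Arg_of_real_cis[of "t / exp (Re w)" "y - Im w"] by simp
  then have "sqrt ((1 + cos (\<alpha> + \<beta>)) / 2) * (norm ?x + 1) \<le> norm (?x + of_real 1)"
    using assms by (intro norm_add_real_sector) auto
  moreover have "sqrt ((1 + cos (\<alpha> + \<beta>)) / 2) * 1 \<le> sqrt ((1 + cos (\<alpha> + \<beta>)) / 2) * (norm ?x + 1)"
  proof (intro mult_left_mono)
    have "0 \<le> 1 + cos (\<alpha> + \<beta>)" using cos_ge_minus_one[of "\<alpha> + \<beta>"] by linarith
    then show "0 \<le> sqrt ((1 + cos (\<alpha> + \<beta>)) / 2)" by simp
  qed simp
  ultimately show ?thesis by (simp add: add.commute)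
qed

lemma sqrt_one_plus_cos_pos:
  assumes "0 \<le> \<gamma>" "\<gamma> < pi"
  shows "sqrt ((1 + cos \<gamma>) / 2) > 0"
proof -
  have "cos pi < cos \<gamma>" using assms by (intro cos_monotone_0_pi) auto
  then show ?thesis by simp
qed

text \<open>Up to a factor a, the Cauchy transform of the density at the point - a. These are the
  integrals in the remainder, freed of their constants.\<close>

definition ray_cauchy :: "real \<Rightarrow> nat \<Rightarrow> real \<Rightarrow> complex \<Rightarrow> complex" where
  "ray_cauchy lam n y a = (LBINT t:{0<..}. ray_density lam n y t / (1 + of_real t * cis y / a))"

lemma ray_cauchy_integrand_bound:
  assumes y: "y = omega lam \<or> y = - omega lam" and w: "\<bar>Im w\<bar> \<le> \<beta>" "\<beta> < pi - omega lam" and t: "t > 0"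
  shows "1 + of_real t * cis y / exp w \<noteq> 0"
    "norm (ray_density lam n y t / (1 + of_real t * cis y / exp w)) \<le> norm (ray_density lam n y t) / sqrt ((1 + cos (omega lam + \<beta>)) / 2)"
proof -
  note o = omega_bounds[of lam]
  have l: "sqrt ((1 + cos (omega lam + \<beta>)) / 2) \<le> norm (1 + of_real t * cis y / exp w)"
    using y w t o by (intro one_plus_ray_lower) auto
  have p: "sqrt ((1 + cos (omega lam + \<beta>)) / 2) > 0" using w o by (intro sqrt_one_plus_cos_pos) auto
  show "1 + of_real t * cis y / exp w \<noteq> 0" using l p by auto
  then show "norm (ray_density lam n y t / (1 + of_real t * cis y / exp w)) \<le> norm (ray_density lam n y t) / sqrt ((1 + cos (omega lam + \<beta>)) / 2)"
    unfolding norm_divide using l p by (intro divide_left_mono mult_pos_pos) auto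
qed

lemma set_integrable_ray_cauchy:
  assumes n: "n \<ge> 1" and y: "y = omega lam \<or> y = - omega lam" and w: "\<bar>Im w\<bar> < pi - omega lam"
  shows "set_integrable lborel {0<..} (\<lambda>t. ray_density lam n y t / (1 + of_real t * cis y / exp w))"
proof (rule set_integrable_bound_greaterThan)
  show "set_integrable lborel {0<..} (\<lambda>t. norm (ray_density lam n y t) / sqrt ((1 + cos (omega lam + \<bar>Im w\<bar>)) / 2))"
    by (intro set_integrable_divide set_integrable_norm set_integrable_ray_density n y)
  have "\<bar>y\<bar> < pi" using y omega_bounds[of lam] by auto
  then show "continuous_on {0<..} (\<lambda>t. ray_density lam n y t / (1 + of_real t * cis y / exp w))"
    using ray_cauchy_integrand_bound(1)[OF y order.refl w]
    by (intro continuous_intros continuous_on_ray_density) auto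
qed (use ray_cauchy_integrand_bound(2)[OF y order.refl w] in auto)

text \<open>From x / (1 + x / a) = a * (1 - 1 / (1 + x / a)): one more power of x is traded for a
  coefficient integral. This is the whole step from N to N + 1.\<close>

lemma ray_cauchy_Suc:
  assumes n: "n \<ge> 1" and y: "y = omega lam \<or> y = - omega lam" and w: "\<bar>Im w\<bar> < pi - omega lam"
  shows "ray_cauchy lam (Suc n) y (exp w) = exp w * ((LBINT t:{0<..}. ray_density lam n y t) - ray_cauchy lam n y (exp w))"
proof -
  have "ray_cauchy lam (Suc n) y (exp w) =
     (LBINT t:{0<..}. exp w * (ray_density lam n y t - ray_density lam n y t / (1 + of_real t * cis y / exp w)))"
    unfolding ray_cauchy_def
  proof (intro set_lebesgue_integral_cong allI impI)
    fix t :: real assume "t \<in> {0<..}"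
    then have nz: "1 + of_real t * cis y / exp w \<noteq> 0"
      using ray_cauchy_integrand_bound(1)[OF y order.refl w] by auto
    have "c * x * d / (1 + x) = c * (d - d / (1 + x))" if "1 + x \<noteq> 0" for c d x :: complex
      using that by (simp add: field_simps)
    from this[OF nz, of "exp w" "ray_density lam n y t"]
    show "ray_density lam (Suc n) y t / (1 + of_real t * cis y / exp w) =
        exp w * (ray_density lam n y t - ray_density lam n y t / (1 + of_real t * cis y / exp w))"
      by (simp add: ray_density_Suc)
  qed simp
  also have "\<dots> = exp w * ((LBINT t:{0<..}. ray_density lam n y t) - ray_cauchy lam n y (exp w))"
    unfolding ray_cauchy_def
    by (simp add: set_integral_diff(2)[OF set_integrable_ray_density[OF n y] set_integrable_ray_cauchy[OF n y w]])
  finally show ?thesis .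
qed

lemma ray_cauchy_holomorphic:
  assumes n: "n \<ge> 1" and y: "y = omega lam \<or> y = - omega lam"
  shows "(\<lambda>w. ray_cauchy lam n y (exp w)) holomorphic_on {w. \<bar>Im w\<bar> < pi - omega lam}"
proof -
  let ?V = "{w. \<bar>Im w\<bar> < pi - omega lam}"
  let ?f = "\<lambda>w t. indicator {0<..} t *\<^sub>R (ray_density lam n y t / (1 + of_real t * cis y / exp w))"
  have "(\<lambda>w. LBINT t. ?f w t) holomorphic_on ?V"
  proof (rule holomorphic_on_parametric_integral)
    show "open ?V" by (intro open_Collect_less continuous_intros)
    show "?f w \<in> borel_measurable lborel" if "w \<in> ?V" for w
      using set_integrable_ray_cauchy[OF n y, of w] that by (auto simp: set_integrable_def)
    show "(\<lambda>w. ?f w t) holomorphic_on ?V" for t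
    proof (cases "t > 0")
      case True
      then show ?thesis
        using ray_cauchy_integrand_bound(1)[OF y order.refl _ True] by (auto intro!: holomorphic_intros)
    qed simp
    fix w0 assume w0: "w0 \<in> ?V"
    \<comment> \<open>Half the distance to the edge: the ball stays in a closed strip |Im w| <=
      \<beta> inside the open one, where the denominators are bounded below uniformly in t.\<close>
    define r where "r = (pi - omega lam - \<bar>Im w0\<bar>) / 2"
    define \<beta> where "\<beta> = \<bar>Im w0\<bar> + r"
    have r: "r > 0" and \<beta>: "\<beta> < pi - omega lam" using w0 by (auto simp: r_def \<beta>_def field_simps)
    let ?g = "\<lambda>t. indicator {0<..} t *\<^sub>R (norm (ray_density lam n y t) / sqrt ((1 + cos (omega lam + \<beta>)) / 2))"
    have "set_integrable lborel {0<..} (\<lambda>t. norm (ray_density lam n y t) / sqrt ((1 + cos (omega lam + \<beta>)) / 2))"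
      by (intro set_integrable_divide set_integrable_norm set_integrable_ray_density n y)
    then have "integrable lborel ?g" by (simp add: set_integrable_def)
    moreover have "w \<in> ?V \<and> (\<forall>t\<in>space lborel. norm (?f w t) \<le> ?g t)" if w: "w \<in> ball w0 r" for w
    proof -
      have "\<bar>Im w\<bar> \<le> \<beta>"
        using w abs_Im_le_cmod[of "w0 - w"] by (auto simp: \<beta>_def dist_norm)
      then show ?thesis
        using ray_cauchy_integrand_bound(2)[OF y _ \<beta>, of w] \<beta> by (auto simp: indicator_def)
    qed
    ultimately show "\<exists>r>0. \<exists>g. integrable lborel g \<and> (\<forall>w\<in>ball w0 r. w \<in> ?V \<and> (\<forall>t\<in>space lborel. norm (?f w t) \<le> g t))"
      using r by blast
  qed
  then show ?thesis by (simp add: ray_cauchy_def set_lebesgue_integral_def)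
qed

lemma sqrt_two_pi_mult_self:
  "complex_of_real (sqrt (2 * pi)) * of_real (sqrt (2 * pi)) = 2 * of_real pi"
proof -
  have "sqrt (2 * pi) * sqrt (2 * pi) = 2 * pi" by simp
  then show ?thesis by (metis of_real_mult of_real_numeral)
qed

section \<open>Analytic continuation and general \<open>N\<close>\<close>

text \<open>Because z + a = (lam + 1) * a, all powers of lam + 1 cancel, and the powers of a leave 1
  / a^(N + 1).\<close>

lemma remainder_conv_ray_cauchy:
  assumes lam: "lam > 0" and a: "a \<noteq> 0"
  shows "remainder N a lam = (-1) ^ N / a ^ (N + 1) *
    ((ray_cauchy lam N (omega lam) a - ray_cauchy lam N (- omega lam) a) / (2 * of_real pi * \<i>))"
proof -
  let ?r = "complex_of_real (sqrt (2 * pi))"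
  have r: "?r * ?r = 2 * of_real pi" "?r \<noteq> 0"
    by (rule sqrt_two_pi_mult_self) simp
  have R: "exp (of_real ((real N + 1 / 2) * y) * \<i>) / (?r * \<i>) * (LBINT t:{0<..}. remainder_integrand N a lam y t)
      = ray_cauchy lam N y a / (2 * of_real pi * \<i>)" if y: "\<bar>y\<bar> < pi" for y
  proof -
    have "exp (of_real ((real N + 1 / 2) * y) * \<i>) * (LBINT t:{0<..}. remainder_integrand N a lam y t) =
       (LBINT t:{0<..}. exp (of_real ((real N + 1 / 2) * y) * \<i>) * remainder_integrand N a lam y t)"
      by simp
    also have "\<dots> = (LBINT t:{0<..}. (1 / ?r) * (ray_density lam N y t / (1 + of_real t * cis y / a)))"
    proof (intro set_lebesgue_integral_cong allI impI)
      fix t :: real assume t: "t \<in> {0<..}"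
      have e: "exp (of_real y * \<i>) = cis y" by (simp add: cis_conv_exp mult.commute)
      have "exp (of_real ((real N + 1 / 2) * y) * \<i>) * remainder_integrand N a lam y t
          = (exp (of_real ((real N + 1 / 2) * y) * \<i>) *
      (of_real (t powr (real N - 1 / 2) * exp (- t * norm (log_const lam))) * scaled_Gamma (of_real t * exp (of_real y * \<i>))))
            / (1 + of_real t * cis y / a)"
        by (simp only: remainder_integrand_def e times_divide_eq_left times_divide_eq_right)
      also have "\<dots> = (1 / ?r) * (ray_density lam N y t / (1 + of_real t * cis y / a))"
        using t by (subst scaled_Gamma_ray_density[OF _ y]) auto
      finally show "exp (of_real ((real N + 1 / 2) * y) * \<i>) * remainder_integrand N a lam y t
          = (1 / ?r) * (ray_density lam N y t / (1 + of_real t * cis y / a))" .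
    qed simp
    also have "\<dots> = (1 / ?r) * ray_cauchy lam N y a"
      unfolding ray_cauchy_def by (rule set_integral_mult_right)
    finally have "exp (of_real ((real N + 1 / 2) * y) * \<i>) / (?r * \<i>) * (LBINT t:{0<..}. remainder_integrand N a lam y t)
        = ray_cauchy lam N y a / (?r * ?r * \<i>)"
      using r(2) by (simp add: field_simps)
    then show ?thesis unfolding r(1) .
  qed
  note o = omega_bounds[of lam]
  let ?I = "\<lambda>y. LBINT t:{0<..}. remainder_integrand N a lam y t"
  let ?L = "complex_of_real (lam + 1)"
  have L: "?L \<noteq> 0" using lam by (auto simp: complex_eq_iff)
  have z: "of_real lam * a + a = ?L * a" by (simp add: ring_distribs)
  have c: "a ^ N / (?L * a) ^ (2 * N + 1) * ?L ^ (2 * N + 1) = 1 / a ^ (N + 1)"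
  proof -
    have "a ^ (2 * N + 1) = a ^ N * a ^ (N + 1)" by (simp add: mult_2 flip: power_add)
    then show ?thesis using a L by (simp add: power_mult_distrib del: power_Suc)
  qed
  have "remainder N a lam = (-1) ^ N * (a ^ N / (?L * a) ^ (2 * N + 1) * ?L ^ (2 * N + 1)) *
      ((exp (of_real ((real N + 1 / 2) * omega lam) * \<i>) / (?r * \<i>) * ?I (omega lam))
       - (exp (of_real ((real N + 1 / 2) * (- omega lam)) * \<i>) / (?r * \<i>) * ?I (- omega lam)))"
  proof -
    have "(-1) ^ N * A / B * C * P * I + (-1) ^ (N + 1) * A / B * C * Q * J = (-1) ^ N * (A / B * C) * (P * I - Q * J)"
      for A B C P Q I J :: complex
      by (simp add: right_diff_distrib diff_divide_distrib mult_ac)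
    then show ?thesis
      unfolding remainder_def Let_def z mult_minus_right of_real_minus by blast
  qed
  also have "\<dots> = (-1) ^ N / a ^ (N + 1) *
    ((ray_cauchy lam N (omega lam) a - ray_cauchy lam N (- omega lam) a) / (2 * of_real pi * \<i>))"
    unfolding c using R[of "omega lam"] R[of "- omega lam"] o by (simp add: diff_divide_distrib)
  finally show ?thesis .
qed

text \<open>For real a the two rays give conjugate values, so their difference is 2 i times the
  imaginary part found at the angle \<omega> / 2. The rotation to \<omega> is free of residues,
  since the pole - a of 1 / (a + x) lies on the cut.\<close>

lemma upper_incomplete_Gamma_positive_ray_cauchy:
  fixes lam a :: real
  assumes lam: "lam > 0" and a: "a > 0"
  shows "upper_incomplete_Gamma (- of_real a) (of_real lam * of_real a) =
    of_real ((lam * a) powr (- a) * exp (- (lam * a))) *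
     (1 / (of_real (lam + 1) * of_real a)
        - (ray_cauchy lam 1 (omega lam) (of_real a) - ray_cauchy lam 1 (- omega lam) (of_real a)) / (2 * of_real pi * \<i>) / of_real a ^ 2)"
proof -
  define X where "X = (LBINT l:{lam<..}. exp (- (a * (l + ln l - (lam + ln lam)))) / (1 + l)\<^sup>2)"
  define \<kappa> where "\<kappa> = sqrt ((1 + cos (omega lam)) / 2)"
  note o = omega_bounds[of lam]
  have \<kappa>: "\<kappa> > 0" unfolding \<kappa>_def using o by (intro sqrt_one_plus_cos_pos) auto
  define E where "E x = 1 / (of_real a + x)" for x :: complex
  have nz: "of_real a + x \<noteq> 0" if "x \<notin> \<real>\<^sub>\<le>\<^sub>0" for x :: complex
  proof
    assume "of_real a + x = 0"
    then have "x = of_real (- a)" by (simp add: eq_neg_iff_add_eq_0 add.commute)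
    then show False using that a by simp
  qed
  have E: "E holomorphic_on - \<real>\<^sub>\<le>\<^sub>0"
    unfolding E_def using nz by (intro holomorphic_intros) auto
  have Eb: "norm (E (of_real t * cis y)) \<le> 1 / (\<kappa> * a)"
    if t: "t > 0" and y: "omega lam / 2 \<le> y" "y \<le> omega lam" for t y
  proof -
    have "\<bar>Arg (of_real t * cis y)\<bar> \<le> omega lam"
      using Arg_of_real_cis[OF t, of y] y o by simp
    then have "\<kappa> * (norm (of_real t * cis y) + a) \<le> norm (of_real t * cis y + of_real a)"
      unfolding \<kappa>_def using a o by (intro norm_add_real_sector) auto
    moreover have "\<kappa> * a \<le> \<kappa> * (norm (of_real t * cis y) + a)" using \<kappa> by simp
    ultimately have "\<kappa> * a \<le> norm (of_real a + of_real t * cis y)" by (simp add: add.commute)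
    moreover have "\<kappa> * a > 0" using \<kappa> a by simp
    ultimately show ?thesis
      unfolding E_def norm_divide norm_one by (intro frac_le) auto
  qed
  have X: "X = Im (LBINT t:{0<..}. of_real t * cis (omega lam / 2) * ray_kernel lam (of_real t * cis (omega lam / 2))
      * cis (omega lam / 2) / (of_real a + of_real t * cis (omega lam / 2))) / pi"
    unfolding X_def by (rule cauchy_ray_integral[OF lam a half_omega_rotation(1,4,5)])
  have rot: "(LBINT t:{0<..}. (of_real t * cis (omega lam)) ^ 1 * ray_kernel lam (of_real t * cis (omega lam)) * cis (omega lam) * E (of_real t * cis (omega lam)))
     = (LBINT t:{0<..}. (of_real t * cis (omega lam / 2)) ^ 1 * ray_kernel lam (of_real t * cis (omega lam / 2)) * cis (omega lam / 2) * E (of_real t * cis (omega lam / 2)))"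
    by (rule ray_kernel_integrable_rotation(2)[OF order.refl half_omega_rotation(1-3) E Eb])
  define Y where "Y = (LBINT t:{0<..}. ray_density lam 1 (omega lam) t * E (of_real t * cis (omega lam)))"
  have XY: "X = Im Y / pi"
    using X rot by (simp add: Y_def ray_density_omega E_def)
  have c1: "ray_cauchy lam 1 (omega lam) (of_real a) = of_real a * Y"
  proof -
    have "d / (1 + x / of_real a) = of_real a * (d * E x)" for d x
      using a by (simp add: E_def divide_simps add.commute)
    then show ?thesis unfolding ray_cauchy_def Y_def by (simp only: set_integral_mult_right)
  qed
  have c2: "ray_cauchy lam 1 (- omega lam) (of_real a) = cnj (ray_cauchy lam 1 (omega lam) (of_real a))"
    unfolding ray_cauchy_def
    by (rule set_integral_cnj_greaterThan) (use o in \<open>simp add: ray_density_uminus cis_cnj\<close>)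
  have "ray_cauchy lam 1 (omega lam) (of_real a) - ray_cauchy lam 1 (- omega lam) (of_real a) = 2 * \<i> * of_real (a * Im Y)"
    unfolding c2 unfolding c1 by (simp add: complex_eq_iff)
  also have "a * Im Y = pi * (a * X)" by (simp add: XY)
  finally have "(ray_cauchy lam 1 (omega lam) (of_real a) - ray_cauchy lam 1 (- omega lam) (of_real a)) / (2 * of_real pi * \<i>) / of_real a ^ 2
     = of_real (X / a)"
    using a by (simp add: field_simps power2_eq_square)
  moreover have "complex_of_real (1 / ((lam + 1) * a) - X / a) = 1 / (of_real (lam + 1) * of_real a) - of_real (X / a)"
    by simp
  moreover have "1 / ((lam + 1) * a) - X / a = (1 / (1 + lam) - X) / a"
    by (simp add: diff_divide_distrib add.commute)
  ultimately show ?thesis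
    unfolding upper_incomplete_Gamma_positive[OF lam a] X_def[symmetric] by (simp only: of_real_mult)
qed

text \<open>Base point and exponent both move with w. The power is bounded by exp (A * |Ln b|): the
  sector bound keeps the base b away from 0, and for large u its logarithm grows more slowly than
  exp (- u) decays.\<close>

lemma upper_incomplete_Gamma_holomorphic:
  assumes lam: "lam > 0"
  shows "(\<lambda>w. upper_incomplete_Gamma (- exp w) (of_real lam * exp w)) holomorphic_on {w. \<bar>Im w\<bar> < pi}"
proof -
  let ?V = "{w :: complex. \<bar>Im w\<bar> < pi}"
  let ?b = "\<lambda>w u. of_real lam * exp w + complex_of_real u"
  let ?h = "\<lambda>w u. ?b w u powr (- exp w - 1) * exp (- ?b w u)"
  let ?f = "\<lambda>w u. indicator {0<..} u *\<^sub>R ?h w u"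
  have lower: "sqrt ((1 + cos \<beta>) / 2) * (lam * exp (Re w)) \<le> norm (?b w u)"
    if "\<bar>Im w\<bar> \<le> \<beta>" "\<beta> < pi" "u > 0" for w u \<beta>
  proof -
    have x: "of_real lam * exp w = of_real (lam * exp (Re w)) * cis (Im w)"
      by (simp add: exp_eq_polar[of w])
    have "Arg (of_real lam * exp w) = Im w"
      unfolding x using that lam by (intro Arg_of_real_cis) auto
    then have "sqrt ((1 + cos \<beta>) / 2) * (norm (of_real lam * exp w) + u) \<le> norm (?b w u)"
      using that by (intro norm_add_real_sector) auto
    moreover have "sqrt ((1 + cos \<beta>) / 2) * (lam * exp (Re w)) \<le> sqrt ((1 + cos \<beta>) / 2) * (norm (of_real lam * exp w) + u)"
    proof (intro mult_left_mono)
      have "0 \<le> 1 + cos \<beta>" using cos_ge_minus_one[of \<beta>] by linarith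
      then show "0 \<le> sqrt ((1 + cos \<beta>) / 2)" by simp
    qed (use that lam in \<open>simp add: norm_mult\<close>)
    ultimately show ?thesis by linarith
  qed
  have slit: "?b w u \<notin> \<real>\<^sub>\<le>\<^sub>0" if "w \<in> ?V" "u > 0" for w u
  proof
    assume A: "?b w u \<in> \<real>\<^sub>\<le>\<^sub>0"
    then have "sin (Im w) = 0" using lam by (simp add: complex_nonpos_Reals_iff Im_exp)
    then have "Im w = 0" using sin_eq_0_pi[of "Im w"] that by (auto simp: abs_less_iff)
    then have "Re (?b w u) > 0" using lam that by (simp add: Re_exp add_pos_pos)
    then show False using A by (simp add: complex_nonpos_Reals_iff)
  qed
  have "(\<lambda>w. LBINT u. ?f w u) holomorphic_on ?V"
  proof (rule holomorphic_on_parametric_integral)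
    show "open ?V" by (intro open_Collect_less continuous_intros)
    show "?f w \<in> borel_measurable lborel" if "w \<in> ?V" for w
    proof -
      have "continuous_on {0<..} (\<lambda>u. exp ((- exp w - 1) * Ln (?b w u)) * exp (- ?b w u))"
        using slit[OF that] by (intro continuous_intros) simp
      also have "?this \<longleftrightarrow> continuous_on {0<..} (?h w)"
      proof (intro continuous_on_cong refl)
        fix u :: real assume "u \<in> {0<..}"
        then have "?b w u \<noteq> 0" using slit[OF that, of u] by auto
        then show "exp ((- exp w - 1) * Ln (?b w u)) * exp (- ?b w u) = ?h w u"
          by (simp only: powr_def if_False)
      qed
      finally have "continuous_on {0<..} (?h w)" .
      then have "?f w \<in> borel_measurable borel"
        by (intro borel_measurable_continuous_on_indicator) auto
      then show ?thesis by simp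
    qed
    show "(\<lambda>w. ?f w u) holomorphic_on ?V" for u
    proof (cases "u > 0")
      case True
      then show ?thesis using slit[of _ u] by (auto intro!: holomorphic_intros)
    qed simp
    fix w0 assume w0: "w0 \<in> ?V"
    define r where "r = (pi - \<bar>Im w0\<bar>) / 2"
    define \<beta> where "\<beta> = \<bar>Im w0\<bar> + r"
    define \<rho> where "\<rho> = \<bar>Re w0\<bar> + r"
    have r: "r > 0" and \<beta>: "0 \<le> \<beta>" "\<beta> < pi" using w0 by (auto simp: r_def \<beta>_def field_simps)
    define c0 where "c0 = sqrt ((1 + cos \<beta>) / 2) * (lam * exp (- \<rho>))"
    have c0: "c0 > 0" unfolding c0_def using lam sqrt_one_plus_cos_pos[OF \<beta>] by simp
    \<comment> \<open>Near w0, \<open>A\<close> bounds the modulus of the exponent - exp w - 1 and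
      \<open>B + u\<close> that of the base; \<open>K\<close> collects everything independent of
      u.\<close>
    define A where "A = exp \<rho> + 1"
    define B where "B = lam * exp \<rho> + 1"
    have A: "A > 0" and B: "B \<ge> 1" using lam by (auto simp: A_def B_def add_pos_pos)
    define K where "K = exp (A * (\<bar>ln c0\<bar> + ln (2 * A) + pi) + B / 2 + lam * exp \<rho>)"
    let ?g = "\<lambda>u. indicator {0<..} u *\<^sub>R (K * exp (- (u / 2)))"
    have "set_integrable lborel {0<..} (\<lambda>u. K * (u ^ 0 * exp (- (1 / 2 * u))))"
      by (intro set_integrable_mult_right set_integrable_power_exp_real) simp
    then have "integrable lborel ?g" by (simp add: set_integrable_def)
    moreover have "w \<in> ?V \<and> (\<forall>u\<in>space lborel. norm (?f w u) \<le> ?g u)" if w: "w \<in> ball w0 r" for w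
    proof -
      have Imw: "\<bar>Im w\<bar> \<le> \<beta>" and Rew: "\<bar>Re w\<bar> \<le> \<rho>"
        using w abs_Im_le_cmod[of "w0 - w"] abs_Re_le_cmod[of "w0 - w"] by (auto simp: \<beta>_def \<rho>_def dist_norm)
      then have V: "w \<in> ?V" using \<beta> by simp
      have nw: "norm (exp w) \<le> exp \<rho>" using Rew by (simp add: norm_exp_eq_Re)
      have "norm (?h w u) \<le> K * exp (- (u / 2))" if u: "u > 0" for u
      proof -
        have b0: "?b w u \<noteq> 0" using slit[OF V u] by auto
        have "c0 \<le> sqrt ((1 + cos \<beta>) / 2) * (lam * exp (Re w))"
          unfolding c0_def using Rew lam sqrt_one_plus_cos_pos[OF \<beta>] by (intro mult_left_mono) auto
        also have "\<dots> \<le> norm (?b w u)" by (rule lower[OF Imw \<beta>(2) u])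
        finally have lo: "c0 \<le> norm (?b w u)" .
        have "norm (?b w u) \<le> norm (of_real lam * exp w) + norm (complex_of_real u)" by (rule norm_triangle_ineq)
        also have "norm (of_real lam * exp w) \<le> lam * exp \<rho>"
          using nw lam by (simp add: norm_mult)
        finally have hi: "norm (?b w u) \<le> B + u" using u by (simp add: B_def)
        have "ln (norm (?b w u)) \<ge> ln c0" using lo c0 by (intro ln_mono)
        moreover have "ln (norm (?b w u)) \<le> ln (B + u)" using hi b0 by (intro ln_mono) simp_all
        moreover have "ln (B + u) \<ge> 0" using B u by simp
        ultimately have lnb: "\<bar>ln (norm (?b w u))\<bar> \<le> \<bar>ln c0\<bar> + ln (B + u)" by linarith
        have "A * ln (B + u) \<le> B / 2 + u / 2 + A * ln (2 * A)"
        proof -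
          \<comment> \<open>The scale 2 * A is chosen so that A times the logarithm uses up only u /
            2, leaving half of the decay exp (- u).\<close>
          have "ln ((B + u) / (2 * A)) \<le> (B + u) / (2 * A) - 1"
            using A B u by (intro ln_le_minus_one) auto
          then have "ln (B + u) \<le> (B + u) / (2 * A) + ln (2 * A)"
            using A B u by (simp add: ln_div)
          then have "A * ln (B + u) \<le> A * ((B + u) / (2 * A) + ln (2 * A))"
            using A by (intro mult_left_mono) auto
          also have "\<dots> = B / 2 + u / 2 + A * ln (2 * A)" using A by (simp add: field_simps)
          finally show ?thesis .
        qed
        moreover have "norm (Ln (?b w u)) \<le> \<bar>ln c0\<bar> + ln (B + u) + pi"
          using norm_Ln_le[OF b0] lnb by linarith
        then have "A * norm (Ln (?b w u)) \<le> A * (\<bar>ln c0\<bar> + ln (B + u) + pi)"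
          using A by (intro mult_left_mono) auto
        moreover have "norm ((- exp w - 1) * Ln (?b w u)) \<le> A * norm (Ln (?b w u))"
        proof -
          have "norm (- exp w - 1) \<le> A"
            using norm_triangle_ineq4[of "- exp w" 1] nw unfolding A_def norm_minus_cancel norm_one by linarith
          then show ?thesis unfolding norm_mult by (intro mult_right_mono) auto
        qed
        moreover have "- Re (?b w u) \<le> lam * exp \<rho> - u"
        proof -
          have "- Re (exp w) \<le> exp \<rho>" using abs_Re_le_cmod[of "exp w"] nw by linarith
          then have "lam * (- Re (exp w)) \<le> lam * exp \<rho>" using lam by (intro mult_left_mono) auto
          then show ?thesis by simp
        qed
        ultimately have e: "norm ((- exp w - 1) * Ln (?b w u)) + - Re (?b w u)
            \<le> (A * (\<bar>ln c0\<bar> + ln (2 * A) + pi) + B / 2 + lam * exp \<rho>) - u / 2"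
          by (simp only: ring_distribs)
        have "norm (?h w u) \<le> exp (norm ((- exp w - 1) * Ln (?b w u))) * exp (- Re (?b w u))"
        proof -
          have "norm (?b w u powr (- exp w - 1)) \<le> exp (norm ((- exp w - 1) * Ln (?b w u)))"
            using b0 by (simp only: powr_def if_False norm_exp)
          moreover have "norm (exp (- ?b w u)) = exp (- Re (?b w u))"
            by (simp only: norm_exp_eq_Re uminus_complex.sel)
          ultimately show ?thesis
            unfolding norm_mult[of "_ powr _"] by (simp only: mult_right_mono exp_ge_zero)
        qed
        also have "\<dots> = exp (norm ((- exp w - 1) * Ln (?b w u)) + - Re (?b w u))" by (simp only: exp_add)
        also have "\<dots> \<le> exp ((A * (\<bar>ln c0\<bar> + ln (2 * A) + pi) + B / 2 + lam * exp \<rho>) - u / 2)"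
          using e by (simp only: exp_le_cancel_iff)
        also have "\<dots> = K * exp (- (u / 2))" by (simp only: K_def diff_conv_add_uminus exp_add)
        finally show ?thesis .
      qed
      then show ?thesis using V by (simp add: indicator_def)
    qed
    ultimately show "\<exists>r>0. \<exists>g. integrable lborel g \<and> (\<forall>w\<in>ball w0 r. w \<in> ?V \<and> (\<forall>u\<in>space lborel. norm (?f w u) \<le> g u))"
      using r by blast
  qed
  then show ?thesis by (simp add: upper_incomplete_Gamma_def set_lebesgue_integral_def)
qed

text \<open>With \<open>a = exp w\<close> the sector becomes a convex strip.\<close>
lemma upper_incomplete_Gamma_ray_cauchy:
  assumes lam: "lam > 0" and w: "\<bar>Im w\<bar> < pi - omega lam"
  shows "upper_incomplete_Gamma (- exp w) (of_real lam * exp w) * exp (exp w * (of_real (ln lam) + w)) * exp (of_real lam * exp w)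
    = 1 / (of_real (lam + 1) * exp w) -
      (ray_cauchy lam 1 (omega lam) (exp w) - ray_cauchy lam 1 (- omega lam) (exp w)) / (2 * of_real pi * \<i>) / exp w ^ 2"
    (is "?lhs w = ?rhs w")
proof -
  let ?V = "{w. \<bar>Im w\<bar> < pi - omega lam}"
  note o = omega_bounds[of lam]
  have L: "complex_of_real lam + 1 \<noteq> 0" using lam by (auto simp: complex_eq_iff)
  have V: "?V = {w. Im w < pi - omega lam} \<inter> {w. - (pi - omega lam) < Im w}" by auto
  have op: "open ?V" by (intro open_Collect_less continuous_intros)
  have conn: "connected ?V"
    unfolding V by (intro convex_connected convex_Int convex_halfspace_Im_lt convex_halfspace_Im_gt)
  have hol: "(\<lambda>w. ?lhs w - ?rhs w) holomorphic_on ?V"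
  proof (intro holomorphic_intros)
    show "(\<lambda>w. upper_incomplete_Gamma (- exp w) (of_real lam * exp w)) holomorphic_on ?V"
      by (rule holomorphic_on_subset[OF upper_incomplete_Gamma_holomorphic[OF lam]]) (use o in auto)
    show "(\<lambda>w. ray_cauchy lam 1 (omega lam) (exp w)) holomorphic_on ?V"
      "(\<lambda>w. ray_cauchy lam 1 (- omega lam) (exp w)) holomorphic_on ?V"
      by (intro ray_cauchy_holomorphic; simp)+
  qed (use L in auto)
  have sub: "complex_of_real ` UNIV \<subseteq> ?V" using o by auto
  have zero: "0 \<in> ?V" using o by simp
  have lim: "(0 :: complex) islimpt complex_of_real ` UNIV"
    unfolding islimpt_approachable
  proof (intro allI impI)
    fix e :: real assume "e > 0"
    then show "\<exists>x'\<in>complex_of_real ` UNIV. x' \<noteq> 0 \<and> dist x' 0 < e"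
      by (intro bexI[OF _ rangeI[of complex_of_real "e / 2"]]) auto
  qed
  \<comment> \<open>A real z means a = exp z > 0, the case already settled. There the two
    exponentials in \<open>?lhs\<close> are the reciprocal of the prefactor, written without
    principal powers so that they are entire in w.\<close>
  have eq: "?lhs z - ?rhs z = 0" if zr: "z \<in> complex_of_real ` UNIV" for z
  proof -
    obtain x where z: "z = of_real x" using zr by auto
    define a where "a = exp x"
    have a: "a > 0" "exp z = of_real a" "ln a = x" by (simp_all add: a_def z exp_of_real)
    have e1: "exp (exp z * (of_real (ln lam) + z)) * exp (of_real lam * exp z) = of_real (exp (a * ln (lam * a)) * exp (lam * a))"
      using lam a by (simp add: z ln_mult exp_of_real[symmetric])
    have "(lam * a) powr (- a) * exp (- (lam * a)) * (exp (a * ln (lam * a)) * exp (lam * a)) = 1"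
      using lam a by (simp add: powr_def exp_minus field_simps)
    then have e2: "complex_of_real ((lam * a) powr (- a) * exp (- (lam * a))) * of_real (exp (a * ln (lam * a)) * exp (lam * a)) = 1"
      by (simp flip: of_real_mult)
    have e3: "upper_incomplete_Gamma (- exp z) (of_real lam * exp z) = of_real ((lam * a) powr (- a) * exp (- (lam * a))) * ?rhs z"
      using upper_incomplete_Gamma_positive_ray_cauchy[OF lam a(1)] unfolding a(2) .
    have "U * p * q = R" if "U = c * R" "p * q = E" "c * E = 1" for U p q c E R :: complex
    proof -
      have "U * p * q = (c * (p * q)) * R" unfolding that(1) by (simp only: mult_ac)
      then show ?thesis using that by simp
    qed
    from this[OF e3 e1 e2] show ?thesis by simp
  qed
  have "w \<in> ?V" using w by simp
  from analytic_continuation[OF hol op conn sub zero lim eq this]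
  have "?lhs w - ?rhs w = 0" .
  then show ?thesis by simp
qed

text \<open>By \<open>ray_cauchy_Suc\<close>, remainder n is the n-th term plus remainder n + 1 for
  n >= 1, so the value of sum plus remainder does not change with N. At N = 1 it is the continued
  identity, with 1 / (z + a) as the term for b_0 = 1.\<close>

lemma upper_incomplete_Gamma_expansion:
  assumes lam: "lam > 0" and a: "a \<noteq> 0" "\<bar>Arg a\<bar> < - omega lam + pi" and N: "N \<ge> 1"
  shows "upper_incomplete_Gamma (- a) (of_real lam * a) =
    (of_real lam * a) powr (- a) * exp (- (of_real lam * a))
      * ((\<Sum>n<N. a ^ n * b_coeff n lam / (of_real lam * a + a) ^ (2 * n + 1)) + remainder N a lam)"
proof -
  define w where "w = Ln a"
  have w: "exp w = a" "\<bar>Im w\<bar> < pi - omega lam"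
    using a by (simp_all add: w_def Arg_eq_Im_Ln)
  let ?L = "complex_of_real (lam + 1)"
  have L: "?L \<noteq> 0" using lam by (auto simp: complex_eq_iff)
  have z: "of_real lam * a + a = ?L * a" by (simp add: ring_distribs)
  define C where "C n = (ray_cauchy lam n (omega lam) a - ray_cauchy lam n (- omega lam) a) / (2 * of_real pi * \<i>)" for n
  define D where "D n = ((LBINT t:{0<..}. ray_density lam n (omega lam) t) - (LBINT t:{0<..}. ray_density lam n (- omega lam) t)) / (2 * of_real pi * \<i>)" for n
  have rem: "remainder n a lam = (-1) ^ n / a ^ (n + 1) * C n" for n
    using remainder_conv_ray_cauchy[OF lam a(1)] by (simp add: C_def)
  have CS: "C (Suc n) = a * (D n - C n)" if "n \<ge> 1" for n
  proof -
    have "(a * (d1 - c1) - a * (d2 - c2)) / c = a * ((d1 - d2) / c - (c1 - c2) / c)" for c d1 d2 c1 c2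
      by (simp add: diff_divide_distrib[symmetric] times_divide_eq_right[symmetric] algebra_simps)
    then show ?thesis
      using ray_cauchy_Suc[OF that _ w(2), of "omega lam"] ray_cauchy_Suc[OF that _ w(2), of "- omega lam"]
      unfolding C_def D_def w(1) by simp
  qed
  have bD: "a ^ n * b_coeff n lam / (?L * a) ^ (2 * n + 1) = (-1) ^ n * D n / a ^ (n + 1)" if "n \<ge> 1" for n
  proof -
    have "a ^ (2 * n + 1) = a ^ n * a ^ (n + 1)" by (simp add: mult_2 flip: power_add)
    moreover have "b_coeff n lam = (-1) ^ n * ?L ^ (2 * n + 1) * D n"
      using b_coeff_ray_density[OF lam that] by (simp add: D_def)
    ultimately show ?thesis using L a(1) by (simp add: power_mult_distrib del: power_Suc)
  qed
  have rem_step: "remainder n a lam = a ^ n * b_coeff n lam / (?L * a) ^ (2 * n + 1) + remainder (Suc n) a lam" if "n \<ge> 1" for n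
    unfolding bD[OF that] rem CS[OF that] using a(1) by (simp add: field_simps)
  have base: "upper_incomplete_Gamma (- a) (of_real lam * a) =
    (of_real lam * a) powr (- a) * exp (- (of_real lam * a)) * (1 / (?L * a) + remainder 1 a lam)"
  proof -
    \<comment> \<open>The principal logarithm is additive here because lam is a positive real; so
      the entire prefactor of the continuation is the principal power.\<close>
    have "Ln (of_real lam * a) = of_real (ln lam) + w"
      unfolding w_def using lam a(1) by (subst Ln_times_of_real) (auto simp: Ln_of_real)
    then have "(of_real lam * a) powr (- a) = exp (- (a * (of_real (ln lam) + w)))"
      using lam a(1) by (simp add: powr_def)
    moreover have "remainder 1 a lam = - (C 1 / a ^ 2)" by (simp add: rem power2_eq_square)
    moreover have "upper_incomplete_Gamma (- a) (of_real lam * a) * exp (a * (of_real (ln lam) + w)) * exp (of_real lam * a)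
        = 1 / (?L * a) - C 1 / a ^ 2"
      using upper_incomplete_Gamma_ray_cauchy[OF lam w(2)] unfolding w(1) C_def .
    moreover have "U = exp (- p) * exp (- q) * (U * exp p * exp q)" for U p q :: complex
      by (simp add: exp_minus field_simps)
    ultimately show ?thesis by (metis diff_conv_add_uminus)
  qed
  have "(\<Sum>n<N. a ^ n * b_coeff n lam / (?L * a) ^ (2 * n + 1)) + remainder N a lam = 1 / (?L * a) + remainder 1 a lam"
    using N
  proof (induction N rule: dec_induct)
    case base
    show ?case by (simp add: b_coeff_0)
  next
    case (step n)
    then show ?case using rem_step[of n] by (simp only: sum.lessThan_Suc add.assoc)
  qed
  then show ?thesis unfolding z base by simp
qed

lemma set_integrable_remainder_integrand:
  assumes a: "a \<noteq> 0" "\<bar>Arg a\<bar> < - omega lam + pi" and N: "N \<ge> 1" and y: "y = omega lam \<or> y = - omega lam"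
  shows "set_integrable lborel {0<..} (remainder_integrand N a lam y)"
proof -
  define w where "w = Ln a"
  have w: "exp w = a" "\<bar>Im w\<bar> < pi - omega lam"
    using a by (simp_all add: w_def Arg_eq_Im_Ln)
  let ?c = "exp (- (of_real ((real N + 1 / 2) * y) * \<i>)) / of_real (sqrt (2 * pi))"
  have "set_integrable lborel {0<..} (\<lambda>t. ?c * (ray_density lam N y t / (1 + of_real t * cis y / a)))"
    using set_integrable_ray_cauchy[OF N y w(2)] unfolding w(1) by (intro set_integrable_mult_right)
  also have "?this \<longleftrightarrow> set_integrable lborel {0<..} (remainder_integrand N a lam y)"
  proof (rule set_integrable_cong)
    fix t :: real assume t: "t \<in> {0<..}"
    have e: "exp (of_real y * \<i>) = cis y" by (simp add: cis_conv_exp mult.commute)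
    have y': "\<bar>y\<bar> < pi" using y omega_bounds[of lam] by auto
    have "?c * (ray_density lam N y t / (1 + of_real t * cis y / a)) =
       exp (- (of_real ((real N + 1 / 2) * y) * \<i>)) * (ray_density lam N y t / of_real (sqrt (2 * pi))) / (1 + of_real t * cis y / a)"
      by simp
    also have "\<dots> = (exp (- (of_real ((real N + 1 / 2) * y) * \<i>)) * exp (of_real ((real N + 1 / 2) * y) * \<i>)) *
       (of_real (t powr (real N - 1 / 2) * exp (- t * norm (log_const lam))) * scaled_Gamma (of_real t * exp (of_real y * \<i>))) / (1 + of_real t * cis y / a)"
      using t by (subst scaled_Gamma_ray_density[OF _ y', symmetric]) (auto simp only: mult.assoc greaterThan_iff)
    also have "exp (- (of_real ((real N + 1 / 2) * y) * \<i>)) * exp (of_real ((real N + 1 / 2) * y) * \<i>) = 1"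
      by (simp flip: exp_add)
    finally show "?c * (ray_density lam N y t / (1 + of_real t * cis y / a)) = remainder_integrand N a lam y t"
      by (simp add: remainder_integrand_def e)
  qed simp_all
  finally show ?thesis .
qed

lemma b_integrand_conv_ray_density:
  assumes "t > 0"
  shows "b_integrand n lam t = (ray_density lam n (omega lam) t - ray_density lam n (- omega lam) t) / of_real (sqrt (2 * pi))"
proof -
  have o: "\<bar>omega lam\<bar> < pi" "\<bar>- omega lam\<bar> < pi" using omega_bounds[of lam] by auto
  show ?thesis
    unfolding diff_divide_distrib scaled_Gamma_ray_density[OF assms o(1), symmetric] scaled_Gamma_ray_density[OF assms o(2), symmetric]
    by (simp add: b_integrand_def right_diff_distrib mult_ac)
qed

theorem theorem1p1:
  fixes lam :: real
  assumes "lam > 0"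
  shows
    "(\<forall>(a::complex) (z::complex) (N::nat).
        a \<noteq> 0 \<and> z = complex_of_real lam * a \<and> N \<ge> 1 \<and> \<bar>Arg a\<bar> < - omega lam + pi \<longrightarrow>
          set_integrable lborel {0<..} (remainder_integrand N a lam (omega lam)) \<and>
          set_integrable lborel {0<..} (remainder_integrand N a lam (- omega lam)) \<and>
          upper_incomplete_Gamma (- a) z =
            z powr (- a) * exp (- z)
            * ((\<Sum>n<N. a ^ n * b_coeff n lam / (z + a) ^ (2 * n + 1)) + remainder N a lam))
     \<and>
     (\<forall>n::nat. n \<ge> 1 \<longrightarrow>
        set_integrable lborel {0<..} (b_integrand n lam) \<and>
        b_coeff n lam =
          (-1) ^ n * (complex_of_real (lam + 1) ^ (2 * n + 1) / (complex_of_real (sqrt (2 * pi)) * \<i>))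
          * (LBINT t:{0<..}. b_integrand n lam t))"
proof (intro conjI allI impI; (elim conjE)?)
  fix a z :: complex and N :: nat
  assume "a \<noteq> 0" "z = complex_of_real lam * a" "N \<ge> 1" "\<bar>Arg a\<bar> < - omega lam + pi"
  then show "set_integrable lborel {0<..} (remainder_integrand N a lam (omega lam))"
    "set_integrable lborel {0<..} (remainder_integrand N a lam (- omega lam))"
    "upper_incomplete_Gamma (- a) z =
            z powr (- a) * exp (- z)
            * ((\<Sum>n<N. a ^ n * b_coeff n lam / (z + a) ^ (2 * n + 1)) + remainder N a lam)"
    using set_integrable_remainder_integrand upper_incomplete_Gamma_expansion[OF assms] by auto
next
  fix n :: nat assume n: "n \<ge> 1"
  let ?r = "complex_of_real (sqrt (2 * pi))"
  let ?d = "\<lambda>t. (1 / ?r) * (ray_density lam n (omega lam) t - ray_density lam n (- omega lam) t)"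
  have i: "set_integrable lborel {0<..} (ray_density lam n (omega lam))"
    "set_integrable lborel {0<..} (ray_density lam n (- omega lam))"
    using set_integrable_ray_density[OF n] by auto
  have "set_integrable lborel {0<..} ?d" by (intro set_integrable_mult_right set_integral_diff i)
  also have "?this \<longleftrightarrow> set_integrable lborel {0<..} (b_integrand n lam)"
    by (intro set_integrable_cong) (auto simp: b_integrand_conv_ray_density)
  finally show "set_integrable lborel {0<..} (b_integrand n lam)" .
  have "(LBINT t:{0<..}. b_integrand n lam t) = (LBINT t:{0<..}. ?d t)"
    by (intro set_lebesgue_integral_cong) (auto simp: b_integrand_conv_ray_density)
  also have "\<dots> = (1 / ?r) * ((LBINT t:{0<..}. ray_density lam n (omega lam) t) - (LBINT t:{0<..}. ray_density lam n (- omega lam) t))"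
    unfolding set_integral_mult_right by (subst set_integral_diff(2)[OF i]) simp
  finally have I: "(LBINT t:{0<..}. b_integrand n lam t) = \<dots>" .
  have r: "2 * of_real pi * \<i> = ?r * \<i> * ?r"
    unfolding sqrt_two_pi_mult_self[symmetric] by (simp only: mult_ac)
  show "b_coeff n lam = (-1) ^ n * (complex_of_real (lam + 1) ^ (2 * n + 1) / (?r * \<i>)) * (LBINT t:{0<..}. b_integrand n lam t)"
    unfolding b_coeff_ray_density[OF assms n] I r by simp
qed

end
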